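(* If a countable group $\Gamma$ has an infinite amenable subgroup $H\subset\Gamma$, then all pmp $\Gamma$-actions that are co-induced from free ergodic pmp $H$-actions are weakly conjugate to one another.
   Context: Probability spaces are standard; pmp means probability measure preserving. A pmp action $G\curvearrowright^\sigma(X,\mu)$ induces an action on $L^\infty(X)$, still denoted $\sigma$, by $\sigma_g(a)(t)=a(\sigma_{g^{-1}}(t))$; $\tau$ denotes integration. Weak conjugacy (for two pmp actions $\sigma,\rho$ of the same countable group $G$ on $X$, $Y$): $\sigma$ is weakly embeddable into $\rho$ if for all finite $F\subset G$, projections $p_1,\dots,p_n\in L^\infty(X)$, $K\ge1$, $\varepsilon>0$ there are projections $q_1,\dots,q_n\in L^\infty(Y)$ with $|\tau(\prod_{i=1}^k\sigma_{g_i}(p_{n_i}))-\tau(\prod_{i=1}^k\rho_{g_i}(q_{n_i}))|<\varepsilon$ for all $1\le k\le K$, $g_1,\dots,g_k\in F$, $1\le n_1,\dots,n_k\le n$. The actions are weakly conjugate if each is weakly embeddable into the other. Co-induction: let $H\subset\Gamma$ and $H\curvearrowright^\sigma(A,\tau)$ be a trace preserving action, $A=L^\infty(X)$. Let $S\subset\Gamma$ be a set of representatives of $\Gamma/H$, define $\pi:\Gamma\to H$ by $\pi(sh)=h$ ($s\in S,h\in H$) and $c:\Gamma\times\Gamma/H\to H$ by $c(g,sH)=\pi(gs)\pi(s)^{-1}$, $s\in S$. On $\tilde A=A^{\overline\otimes\,\Gamma/H}=L^\infty(\tilde X)$, $\tilde X=X^{\Gamma/H}$, writing $\tilde a_{sH}$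 for the elementary tensor with $a$ in position $sH$ and $1$ elsewhere, the co-induced action is determined by $\tilde\sigma_g(\tilde a_{sH})=\tilde b_{gsH}$ with $b=\sigma_{c(g,sH)}(a)$. *)

theory Defs
  imports
    "HOL-Probability.Probability"
    "HOL-Algebra.Left_Coset"
    "HOL-Algebra.Group_Action"
begin

section \<open>Amenability\<close>

definition amenable :: "('g, 'm) monoid_scheme \<Rightarrow> bool" where
  "amenable G \<longleftrightarrow> group G \<and>
     (\<exists>m :: 'g set \<Rightarrow> real.
        (\<forall>A. A \<subseteq> carrier G \<longrightarrow> 0 \<le> m A) \<and>
        m (carrier G) = 1 \<and>
        (\<forall>A B. A \<subseteq> carrier G \<longrightarrow> B \<subseteq> carrier G \<longrightarrow> A \<inter> B = {} \<longrightarrow> m (A \<union> B) = m A + m B) \<and>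
        (\<forall>g\<in>carrier G. \<forall>A. A \<subseteq> carrier G \<longrightarrow> m (g <#\<^bsub>G\<^esub> A) = m A))"


section \<open>Probability measure preserving actions\<close>

text \<open>The underlying measurable space is the Borel space of a Polish topology.\<close>

definition standard_prob_space :: "'x measure \<Rightarrow> bool" where
  "standard_prob_space M \<longleftrightarrow> prob_space M \<and>
     (\<exists>T. topspace T = space M \<and> completely_metrizable_space T \<and> second_countable T \<and>
          sets M = sigma_sets (space M) {U. openin T U})"

text \<open>By the convention of \<^const>\<open>BijGroup\<close>, the map \<open>\<sigma> g\<close> is \<^const>\<open>undefined\<close> outside
  \<open>space M\<close>; this only fixes a representative.\<close>

definition pmp_action :: "('g, 'm) monoid_scheme \<Rightarrow> 'x measure \<Rightarrow> ('g \<Rightarrow> 'x \<Rightarrow> 'x) \<Rightarrow> bool" where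
  "pmp_action G M \<sigma> \<longleftrightarrow> prob_space M \<and> group_action G (space M) \<sigma> \<and>
     (\<forall>g\<in>carrier G. \<sigma> g \<in> measurable M M \<and> distr M M (\<sigma> g) = M)"

definition free_action :: "('g, 'm) monoid_scheme \<Rightarrow> 'x measure \<Rightarrow> ('g \<Rightarrow> 'x \<Rightarrow> 'x) \<Rightarrow> bool" where
  "free_action G M \<sigma> \<longleftrightarrow> (\<forall>g\<in>carrier G. g \<noteq> \<one>\<^bsub>G\<^esub> \<longrightarrow> (AE x in M. \<sigma> g x \<noteq> x))"

definition ergodic_action :: "('g, 'm) monoid_scheme \<Rightarrow> 'x measure \<Rightarrow> ('g \<Rightarrow> 'x \<Rightarrow> 'x) \<Rightarrow> bool" where
  "ergodic_action G M \<sigma> \<longleftrightarrow>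
     (\<forall>A\<in>sets M. (\<forall>g\<in>carrier G. \<sigma> g -` A \<inter> space M = A) \<longrightarrow> measure M A = 0 \<or> measure M A = 1)"

section \<open>Weak conjugacy\<close>

text \<open>Elements of \<open>L\<^sup>\<infinity>\<close> are represented by functions; all notions below respect
  almost everywhere equality.\<close>

definition Linfty :: "'x measure \<Rightarrow> ('x \<Rightarrow> complex) set" where
  "Linfty M = {a \<in> borel_measurable M. \<exists>C. AE x in M. cmod (a x) \<le> C}"

definition Linfty_projection :: "'x measure \<Rightarrow> ('x \<Rightarrow> complex) \<Rightarrow> bool" where
  "Linfty_projection M p \<longleftrightarrow>
     p \<in> Linfty M \<and> (AE x in M. cnj (p x) = p x) \<and> (AE x in M. p x * p x = p x)"

definition induced_action ::
  "('g, 'm) monoid_scheme \<Rightarrow> ('g \<Rightarrow> 'x \<Rightarrow> 'x) \<Rightarrow> 'g \<Rightarrow> ('x \<Rightarrow> complex) \<Rightarrow> 'x \<Rightarrow> complex" where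
  "induced_action G \<sigma> g a = (\<lambda>t. a (\<sigma> (inv\<^bsub>G\<^esub> g) t))"

definition weakly_embeddable ::
  "('g, 'm) monoid_scheme \<Rightarrow> 'x measure \<Rightarrow> ('g \<Rightarrow> 'x \<Rightarrow> 'x) \<Rightarrow> 'y measure \<Rightarrow> ('g \<Rightarrow> 'y \<Rightarrow> 'y) \<Rightarrow> bool"
where
  "weakly_embeddable G M \<sigma> N \<rho> \<longleftrightarrow>
     (\<forall>F (n::nat) p (K::nat) (\<epsilon>::real).
        finite F \<longrightarrow> F \<subseteq> carrier G \<longrightarrow> (\<forall>i\<in>{1..n}. Linfty_projection M (p i)) \<longrightarrow> 1 \<le> K \<longrightarrow> 0 < \<epsilon> \<longrightarrow>
        (\<exists>q. (\<forall>i\<in>{1..n}. Linfty_projection N (q i)) \<and>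
             (\<forall>k\<in>{1..K}. \<forall>(g::nat \<Rightarrow> 'g) (m::nat \<Rightarrow> nat).
                (\<forall>i\<in>{1..k}. g i \<in> F \<and> m i \<in> {1..n}) \<longrightarrow>
                cmod ((\<integral>t. (\<Prod>i=1..k. induced_action G \<sigma> (g i) (p (m i)) t) \<partial>M)
                    - (\<integral>t. (\<Prod>i=1..k. induced_action G \<rho> (g i) (q (m i)) t) \<partial>N)) < \<epsilon>)))"

definition weakly_conjugate ::
  "('g, 'm) monoid_scheme \<Rightarrow> 'x measure \<Rightarrow> ('g \<Rightarrow> 'x \<Rightarrow> 'x) \<Rightarrow> 'y measure \<Rightarrow> ('g \<Rightarrow> 'y \<Rightarrow> 'y) \<Rightarrow> bool"
where
  "weakly_conjugate G M \<sigma> N \<rho> \<longleftrightarrow>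
     weakly_embeddable G M \<sigma> N \<rho> \<and> weakly_embeddable G N \<rho> M \<sigma>"


section \<open>Co-induction\<close>

definition coset_representatives :: "('g, 'm) monoid_scheme \<Rightarrow> 'g set \<Rightarrow> 'g set \<Rightarrow> bool" where
  "coset_representatives G H S \<longleftrightarrow>
     S \<subseteq> carrier G \<and> (\<forall>C\<in>lcosets\<^bsub>G\<^esub> H. \<exists>!s. s \<in> S \<and> s <#\<^bsub>G\<^esub> H = C)"

definition coset_rep :: "('g, 'm) monoid_scheme \<Rightarrow> 'g set \<Rightarrow> 'g set \<Rightarrow> 'g set \<Rightarrow> 'g" where
  "coset_rep G H S C = (THE s. s \<in> S \<and> s <#\<^bsub>G\<^esub> H = C)"

definition coset_proj :: "('g, 'm) monoid_scheme \<Rightarrow> 'g set \<Rightarrow> 'g set \<Rightarrow> 'g \<Rightarrow> 'g" where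
  "coset_proj G H S g = inv\<^bsub>G\<^esub> (coset_rep G H S (g <#\<^bsub>G\<^esub> H)) \<otimes>\<^bsub>G\<^esub> g"

definition coset_cocycle :: "('g, 'm) monoid_scheme \<Rightarrow> 'g set \<Rightarrow> 'g set \<Rightarrow> 'g \<Rightarrow> 'g set \<Rightarrow> 'g" where
  "coset_cocycle G H S g C =
     coset_proj G H S (g \<otimes>\<^bsub>G\<^esub> coset_rep G H S C) \<otimes>\<^bsub>G\<^esub> inv\<^bsub>G\<^esub> (coset_proj G H S (coset_rep G H S C))"

definition coinduced_space :: "('g, 'm) monoid_scheme \<Rightarrow> 'g set \<Rightarrow> 'x measure \<Rightarrow> ('g set \<Rightarrow> 'x) measure" where
  "coinduced_space G H M = (\<Pi>\<^sub>M C\<in>lcosets\<^bsub>G\<^esub> H. M)"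

text \<open>The point transformations \<open>(g t)\<^bsub>gC\<^esub> = \<sigma>\<^bsub>c(g,C)\<^esub> (t\<^bsub>C\<^esub>)\<close>. That they induce the usual
  action on elementary tensors and form a pmp action is shown in
  \<open>induced_action_coinduced_action\<close> and \<open>pmp_action_coinduced_action\<close> below.\<close>

definition coinduced_action ::
  "('g, 'm) monoid_scheme \<Rightarrow> 'g set \<Rightarrow> 'g set \<Rightarrow> 'x measure \<Rightarrow> ('g \<Rightarrow> 'x \<Rightarrow> 'x) \<Rightarrow>
   'g \<Rightarrow> ('g set \<Rightarrow> 'x) \<Rightarrow> ('g set \<Rightarrow> 'x)"
where
  "coinduced_action G H S M \<sigma> g =
     (\<lambda>t\<in>space (coinduced_space G H M). \<lambda>C\<in>lcosets\<^bsub>G\<^esub> H.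
        \<sigma> (coset_cocycle G H S g (inv\<^bsub>G\<^esub> g <#\<^bsub>G\<^esub> C)) (t (inv\<^bsub>G\<^esub> g <#\<^bsub>G\<^esub> C)))"

lemma coset_rep:
  assumes "coset_representatives G H S" "C \<in> lcosets\<^bsub>G\<^esub> H"
  shows "coset_rep G H S C \<in> S" "coset_rep G H S C <#\<^bsub>G\<^esub> H = C"
    "coset_rep G H S C \<in> carrier G"
proof -
  have "\<exists>!s. s \<in> S \<and> s <#\<^bsub>G\<^esub> H = C"
    using assms by (auto simp: coset_representatives_def)
  from theI'[OF this] show "coset_rep G H S C \<in> S" "coset_rep G H S C <#\<^bsub>G\<^esub> H = C"
    by (auto simp: coset_rep_def)
  then show "coset_rep G H S C \<in> carrier G"
    using assms by (auto simp: coset_representatives_def)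
qed

lemma lcosets_translate:
  assumes "group G" "subgroup H G" "g \<in> carrier G" "C \<in> lcosets\<^bsub>G\<^esub> H"
  shows "g <#\<^bsub>G\<^esub> C \<in> lcosets\<^bsub>G\<^esub> H"
proof -
  interpret group G by fact
  show ?thesis
    using assms subgroup.subset[OF assms(2)] by (auto simp: LCOSETS_def lcos_m_assoc)
qed

lemma lcosets_translate_translate:
  assumes "group G" "subgroup H G" "g \<in> carrier G" "h \<in> carrier G" "C \<in> lcosets\<^bsub>G\<^esub> H"
  shows "g <#\<^bsub>G\<^esub> (h <#\<^bsub>G\<^esub> C) = (g \<otimes>\<^bsub>G\<^esub> h) <#\<^bsub>G\<^esub> C"
  using assms by (meson group.lcos_m_assoc subgroup.lcosets_carrier)

lemma lcosets_translate_one: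
  assumes "group G" "subgroup H G" "C \<in> lcosets\<^bsub>G\<^esub> H"
  shows "\<one>\<^bsub>G\<^esub> <#\<^bsub>G\<^esub> C = C"
  using assms by (meson group.lcos_mult_one subgroup.lcosets_carrier)

lemma lcoset_mult_coset_rep:
  assumes "group G" "subgroup H G" "coset_representatives G H S" "g \<in> carrier G"
    "C \<in> lcosets\<^bsub>G\<^esub> H"
  shows "(g \<otimes>\<^bsub>G\<^esub> coset_rep G H S C) <#\<^bsub>G\<^esub> H = g <#\<^bsub>G\<^esub> C"
  using group.lcos_m_assoc[OF assms(1) subgroup.subset[OF assms(2)] assms(4)
      coset_rep(3)[OF assms(3,5)]] coset_rep(2)[OF assms(3,5)] by simp

lemma coset_cocycle_eq:
  assumes "group G" "subgroup H G" "coset_representatives G H S" "g \<in> carrier G"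
    "C \<in> lcosets\<^bsub>G\<^esub> H"
  shows "coset_cocycle G H S g C =
    inv\<^bsub>G\<^esub> (coset_rep G H S (g <#\<^bsub>G\<^esub> C)) \<otimes>\<^bsub>G\<^esub> (g \<otimes>\<^bsub>G\<^esub> coset_rep G H S C)"
proof -
  interpret group G by fact
  have C: "coset_rep G H S C \<in> carrier G" and gC: "coset_rep G H S (g <#\<^bsub>G\<^esub> C) \<in> carrier G"
    using coset_rep(3)[OF assms(3)] lcosets_translate[OF assms(1,2,4,5)] assms(5) by blast+
  have 1: "coset_proj G H S (coset_rep G H S C) = \<one>\<^bsub>G\<^esub>"
    unfolding coset_proj_def coset_rep(2)[OF assms(3,5)] by (rule l_inv[OF C])
  show ?thesis
    unfolding coset_cocycle_def 1 unfolding coset_proj_def lcoset_mult_coset_rep[OF assms] inv_one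
    by (intro r_one m_closed inv_closed C gC assms(4))
qed

lemma coset_cocycle_in:
  assumes "group G" "subgroup H G" "coset_representatives G H S" "g \<in> carrier G"
    "C \<in> lcosets\<^bsub>G\<^esub> H"
  shows "coset_cocycle G H S g C \<in> H"
proof -
  interpret group G by fact
  have D: "g <#\<^bsub>G\<^esub> C \<in> lcosets\<^bsub>G\<^esub> H"
    using lcosets_translate[OF assms(1,2,4,5)] .
  have "g \<otimes>\<^bsub>G\<^esub> coset_rep G H S C \<in> (g \<otimes>\<^bsub>G\<^esub> coset_rep G H S C) <#\<^bsub>G\<^esub> H"
    by (intro lcos_self m_closed assms coset_rep(3)[OF assms(3,5)])
  then have "g \<otimes>\<^bsub>G\<^esub> coset_rep G H S C \<in> coset_rep G H S (g <#\<^bsub>G\<^esub> C) <#\<^bsub>G\<^esub> H"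
    unfolding lcoset_mult_coset_rep[OF assms] coset_rep(2)[OF assms(3) D] .
  from subgroup.lcos_module_imp[OF assms(2,1) coset_rep(3)[OF assms(3) D] this] show ?thesis
    unfolding coset_cocycle_eq[OF assms] .
qed

lemma coset_cocycle_mult:
  assumes "group G" "subgroup H G" "coset_representatives G H S" "g \<in> carrier G" "h \<in> carrier G"
    "C \<in> lcosets\<^bsub>G\<^esub> H"
  shows "coset_cocycle G H S (g \<otimes>\<^bsub>G\<^esub> h) C =
    coset_cocycle G H S g (h <#\<^bsub>G\<^esub> C) \<otimes>\<^bsub>G\<^esub> coset_cocycle G H S h C"
proof -
  interpret group G by fact
  have hC: "h <#\<^bsub>G\<^esub> C \<in> lcosets\<^bsub>G\<^esub> H" and ghC: "(g \<otimes>\<^bsub>G\<^esub> h) <#\<^bsub>G\<^esub> C \<in> lcosets\<^bsub>G\<^esub> H"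
    using lcosets_translate[OF assms(1,2)] assms(4-6) m_closed by auto
  have cancel: "inv\<^bsub>G\<^esub> z \<otimes>\<^bsub>G\<^esub> ((g \<otimes>\<^bsub>G\<^esub> h) \<otimes>\<^bsub>G\<^esub> x) =
      inv\<^bsub>G\<^esub> z \<otimes>\<^bsub>G\<^esub> (g \<otimes>\<^bsub>G\<^esub> y) \<otimes>\<^bsub>G\<^esub> (inv\<^bsub>G\<^esub> y \<otimes>\<^bsub>G\<^esub> (h \<otimes>\<^bsub>G\<^esub> x))"
    if "x \<in> carrier G" "y \<in> carrier G" "z \<in> carrier G" for x y z
  proof -
    have "y \<otimes>\<^bsub>G\<^esub> (inv\<^bsub>G\<^esub> y \<otimes>\<^bsub>G\<^esub> (h \<otimes>\<^bsub>G\<^esub> x)) = h \<otimes>\<^bsub>G\<^esub> x"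
      using that assms(5) m_assoc[of y "inv\<^bsub>G\<^esub> y" "h \<otimes>\<^bsub>G\<^esub> x"] by simp
    then show ?thesis
      using that assms(4,5) by (simp add: m_assoc)
  qed
  have gh: "g \<otimes>\<^bsub>G\<^esub> h \<in> carrier G"
    using assms(4,5) by (rule m_closed)
  show ?thesis
    unfolding coset_cocycle_eq[OF assms(1-3) gh assms(6)] coset_cocycle_eq[OF assms(1-4) hC]
      coset_cocycle_eq[OF assms(1-3,5,6)] lcosets_translate_translate[OF assms(1,2,4,5,6)]
    by (intro cancel coset_rep(3)[OF assms(3)] assms(6) hC ghC)
qed

lemma coset_cocycle_one:
  assumes "group G" "subgroup H G" "coset_representatives G H S" "C \<in> lcosets\<^bsub>G\<^esub> H"
  shows "coset_cocycle G H S \<one>\<^bsub>G\<^esub> C = \<one>\<^bsub>G\<^esub>"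
proof -
  interpret group G by fact
  show ?thesis
    using assms coset_rep(3)[OF assms(3,4)]
    by (simp add: coset_cocycle_eq lcosets_translate_one)
qed

lemma coset_cocycle_inv:
  assumes "group G" "subgroup H G" "coset_representatives G H S" "g \<in> carrier G"
    "C \<in> lcosets\<^bsub>G\<^esub> H"
  shows "coset_cocycle G H S (inv\<^bsub>G\<^esub> g) (g <#\<^bsub>G\<^esub> C) = inv\<^bsub>G\<^esub> (coset_cocycle G H S g C)"
proof -
  interpret group G by fact
  have "coset_cocycle G H S (inv\<^bsub>G\<^esub> g) (g <#\<^bsub>G\<^esub> C) \<otimes>\<^bsub>G\<^esub> coset_cocycle G H S g C = \<one>\<^bsub>G\<^esub>"
    using coset_cocycle_mult[of G H S "inv\<^bsub>G\<^esub> g" g C] coset_cocycle_one[of G H S C] assms by simp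
  moreover have "coset_cocycle G H S g C \<in> carrier G"
      "coset_cocycle G H S (inv\<^bsub>G\<^esub> g) (g <#\<^bsub>G\<^esub> C) \<in> carrier G"
    using coset_cocycle_in[OF assms(1,2,3)] assms lcosets_translate[OF assms(1,2)]
      subgroup.subset[OF assms(2)] by (meson inv_closed subsetD)+
  ultimately show ?thesis
    using inv_equality by metis
qed

text \<open>With \<open>b = \<sigma>\<^bsub>c(g,C)\<^esub>(a)\<close>, the co-induced action maps the elementary tensor with \<open>a\<close> in
  position \<open>C\<close> to the elementary tensor with \<open>b\<close> in position \<open>gC\<close>.\<close>

lemma induced_action_coinduced_action:
  assumes "group G" "subgroup H G" "coset_representatives G H S" "g \<in> carrier G"
    "C \<in> lcosets\<^bsub>G\<^esub> H" "t \<in> space (coinduced_space G H M)"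
  shows "induced_action G (coinduced_action G H S M \<sigma>) g (\<lambda>t. a (t C)) t =
    induced_action (G\<lparr>carrier := H\<rparr>) \<sigma> (coset_cocycle G H S g C) a (t (g <#\<^bsub>G\<^esub> C))"
proof -
  interpret group G by fact
  have "inv\<^bsub>G\<lparr>carrier := H\<rparr>\<^esub> (coset_cocycle G H S g C) = inv\<^bsub>G\<^esub> (coset_cocycle G H S g C)"
    using m_inv_consistent[OF assms(2)] coset_cocycle_in[OF assms(1-5)] by simp
  then show ?thesis
    using assms coset_cocycle_inv[OF assms(1-5)]
    by (simp add: induced_action_def coinduced_action_def)
qed

lemma space_coinduced_space: "space (coinduced_space G H M) = (lcosets\<^bsub>G\<^esub> H) \<rightarrow>\<^sub>E space M"
  by (simp add: coinduced_space_def space_PiM)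

lemma pmp_action_coinduced_action:
  assumes G: "group G" and H: "subgroup H G" and S: "coset_representatives G H S"
    and act: "pmp_action (G\<lparr>carrier := H\<rparr>) M \<sigma>"
  shows "pmp_action G (coinduced_space G H M) (coinduced_action G H S M \<sigma>)"
proof -
  interpret group G by fact
  interpret M: prob_space M
    using act by (simp add: pmp_action_def)
  interpret P: product_prob_space "\<lambda>_::'a set. M" "lcosets\<^bsub>G\<^esub> H"
    by unfold_locales
  let ?L = "lcosets\<^bsub>G\<^esub> H" and ?X = "coinduced_space G H M" and ?c = "coset_cocycle G H S"
  let ?a = "coinduced_action G H S M \<sigma>"
  have ga: "group_action (G\<lparr>carrier := H\<rparr>) (space M) \<sigma>"
    using act by (simp add: pmp_action_def)
  have meas: "\<sigma> h \<in> measurable M M" and distr: "distr M M (\<sigma> h) = M" if "h \<in> H" for h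
    using act that by (auto simp: pmp_action_def)
  have mult: "\<sigma> (h \<otimes>\<^bsub>G\<^esub> k) x = \<sigma> h (\<sigma> k x)" if "h \<in> H" "k \<in> H" "x \<in> space M" for h k x
    using group_action.composition_rule[OF ga, of x h k] that by simp
  have one: "\<sigma> \<one>\<^bsub>G\<^esub> x = x" if "x \<in> space M" for x
    using fun_cong[OF group_action.id_eq_one[OF ga], of x] that by simp
  have L: "g <#\<^bsub>G\<^esub> C \<in> ?L" if "g \<in> carrier G" "C \<in> ?L" for g C
    using lcosets_translate[OF G H that] .
  have c: "?c g C \<in> H" if "g \<in> carrier G" "C \<in> ?L" for g C
    using coset_cocycle_in[OF G H S that] .
  have a_eq: "?a g t (g <#\<^bsub>G\<^esub> C) = \<sigma> (?c g C) (t C)"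
    if "g \<in> carrier G" "C \<in> ?L" "t \<in> space ?X" for g C t
    using that L lcosets_translate_translate[OF G H, of "inv\<^bsub>G\<^esub> g" g C] lcosets_translate_one[OF G H]
    by (simp add: coinduced_action_def)
  have a_space: "?a g t \<in> space ?X" if "g \<in> carrier G" "t \<in> space ?X" for g t
    using that L c measurable_space[OF meas] unfolding coinduced_action_def space_coinduced_space
    by (auto simp: PiE_iff)
  have surj: "\<exists>D\<in>?L. C = g <#\<^bsub>G\<^esub> D" if "g \<in> carrier G" "C \<in> ?L" for g C
    using that L[of "inv\<^bsub>G\<^esub> g" C] lcosets_translate_translate[OF G H, of g "inv\<^bsub>G\<^esub> g" C]
      lcosets_translate_one[OF G H, of C] by (intro bexI[of _ "inv\<^bsub>G\<^esub> g <#\<^bsub>G\<^esub> C"]) auto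
  have ext: "t = t'" if "t \<in> space ?X" "t' \<in> space ?X" "\<And>C. C \<in> ?L \<Longrightarrow> t C = t' C" for t t'
    using that unfolding space_coinduced_space by (intro PiE_ext) auto
  have a_mult: "?a (g \<otimes>\<^bsub>G\<^esub> h) t = ?a g (?a h t)"
    if g: "g \<in> carrier G" and h: "h \<in> carrier G" and t: "t \<in> space ?X" for g h t
  proof (rule ext)
    show "?a (g \<otimes>\<^bsub>G\<^esub> h) t \<in> space ?X" "?a g (?a h t) \<in> space ?X"
      using g h t by (auto intro!: a_space)
    fix C assume "C \<in> ?L"
    then obtain D where D: "D \<in> ?L" "C = (g \<otimes>\<^bsub>G\<^esub> h) <#\<^bsub>G\<^esub> D"
      using surj[of "g \<otimes>\<^bsub>G\<^esub> h"] g h by auto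
    have "t D \<in> space M"
      using t D by (auto simp: space_coinduced_space)
    moreover have "C = g <#\<^bsub>G\<^esub> (h <#\<^bsub>G\<^esub> D)"
      using lcosets_translate_translate[OF G H g h D(1)] D(2) by simp
    ultimately show "?a (g \<otimes>\<^bsub>G\<^esub> h) t C = ?a g (?a h t) C"
      using a_eq[of "g \<otimes>\<^bsub>G\<^esub> h" D t] a_eq[OF h D(1) t] a_eq[OF g L[OF h D(1)] a_space[OF h t]]
        coset_cocycle_mult[OF G H S g h D(1)] mult[OF c[OF g L[OF h D(1)]] c[OF h D(1)]] g h t D
      by simp
  qed
  have a_one: "?a \<one>\<^bsub>G\<^esub> t = t" if t: "t \<in> space ?X" for t
  proof (rule ext)
    fix C assume C: "C \<in> ?L"
    have "t C \<in> space M"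
      using t C by (auto simp: space_coinduced_space)
    then show "?a \<one>\<^bsub>G\<^esub> t C = t C"
      using a_eq[of "\<one>\<^bsub>G\<^esub>" C t] C t lcosets_translate_one[OF G H C] coset_cocycle_one[OF G H S C] one
      by simp
  qed (use t a_space in auto)
  have a_bij: "?a g \<in> Bij (space ?X)" if g: "g \<in> carrier G" for g
  proof -
    have "bij_betw (?a g) (space ?X) (space ?X)"
      by (rule bij_betw_byWitness[where f' = "?a (inv\<^bsub>G\<^esub> g)"])
        (use g a_space a_one a_mult[of g "inv\<^bsub>G\<^esub> g"] a_mult[of "inv\<^bsub>G\<^esub> g" g] in auto)
    moreover have "?a g \<in> extensional (space ?X)"
      by (simp add: coinduced_action_def)
    ultimately show ?thesis
      by (simp add: Bij_def)
  qed
  have "group_action G (space ?X) ?a"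
    unfolding group_action_def group_hom_def group_hom_axioms_def
  proof (intro conjI G group_BijGroup homI)
    fix g h assume g: "g \<in> carrier G" and h: "h \<in> carrier G"
    have "?a (g \<otimes>\<^bsub>G\<^esub> h) = compose (space ?X) (?a g) (?a h)"
    proof
      fix t show "?a (g \<otimes>\<^bsub>G\<^esub> h) t = compose (space ?X) (?a g) (?a h) t"
        using a_mult[OF g h, of t]
        by (cases "t \<in> space ?X") (auto simp: compose_def coinduced_action_def)
    qed
    then show "?a (g \<otimes>\<^bsub>G\<^esub> h) = ?a g \<otimes>\<^bsub>BijGroup (space ?X)\<^esub> ?a h"
      using a_bij g h by (simp add: BijGroup_def)
  qed (use a_bij in \<open>simp add: BijGroup_def\<close>)
  moreover have "?a g \<in> measurable ?X ?X" if g: "g \<in> carrier G" for g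
  proof -
    have "(\<lambda>t. \<lambda>C\<in>?L. \<sigma> (?c g (inv\<^bsub>G\<^esub> g <#\<^bsub>G\<^esub> C)) (t (inv\<^bsub>G\<^esub> g <#\<^bsub>G\<^esub> C))) \<in> measurable ?X ?X"
      unfolding coinduced_space_def
    proof (rule measurable_restrict)
      fix C assume "C \<in> ?L"
      then have C: "inv\<^bsub>G\<^esub> g <#\<^bsub>G\<^esub> C \<in> ?L"
        using g L by simp
      show "(\<lambda>t. \<sigma> (?c g (inv\<^bsub>G\<^esub> g <#\<^bsub>G\<^esub> C)) (t (inv\<^bsub>G\<^esub> g <#\<^bsub>G\<^esub> C))) \<in> measurable (PiM ?L (\<lambda>_. M)) M"
        by (rule measurable_compose[OF measurable_component_singleton[OF C] meas[OF c[OF g C]]])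
    qed
    then show ?thesis
      by (rule measurable_cong[THEN iffD1, rotated]) (simp add: coinduced_action_def)
  qed
  moreover have "distr ?X ?X (?a g) = ?X" if g: "g \<in> carrier G" and m: "?a g \<in> measurable ?X ?X" for g
    unfolding coinduced_space_def
  proof (rule measure_eqI_PiM_infinite)
    show "finite_measure (distr (PiM ?L (\<lambda>_. M)) (PiM ?L (\<lambda>_. M)) (?a g))"
      using m by (intro prob_space.finite_measure P.prob_space_distr) (simp add: coinduced_space_def)
    fix A J assume J: "finite J" "J \<subseteq> ?L" and A: "\<And>C. C \<in> J \<Longrightarrow> A C \<in> sets M"
    let ?i = "\<lambda>C. inv\<^bsub>G\<^esub> g <#\<^bsub>G\<^esub> C" and ?I = "(\<lambda>C. inv\<^bsub>G\<^esub> g <#\<^bsub>G\<^esub> C) ` J"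
    let ?B = "\<lambda>D. \<sigma> (?c g D) -` A (g <#\<^bsub>G\<^esub> D) \<inter> space M"
    have gi: "g <#\<^bsub>G\<^esub> ?i C = C" if "C \<in> ?L" for C
      using g that lcosets_translate_translate[OF G H, of g "inv\<^bsub>G\<^esub> g" C]
        lcosets_translate_one[OF G H, of C] by simp
    have I: "?I \<subseteq> ?L" "finite ?I" and inj: "inj_on ?i J"
      using J g L gi by (auto intro!: inj_on_inverseI[of _ "\<lambda>D. g <#\<^bsub>G\<^esub> D"])
    have em: "emeasure M (?B (?i C)) = emeasure M (A C)" if "C \<in> J" for C
      using emeasure_distr[OF meas[OF c[OF g]] A, of "?i C" C] distr[OF c[OF g], of "?i C"] that J g L gi
      by (auto simp: subset_iff)
    have B: "?B D \<in> sets M" if "D \<in> ?I" for D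
      using that J g L A gi by (auto intro!: measurable_sets[OF meas] c)
    have "?a g -` prod_emb ?L (\<lambda>_. M) J (Pi\<^sub>E J A) \<inter> space ?X = prod_emb ?L (\<lambda>_. M) ?I (Pi\<^sub>E ?I ?B)"
    proof (rule Set.set_eqI)
      fix t
      show "t \<in> ?a g -` prod_emb ?L (\<lambda>_. M) J (Pi\<^sub>E J A) \<inter> space ?X \<longleftrightarrow>
            t \<in> prod_emb ?L (\<lambda>_. M) ?I (Pi\<^sub>E ?I ?B)"
      proof (cases "t \<in> space ?X")
        case True
        have "?a g t C = \<sigma> (?c g (?i C)) (t (?i C))" "t (?i C) \<in> space M" if "C \<in> J" for C
          using a_eq[OF g, of "?i C" t] that True J g L gi
          by (auto simp: subset_iff space_coinduced_space)
        then show ?thesis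
          using True a_space[OF g True] J gi unfolding space_coinduced_space
          by (auto simp: prod_emb_def subset_iff PiE_iff)
      next
        case False
        then show ?thesis
          by (auto simp: prod_emb_def space_coinduced_space)
      qed
    qed
    then have "emeasure (distr ?X ?X (?a g)) (prod_emb ?L (\<lambda>_. M) J (Pi\<^sub>E J A)) =
        emeasure ?X (prod_emb ?L (\<lambda>_. M) ?I (Pi\<^sub>E ?I ?B))"
      using J A by (subst emeasure_distr[OF m]) (auto simp: coinduced_space_def intro!: sets_PiM_I)
    also have "\<dots> = (\<Prod>D\<in>?I. emeasure M (?B D))"
      unfolding coinduced_space_def using I B by (intro P.emeasure_PiM_emb) auto
    also have "\<dots> = (\<Prod>C\<in>J. emeasure M (A C))"
      using inj em by (subst prod.reindex) auto
    also have "\<dots> = emeasure ?X (prod_emb ?L (\<lambda>_. M) J (Pi\<^sub>E J A))"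
      unfolding coinduced_space_def using J A by (intro P.emeasure_PiM_emb[symmetric]) auto
    finally show "emeasure (distr (PiM ?L (\<lambda>_. M)) (PiM ?L (\<lambda>_. M)) (?a g))
          (prod_emb ?L (\<lambda>_. M) J (Pi\<^sub>E J A)) =
        emeasure (PiM ?L (\<lambda>_. M)) (prod_emb ?L (\<lambda>_. M) J (Pi\<^sub>E J A))"
      by (simp add: coinduced_space_def)
  qed simp_all
  moreover have "prob_space ?X"
    unfolding coinduced_space_def by (rule P.prob_space_axioms)
  ultimately show ?thesis
    unfolding pmp_action_def by blast
qed

end

theory Submission
  imports Defs "HOL-Library.Nat_Bijection" "HOL-Combinatorics.Permutations"
begin

text \<open>
  The theorem combines two facts.

  The first concerns actions of the amenable group \<open>H\<close> itself (\<open>amenable_weak_containment\<close>): if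
  \<open>\<sigma>\<close> is free and \<open>\<rho>\<close> is any probability measure preserving action on \<open>N\<close>, then every finite
  labelling \<open>f\<close> of \<open>N\<close> is imitated by a labelling \<open>f'\<close> of \<open>M\<close>: for a finite window \<open>F\<close> of group
  elements, the pattern \<open>(f' (\<sigma> h x))\<close>, \<open>h \<in> F\<close>, at a random point \<open>x\<close> has nearly the distribution of
  \<open>(f (\<rho> h y))\<close> at a random \<open>y\<close>. The labelling \<open>f'\<close> comes from a competition. Cut \<open>M\<close> into many small
  cells, put the cells in a random order and attach to each cell a random point of \<open>N\<close>. Let \<open>K\<close> be a
  Folner set. A point \<open>z\<close> looks at the translates \<open>\<sigma> (inv k) z\<close>, \<open>k \<in> K\<close>, picks the one whose cell comes
  first, and reads off \<open>f (\<rho> k y)\<close>, where \<open>y\<close> is the point attached to that cell. For all \<open>h \<in> F\<close> the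
  point \<open>\<sigma> h x\<close> looks at a subset of one and the same set \<open>V\<close> of translates of \<open>x\<close>, and by the Folner
  property these subsets fill almost all of \<open>V\<close>. By symmetry of the random order, the winner in \<open>V\<close> then
  most probably lies in all of them, so that all \<open>\<sigma> h x\<close> pick the same translate \<open>\<sigma> v x\<close>. If \<open>y\<close> is
  attached to its cell, the pattern at \<open>x\<close> is \<open>(f (\<rho> h (\<rho> (inv v) y)))\<close>: an exact sample of the
  patterns of \<open>\<rho>\<close>, because \<open>\<rho> (inv v)\<close> preserves the measure. Such samples are independent for
  different winning cells, and as cells are small a law of large numbers holds: some choice of order and
  attached points produces nearly the right frequencies. Freeness enters where a point is required to have
  its translates in different cells.

  The existence of Folner sets is derived from the invariant mean by Hall's marriage theorem: without them
  some finite set would at least double every finite set, and a matching would turn this into a paradoxical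
  decomposition of the group.

  The second fact is that co-induction preserves this kind of imitation
  (\<open>coinduced_weakly_embeddable\<close>). A measurable set in \<open>N\<^sup>\<Gamma>\<^sup>/\<^sup>H\<close> is approximated by one that depends on
  the labels of finitely many coordinates only. Any joint event formed from translates of such sets is an event
  about \<open>H\<close>-patterns in finitely many independent coordinates, so replacing \<open>f\<close> by \<open>f'\<close> in every
  coordinate changes its probability by little. Different systems of coset representatives lead to
  cohomologous cocycles (\<open>coset_cocycle_change\<close>), and the coboundary is absorbed by the invariance of the
  measure.
\<close>

section \<open>The marriage theorem for countable families\<close>

text \<open>
  Only finite subfamilies are constrained, so the index set may be infinite; the members must then be
  finite, for otherwise the marriage theorem fails.
\<close>
definition hall_family :: "'i set \<Rightarrow> ('i \<Rightarrow> 'a set) \<Rightarrow> bool" where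
  "hall_family I A \<longleftrightarrow> (\<forall>i\<in>I. finite (A i)) \<and>
     (\<forall>J. finite J \<longrightarrow> J \<subseteq> I \<longrightarrow> card J \<le> card (\<Union>(A ` J)))"

lemma hall_familyD: "hall_family I A \<Longrightarrow> finite J \<Longrightarrow> J \<subseteq> I \<Longrightarrow> card J \<le> card (\<Union>(A ` J))"
  by (simp add: hall_family_def)

text \<open>
  Rado's argument: if removing \<open>x\<close> and removing \<open>y\<close> both violate the condition, then counting the
  union and the intersection of the two violating subfamilies contradicts the condition for \<open>A\<close>.
\<close>
lemma hall_family_remove:
  assumes A: "hall_family I A" and i: "i \<in> I" and x: "x \<in> A i" and y: "y \<in> A i" and "x \<noteq> y"
  shows "hall_family I (A(i := A i - {x})) \<or> hall_family I (A(i := A i - {y}))"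
proof (rule ccontr)
  have fin: "finite (A j)" if "j \<in> I" for j
    using A that by (auto simp: hall_family_def)
  have hall: "card J \<le> card (\<Union>(A ` J))" if "finite J" "J \<subseteq> I" for J
    using A that by (auto simp: hall_family_def)
  have witness: "\<exists>J. finite J \<and> J \<subseteq> I - {i} \<and> card (\<Union>(A ` J) \<union> (A i - {z})) \<le> card J"
    if not_hall: "\<not> hall_family I (A(i := A i - {z}))" for z
  proof -
    have "\<forall>j\<in>I. finite ((A(i := A i - {z})) j)"
      using fin by auto
    then obtain J where J: "finite J" "J \<subseteq> I" "card (\<Union>(A(i := A i - {z}) ` J)) < card J"
      using not_hall unfolding hall_family_def by (meson not_le)
    have "i \<in> J"
    proof (rule ccontr)
      assume "i \<notin> J"
      then have "\<Union>(A(i := A i - {z}) ` J) = \<Union>(A ` J)" by (auto split: if_splits)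
      then show False using J hall by (metis not_le)
    qed
    then have "\<Union>(A(i := A i - {z}) ` J) = \<Union>(A ` (J - {i})) \<union> (A i - {z})"
      by (auto split: if_splits)
    then show ?thesis
      using J \<open>i \<in> J\<close> by (intro exI[of _ "J - {i}"]) auto
  qed
  assume "\<not> ?thesis"
  then have not: "\<not> hall_family I (A(i := A i - {x}))" "\<not> hall_family I (A(i := A i - {y}))"
    by simp_all
  obtain J where J: "finite J" "J \<subseteq> I - {i}" "card (\<Union>(A ` J) \<union> (A i - {x})) \<le> card J"
    using witness[OF not(1)] by blast
  obtain K where K: "finite K" "K \<subseteq> I - {i}" "card (\<Union>(A ` K) \<union> (A i - {y})) \<le> card K"
    using witness[OF not(2)] by blast
  let ?P = "\<Union>(A ` J) \<union> (A i - {x})" and ?Q = "\<Union>(A ` K) \<union> (A i - {y})"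
  have finPQ: "finite ?P" "finite ?Q"
    using J K fin i by auto
  have "?P \<union> ?Q = \<Union>(A ` insert i (J \<union> K))"
    using x y \<open>x \<noteq> y\<close> by auto
  moreover have "card (insert i (J \<union> K)) \<le> card (\<Union>(A ` insert i (J \<union> K)))"
    using J K i by (intro hall) auto
  ultimately have "card (insert i (J \<union> K)) \<le> card (?P \<union> ?Q)"
    by simp
  moreover have "card (insert i (J \<union> K)) = Suc (card (J \<union> K))"
    using J K by (intro card_insert_disjoint) auto
  moreover have "card (J \<inter> K) \<le> card (?P \<inter> ?Q)"
  proof -
    have "card (J \<inter> K) \<le> card (\<Union>(A ` (J \<inter> K)))"
      using J K by (intro hall) auto
    also have "\<dots> \<le> card (?P \<inter> ?Q)"
      using finPQ by (intro card_mono) auto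
    finally show ?thesis .
  qed
  moreover have "card ?P + card ?Q = card (?P \<union> ?Q) + card (?P \<inter> ?Q)"
    using finPQ by (rule card_Un_Int)
  moreover have "card J + card K = card (J \<union> K) + card (J \<inter> K)"
    using J K by (intro card_Un_Int) auto
  ultimately show False
    using J(3) K(3) by linarith
qed

lemma hall_family_nonempty: "hall_family I A \<Longrightarrow> i \<in> I \<Longrightarrow> A i \<noteq> {}"
  unfolding hall_family_def by (auto dest!: spec[of _ "{i}"])

lemma hall_family_singleton:
  assumes "hall_family I A" "i \<in> I"
  shows "\<exists>x\<in>A i. hall_family I (A(i := {x}))"
  using assms
proof (induction "card (A i)" arbitrary: A rule: less_induct)
  case less
  have fin: "finite (A i)"
    using less.prems by (auto simp: hall_family_def)
  obtain x where x: "x \<in> A i"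
    using hall_family_nonempty[OF less.prems] by blast
  show ?case
  proof (cases "A i = {x}")
    case True
    then have "A(i := {x}) = A" by (metis fun_upd_triv)
    then show ?thesis using x less.prems(1) by (intro bexI[of _ x]) simp_all
  next
    case False
    then obtain y where y: "y \<in> A i" "x \<noteq> y"
      using x by blast
    obtain z where z: "z \<in> A i" "hall_family I (A(i := A i - {z}))"
      using hall_family_remove[OF less.prems x y] x y by blast
    have "card (A i - {z}) < card (A i)"
      using fin z(1) by (rule card_Diff1_less)
    then have "\<exists>x\<in>A i - {z}. hall_family I ((A(i := A i - {z}))(i := {x}))"
      using less.hyps[of "A(i := A i - {z})"] z less.prems by simp
    then show ?thesis by auto
  qed
qed

text \<open>
  Shrink the members to singletons one after the other. Every finite subfamily becomes final after finitely
  many steps, at which the condition still holds; for two indices it says that their singletons differ.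
\<close>
theorem hall_countable:
  assumes A: "hall_family I A" and I: "countable I"
  shows "\<exists>f. inj_on f I \<and> (\<forall>i\<in>I. f i \<in> A i)"
proof (cases "I = {}")
  case False
  define e where "e = from_nat_into I"
  have e: "e n \<in> I" for n
    unfolding e_def using False by (rule from_nat_into)
  have e_surj: "\<exists>n. i = e n" if "i \<in> I" for i
    using from_nat_into_surj[OF I that] unfolding e_def by metis
  have "\<exists>B. \<forall>n. (hall_family I (B n) \<and> (\<forall>i. B n i \<subseteq> A i)) \<and>
      (\<exists>x\<in>B n (e n). B (Suc n) = (B n)(e n := {x}))"
  proof (rule dependent_nat_choice)
    show "\<exists>B. hall_family I B \<and> (\<forall>i. B i \<subseteq> A i)"
      using A by blast
    fix B n assume B: "hall_family I B \<and> (\<forall>i. B i \<subseteq> A i)"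
    from hall_family_singleton[OF conjunct1[OF B] e[of n]]
    obtain x where x: "x \<in> B (e n)" "hall_family I (B(e n := {x}))" by blast
    with B show "\<exists>B'. (hall_family I B' \<and> (\<forall>i. B' i \<subseteq> A i)) \<and>
        (\<exists>x\<in>B (e n). B' = B(e n := {x}))"
      by (intro exI[of _ "B(e n := {x})"]) auto
  qed
  then obtain B where B: "\<And>n. hall_family I (B n)"
      "\<And>n. \<exists>x\<in>B n (e n). B (Suc n) = (B n)(e n := {x})" "\<And>n i. B n i \<subseteq> A i"
    by blast
  have "\<exists>x. B (Suc n) (e n) = {x}" for n
    using B(2)[of n] by auto
  then have "\<forall>i\<in>I. \<exists>x n. B n i = {x}"
    using e_surj by metis
  then obtain f where f: "\<forall>i\<in>I. \<exists>n. B n i = {f i}"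
    by metis
  have stable: "B (n + k) i = {f i}" if "i \<in> I" "B n i = {f i}" for n k i
  proof (induction k)
    case (Suc k)
    have "B (n + Suc k) i \<subseteq> B (n + k) i"
      using B(2)[of "n + k"] by (auto split: if_splits)
    then show ?case
      using Suc hall_family_nonempty[OF B(1) that(1), of "n + Suc k"] by auto
  qed (use that in simp)
  have "inj_on f I"
  proof (rule inj_onI, rule ccontr)
    fix i j assume ij: "i \<in> I" "j \<in> I" "f i = f j" "i \<noteq> j"
    obtain n where n: "B n i = {f i}" using f ij by blast
    obtain m where m: "B m j = {f j}" using f ij by blast
    have *: "B (n + m) i = {f i}" "B (n + m) j = {f j}"
      using stable[OF ij(1) n, of m] stable[OF ij(2) m, of n] by (auto simp: add.commute)
    have "card {i, j} \<le> card (\<Union>(B (n + m) ` {i, j}))"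
      using ij by (intro hall_familyD[OF B(1)]) auto
    then show False
      using * ij by simp
  qed
  moreover have "f i \<in> A i" if "i \<in> I" for i
    using f that B(3) by (metis insert_subset)
  ultimately show ?thesis by blast
qed simp

section \<open>Folner sets from an invariant mean\<close>

lemma (in group) set_mult_singleton_one: "K \<subseteq> carrier G \<Longrightarrow> {\<one>} <#> K = K"
  by (force simp: set_mult_def)

lemma finite_set_mult: "finite A \<Longrightarrow> finite B \<Longrightarrow> finite (A <#>\<^bsub>G\<^esub> B)"
  by (simp add: set_mult_def)

lemma amenable_group: "amenable G \<Longrightarrow> group G"
  unfolding amenable_def by (rule conjunct1)

text \<open>
  If \<open>F\<close> doubled every finite set, then \<open>hall_countable\<close> would give an injection \<open>\<Psi>\<close> from two copies of
  the group into the group that moves every element by left translation with an element of \<open>F\<close>. Each of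
  the two copies is cut into the pieces on which this element is constant, and the translated pieces of both
  copies are disjoint. The mean of their union is then \<open>2\<close>.
\<close>
lemma amenable_not_doubling:
  fixes G (structure)
  assumes am: "amenable G" and count: "countable (carrier G)"
    and F: "finite F" "F \<subseteq> carrier G"
  shows "\<exists>K. finite K \<and> K \<subseteq> carrier G \<and> card (F <#>\<^bsub>G\<^esub> K) < 2 * card K"
proof (rule ccontr)
  assume not: "\<not> ?thesis"
  interpret group G using am by (rule amenable_group)
  obtain m :: "'a set \<Rightarrow> real" where m: "\<forall>A. A \<subseteq> carrier G \<longrightarrow> 0 \<le> m A" "m (carrier G) = 1"
    "\<forall>A B. A \<subseteq> carrier G \<longrightarrow> B \<subseteq> carrier G \<longrightarrow> A \<inter> B = {} \<longrightarrow> m (A \<union> B) = m A + m B"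
    "\<forall>g\<in>carrier G. \<forall>A. A \<subseteq> carrier G \<longrightarrow> m (g <#\<^bsub>G\<^esub> A) = m A"
    using am[unfolded amenable_def] by (elim conjE exE) (rule that)
  have m_nonneg: "0 \<le> m A" if "A \<subseteq> carrier G" for A
    using m(1) that by simp
  have m_one: "m (carrier G) = 1"
    by (rule m(2))
  have m_add: "m (A \<union> B) = m A + m B" if "A \<subseteq> carrier G" "B \<subseteq> carrier G" "A \<inter> B = {}" for A B
    using m(3) that by simp
  have m_inv: "m (g <#\<^bsub>G\<^esub> A) = m A" if "g \<in> carrier G" "A \<subseteq> carrier G" for g A
    using m(4) that by simp
  have m_empty: "m {} = 0"
    using m_add[of "{}" "{}"] by simp
  have m_UN: "m (\<Union>(B ` I)) = (\<Sum>i\<in>I. m (B i))"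
    if "finite I" "\<And>i. i \<in> I \<Longrightarrow> B i \<subseteq> carrier G" "disjoint_family_on B I" for B and I :: "(bool \<times> 'a) set"
    using that
  proof (induction I rule: finite_induct)
    case (insert i I)
    have "m (B i \<union> \<Union>(B ` I)) = m (B i) + m (\<Union>(B ` I))"
    proof (rule m_add)
      show "B i \<inter> \<Union>(B ` I) = {}"
        using insert.prems(2) insert.hyps by (auto simp: disjoint_family_on_def)
    qed (use insert.prems(1) in auto)
    moreover have "m (\<Union>(B ` I)) = (\<Sum>i\<in>I. m (B i))"
      using insert.prems by (intro insert.IH) (auto simp: disjoint_family_on_def)
    ultimately show ?case
      using insert.hyps by simp
  qed (use m_empty in simp)
  have m_le: "m A \<le> 1" if "A \<subseteq> carrier G" for A
  proof -
    have "A \<union> (carrier G - A) = carrier G" using that by auto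
    then have "m A + m (carrier G - A) = 1"
      using m_add[of A "carrier G - A"] that m_one by auto
    then show ?thesis using m_nonneg[of "carrier G - A"] by auto
  qed
  define A where "A = (\<lambda>(g, b::bool). (\<lambda>s. s \<otimes> g) ` F)"
  have "hall_family (carrier G \<times> UNIV) A"
    unfolding hall_family_def
  proof (intro conjI ballI allI impI)
    fix J :: "('a \<times> bool) set" assume J: "finite J" "J \<subseteq> carrier G \<times> UNIV"
    have "card J \<le> card (fst ` J \<times> (UNIV::bool set))"
      using J(1) by (intro card_mono) force+
    also have "\<dots> = 2 * card (fst ` J)"
      by (simp add: card_cartesian_product)
    also have "\<dots> \<le> card (F <#> (fst ` J))"
    proof -
      have "finite (fst ` J)" "fst ` J \<subseteq> carrier G" using J by auto
      then show ?thesis using not by (meson not_le)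
    qed
    also have "F <#> (fst ` J) = \<Union>(A ` J)"
      by (force simp: A_def set_mult_def)
    finally show "card J \<le> card (\<Union>(A ` J))" .
  qed (use F in \<open>auto simp: A_def\<close>)
  moreover have "countable (carrier G \<times> (UNIV::bool set))"
    using count by (intro countable_SIGMA) auto
  ultimately obtain \<Psi> where inj: "inj_on \<Psi> (carrier G \<times> (UNIV::bool set))"
    and \<Psi>: "\<And>g b. g \<in> carrier G \<Longrightarrow> \<exists>s\<in>F. \<Psi> (g, b) = s \<otimes> g"
    using hall_countable[of "carrier G \<times> (UNIV::bool set)" A] by (fastforce simp: A_def)
  define B where "B = (\<lambda>(b::bool, s). {g \<in> carrier G. \<Psi> (g, b) = s \<otimes> g})"
  have B_sub: "B i \<subseteq> carrier G" for i
    by (auto simp: B_def split: prod.splits)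
  have "(\<Sum>i\<in>{b} \<times> F. m (B i)) = 1" for b
  proof -
    have "disjoint_family_on B ({b} \<times> F)"
      using F by (auto simp: disjoint_family_on_def B_def subset_iff)
    moreover have "\<Union>(B ` ({b} \<times> F)) = carrier G"
      using \<Psi> by (auto simp: B_def)
    ultimately show ?thesis
      using m_UN[of "{b} \<times> F" B] F(1) B_sub m_one by simp
  qed
  then have "(\<Sum>b\<in>UNIV. \<Sum>i\<in>{b} \<times> F. m (B i)) = 2"
    by simp
  moreover have "(\<Sum>b\<in>UNIV. \<Sum>i\<in>{b} \<times> F. m (B i)) = (\<Sum>i\<in>(\<Union>b\<in>UNIV. {b} \<times> F). m (B i))"
    using F(1) by (intro sum.UNION_disjoint[symmetric]) auto
  moreover have "(\<Union>b\<in>(UNIV :: bool set). {b} \<times> F) = UNIV \<times> F"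
    by auto
  ultimately have "(\<Sum>i\<in>UNIV \<times> F. m (B i)) = 2"
    by simp
  moreover have "(\<Sum>i\<in>UNIV \<times> F. m (B i)) = (\<Sum>i\<in>UNIV \<times> F. m (snd i <#\<^bsub>G\<^esub> B i))"
    using F B_sub by (intro sum.cong refl m_inv[symmetric]) auto
  moreover have "\<dots> = m (\<Union>i\<in>UNIV \<times> F. snd i <#\<^bsub>G\<^esub> B i)"
  proof (rule m_UN[symmetric])
    show "disjoint_family_on (\<lambda>i. snd i <#\<^bsub>G\<^esub> B i) (UNIV \<times> F)"
    proof -
      have im: "snd i <#\<^bsub>G\<^esub> B i = (\<lambda>g. \<Psi> (g, fst i)) ` B i" for i
        by (auto simp: B_def l_coset_def split: prod.splits)
      have "i = j" if i: "i \<in> UNIV \<times> F" and j: "j \<in> UNIV \<times> F" and x: "x \<in> snd i <#\<^bsub>G\<^esub> B i" "x \<in> snd j <#\<^bsub>G\<^esub> B j" for i j x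
      proof -
        obtain g h where gh: "g \<in> B i" "x = \<Psi> (g, fst i)" "h \<in> B j" "x = \<Psi> (h, fst j)"
          using x im by blast
        then have "(g, fst i) = (h, fst j)"
          using inj B_sub by (auto dest!: inj_onD subsetD[OF B_sub])
        moreover have "snd i \<otimes> g = snd j \<otimes> h"
          using gh by (auto simp: B_def split: prod.splits)
        ultimately have "snd i = snd j"
          using i j F gh(1) B_sub[of i] by (auto simp: subset_iff)
        with \<open>(g, fst i) = (h, fst j)\<close> show ?thesis by (auto intro: prod_eqI)
      qed
      then show ?thesis
        unfolding disjoint_family_on_def by (meson disjoint_iff)
    qed
    show "snd i <#\<^bsub>G\<^esub> B i \<subseteq> carrier G" if "i \<in> UNIV \<times> F" for i
      using that B_sub F by (intro l_coset_subset_G) auto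
  qed (use F in auto)
  moreover have "\<dots> \<le> 1"
    using B_sub F by (intro m_le UN_least l_coset_subset_G) auto
  ultimately show False by linarith
qed

text \<open>
  A set \<open>F\<close> under which every finite set grows at least by the factor \<open>1 + \<epsilon>\<close> has a power that doubles
  every finite set.
\<close>
lemma amenable_Folner:
  fixes G (structure) and \<epsilon> :: real
  assumes am: "amenable G" and count: "countable (carrier G)"
    and F: "finite F" "F \<subseteq> carrier G" and \<epsilon>: "\<epsilon> > 0"
  shows "\<exists>K. finite K \<and> K \<noteq> {} \<and> K \<subseteq> carrier G \<and> card (F <#>\<^bsub>G\<^esub> K) \<le> (1 + \<epsilon>) * card K"
proof (rule ccontr)
  assume "\<not> ?thesis"
  then have grow: "(1 + \<epsilon>) * card K \<le> card (F <#>\<^bsub>G\<^esub> K)" if "finite K" "K \<subseteq> carrier G" for K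
    using that by (cases "K = {}") (auto simp: not_le intro: less_imp_le)
  interpret group G using am by (rule amenable_group)
  define P where "P n = ((\<lambda>K. F <#> K) ^^ n) {\<one>}" for n
  have P: "finite (P n) \<and> P n \<subseteq> carrier G" for n
    by (induction n) (simp_all add: P_def F finite_set_mult set_mult_closed)
  have P_Suc: "P (Suc n) <#> K = F <#> (P n <#> K)" if "K \<subseteq> carrier G" for n K
    using set_mult_assoc[OF F(2) conjunct2[OF P[of n]] that] by (simp add: P_def)
  have "(1 + \<epsilon>) ^ n * card K \<le> card (P n <#> K) " if K: "finite K" "K \<subseteq> carrier G" for n K
  proof (induction n)
    case 0
    then show ?case using K by (simp add: P_def set_mult_singleton_one)
  next
    case (Suc n)
    have "(1 + \<epsilon>) ^ Suc n * card K \<le> (1 + \<epsilon>) * card (P n <#> K)"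
      using Suc \<epsilon> by (simp add: mult.assoc)
    also have "\<dots> \<le> card (P (Suc n) <#> K)"
      unfolding P_Suc[OF K(2)] using P[of n] K by (intro grow finite_set_mult set_mult_closed) auto
    finally show ?case .
  qed
  moreover obtain n where "2 < (1 + \<epsilon>) ^ n"
    using real_arch_pow[of "1 + \<epsilon>" 2] \<epsilon> by auto
  moreover obtain K where "finite K" "K \<subseteq> carrier G" "card (P n <#> K) < 2 * card K"
    using amenable_not_doubling[OF am count, of "P n"] P[of n] by blast
  ultimately have K: "(1 + \<epsilon>) ^ n * card K \<le> card (P n <#> K)" "card (P n <#> K) < 2 * card K"
    and n: "2 < (1 + \<epsilon>) ^ n"
    by auto
  have "2 * real (card K) \<le> (1 + \<epsilon>) ^ n * card K"
    using n by (intro mult_right_mono) auto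
  then show False
    using K by linarith
qed

text \<open>
  The set \<open>V\<close> is \<open>K\<inverse> F\<close>, with the unit added to \<open>F\<close>. For each \<open>h \<in> F\<close> the elements \<open>v \<in> V\<close>
  with \<open>h \<otimes> inv v \<in> K\<close> form the subset \<open>K\<inverse> h\<close>; the Folner property, applied to the inverses of \<open>F\<close>,
  says that \<open>V\<close> is hardly larger than each of these subsets.
\<close>
lemma Folner_window:
  fixes G (structure) and \<theta> :: real
  assumes am: "amenable G" and count: "countable (carrier G)"
    and F: "finite F" "F \<subseteq> carrier G" and \<theta>: "\<theta> > 0"
  shows "\<exists>K V. finite K \<and> K \<subseteq> carrier G \<and> finite V \<and> V \<subseteq> carrier G \<and> V \<noteq> {} \<and>
    (\<forall>h\<in>F. \<forall>k\<in>K. inv k \<otimes> h \<in> V) \<and> card {v\<in>V. \<exists>h\<in>F. h \<otimes> inv v \<notin> K} \<le> \<theta> * card V"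
proof -
  interpret group G
    using am by (rule amenable_group)
  \<comment> \<open>Including the unit makes \<open>V\<close> nonempty for empty \<open>F\<close>.\<close>
  define F' where "F' = insert \<one> F"
  have F': "finite F'" "F' \<subseteq> carrier G" "F' \<noteq> {}"
    using F by (auto simp: F'_def)
  define \<eta> where "\<eta> = \<theta> / card F'"
  have F'0: "0 < card F'"
    using F' by (simp add: card_gt_0_iff)
  then have \<eta>: "\<eta> > 0"
    using \<theta> by (simp add: \<eta>_def)
  obtain K where K: "finite K" "K \<noteq> {}" "K \<subseteq> carrier G"
    and small: "card ((\<lambda>h. inv h) ` F' <#> K) \<le> (1 + \<eta>) * card K"
    using amenable_Folner[OF am count, of "(\<lambda>h. inv h) ` F'" \<eta>] F' \<eta> by auto
  define V where "V = (\<lambda>(k, h). inv k \<otimes> h) ` (K \<times> F')"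
  have V: "finite V" "V \<subseteq> carrier G" "V \<noteq> {}"
    using K F' by (auto simp: V_def)
  have VI: "inv k \<otimes> h \<in> V" if "k \<in> K" "h \<in> F'" for k h
    using that by (auto simp: V_def)
  have "(\<lambda>v. inv v) ` V = (\<lambda>h. inv h) ` F' <#> K"
  proof -
    have "(\<lambda>v. inv v) ` V = (\<lambda>(k, h). inv (inv k \<otimes> h)) ` (K \<times> F')"
      by (simp add: V_def image_image case_prod_unfold)
    also have "\<dots> = (\<lambda>(k, h). inv h \<otimes> k) ` (K \<times> F')"
      using K F' by (intro image_cong refl) (auto simp: inv_mult_group subset_iff)
    also have "\<dots> = (\<lambda>h. inv h) ` F' <#> K"
      by (auto simp: set_mult_def)
    finally show ?thesis .
  qed
  moreover have "card ((\<lambda>v. inv v) ` V) = card V"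
    using V by (intro card_image inj_onI) (metis inv_inv subsetD)
  ultimately have card_V: "card V \<le> (1 + \<eta>) * card K"
    using small by simp
  have bad: "card {v\<in>V. h \<otimes> inv v \<notin> K} \<le> \<eta> * card V" if h: "h \<in> F'" for h
  proof -
    let ?I = "(\<lambda>k. inv k \<otimes> h) ` K"
    have hG: "h \<in> carrier G"
      using h F' by auto
    have I: "?I \<subseteq> V" "finite ?I"
      using VI[OF _ h] K by auto
    have eq: "h \<otimes> inv (inv k \<otimes> h) = k" if "k \<in> K" for k
      using that K hG by (simp add: inv_mult_group subset_iff flip: m_assoc)
    have card_I: "card ?I = card K"
      by (intro card_image inj_onI) (metis eq)
    have "{v\<in>V. h \<otimes> inv v \<notin> K} \<subseteq> V - ?I"
      using eq by auto
    then have "card {v\<in>V. h \<otimes> inv v \<notin> K} \<le> card (V - ?I)"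
      using V by (intro card_mono) auto
    also have "\<dots> = card V - card K"
      using card_Diff_subset[OF I(2,1)] card_I by simp
    finally have 1: "real (card {v\<in>V. h \<otimes> inv v \<notin> K}) \<le> real (card V - card K)"
      by simp
    have "card K \<le> card V"
      using card_mono[OF V(1) I(1)] card_I by simp
    then have "real (card V - card K) = real (card V) - real (card K)"
      by simp
    also have "\<dots> \<le> \<eta> * card K"
      using card_V by (simp add: algebra_simps)
    also have "\<dots> \<le> \<eta> * card V"
      using \<eta> \<open>card K \<le> card V\<close> by simp
    finally show ?thesis
      using 1 by simp
  qed
  have "{v\<in>V. \<exists>h\<in>F'. h \<otimes> inv v \<notin> K} = (\<Union>h\<in>F'. {v\<in>V. h \<otimes> inv v \<notin> K})"
    by auto
  then have "card {v\<in>V. \<exists>h\<in>F'. h \<otimes> inv v \<notin> K} \<le> (\<Sum>h\<in>F'. card {v\<in>V. h \<otimes> inv v \<notin> K})"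
    using card_UN_le[OF F'(1)] by metis
  then have "real (card {v\<in>V. \<exists>h\<in>F'. h \<otimes> inv v \<notin> K}) \<le> (\<Sum>h\<in>F'. real (card {v\<in>V. h \<otimes> inv v \<notin> K}))"
    unfolding of_nat_sum[symmetric] of_nat_le_iff .
  also have "\<dots> \<le> (\<Sum>h\<in>F'. \<eta> * card V)"
    using bad by (rule sum_mono)
  also have "\<dots> = \<theta> * card V"
    using F'0 by (simp add: \<eta>_def)
  finally have "real (card {v\<in>V. \<exists>h\<in>F'. h \<otimes> inv v \<notin> K}) \<le> \<theta> * card V" .
  moreover have "card {v\<in>V. \<exists>h\<in>F. h \<otimes> inv v \<notin> K} \<le> card {v\<in>V. \<exists>h\<in>F'. h \<otimes> inv v \<notin> K}"
    using V(1) by (intro card_mono) (auto simp: F'_def)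
  ultimately have "card {v\<in>V. \<exists>h\<in>F. h \<otimes> inv v \<notin> K} \<le> \<theta> * card V"
    by simp
  then show ?thesis
    using K V VI by (intro exI[of _ K] exI[of _ V]) (auto simp: F'_def)
qed

section \<open>Events determined by finitely many labels\<close>

text \<open>
  A predicate that cannot tell apart points with equal labels is a union of countably many label classes.
\<close>
lemma sets_Collect_determined:
  assumes V: "finite V" and R: "countable R"
    and f: "\<And>v. v \<in> V \<Longrightarrow> f v \<in> measurable M (count_space R)"
    and P: "\<And>x x'. x \<in> space M \<Longrightarrow> x' \<in> space M \<Longrightarrow> (\<And>v. v \<in> V \<Longrightarrow> f v x = f v x') \<Longrightarrow> P x \<Longrightarrow> P x'"
  shows "{x\<in>space M. P x} \<in> sets M"
proof -
  define A where "A = {a \<in> V \<rightarrow>\<^sub>E R. \<exists>x\<in>space M. P x \<and> (\<forall>v\<in>V. f v x = a v)}"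
  have "countable (V \<rightarrow>\<^sub>E R)"
    using V R by (intro countable_PiE) auto
  then have A: "countable A"
    by (rule countable_subset[rotated]) (auto simp: A_def)
  have "{x\<in>space M. P x} = (\<Union>a\<in>A. {x\<in>space M. \<forall>v\<in>V. f v x = a v})"
  proof (intro equalityI subsetI)
    fix x assume x: "x \<in> {x\<in>space M. P x}"
    then have "restrict (\<lambda>v. f v x) V \<in> A"
      using measurable_space[OF f] by (auto simp: A_def)
    then show "x \<in> (\<Union>a\<in>A. {x\<in>space M. \<forall>v\<in>V. f v x = a v})"
      using x by (intro UN_I[of "restrict (\<lambda>v. f v x) V"]) auto
  next
    fix x assume "x \<in> (\<Union>a\<in>A. {x\<in>space M. \<forall>v\<in>V. f v x = a v})"
    then obtain a x' where "x \<in> space M" "\<forall>v\<in>V. f v x = a v" "x' \<in> space M" "P x'" "\<forall>v\<in>V. f v x' = a v"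
      unfolding A_def by blast
    then show "x \<in> {x\<in>space M. P x}"
      using P[of x' x] by simp
  qed
  also have "\<dots> \<in> sets M"
  proof (intro sets.countable_UN'' A sets.sets_Collect_finite_All V)
    fix a v assume "a \<in> A" "v \<in> V"
    then have "{x\<in>space M. f v x = a v} = f v -` {a v} \<inter> space M" "{a v} \<subseteq> R"
      by (auto simp: A_def)
    then show "{x\<in>space M. f v x = a v} \<in> sets M"
      using measurable_sets[OF f[OF \<open>v \<in> V\<close>], of "{a v}"] by simp
  qed
  finally show ?thesis .
qed

lemma measurable_restrict_count_space:
  assumes W: "finite W" and R: "finite R" and f: "\<And>h. h \<in> W \<Longrightarrow> f h \<in> measurable M (count_space R)"
  shows "(\<lambda>x. \<lambda>h\<in>W. f h x) \<in> measurable M (count_space (W \<rightarrow>\<^sub>E R))"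
proof -
  have "finite (W \<rightarrow>\<^sub>E R)"
    using W R by (intro finite_PiE) auto
  show ?thesis
    unfolding measurable_count_space_eq2[OF \<open>finite (W \<rightarrow>\<^sub>E R)\<close>]
  proof (intro conjI ballI)
    show "(\<lambda>x. \<lambda>h\<in>W. f h x) \<in> space M \<rightarrow> W \<rightarrow>\<^sub>E R"
      using measurable_space[OF f] by auto
    fix w
    have "{x\<in>space M. (\<lambda>h\<in>W. f h x) = w} \<in> sets M"
    proof (rule sets_Collect_determined[OF W countable_finite[OF R] f])
      fix x x' assume "\<And>h. h \<in> W \<Longrightarrow> f h x = f h x'" and w: "(\<lambda>h\<in>W. f h x) = w"
      then show "(\<lambda>h\<in>W. f h x') = w"
        unfolding w[symmetric] by (intro restrict_ext) simp
    qed
    then show "(\<lambda>x. \<lambda>h\<in>W. f h x) -` {w} \<inter> space M \<in> sets M"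
      by (simp add: vimage_def Int_def conj_commute)
  qed
qed

section \<open>Free actions and separating partitions\<close>

locale pmp =
  fixes G :: "('g, 'm) monoid_scheme" (structure) and M :: "'x measure" and \<sigma> :: "'g \<Rightarrow> 'x \<Rightarrow> 'x"
  assumes pmp: "pmp_action G M \<sigma>"
begin

lemma action: "group_action G (space M) \<sigma>"
  using pmp by (simp add: pmp_action_def)

sublocale prob_space M
  using pmp by (simp add: pmp_action_def)

sublocale group G
  using action by (simp add: group_action_def group_hom_def)

lemma measurable_act [measurable]: "g \<in> carrier G \<Longrightarrow> \<sigma> g \<in> measurable M M"
  using pmp by (simp add: pmp_action_def)

lemma distr_act: "g \<in> carrier G \<Longrightarrow> distr M M (\<sigma> g) = M"
  using pmp by (simp add: pmp_action_def)

lemma act_space: "g \<in> carrier G \<Longrightarrow> x \<in> space M \<Longrightarrow> \<sigma> g x \<in> space M"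
  using measurable_space[OF measurable_act] .

lemma act_mult: "g \<in> carrier G \<Longrightarrow> h \<in> carrier G \<Longrightarrow> x \<in> space M \<Longrightarrow> \<sigma> (g \<otimes> h) x = \<sigma> g (\<sigma> h x)"
  using group_action.composition_rule[OF action] by blast

lemma act_one: "x \<in> space M \<Longrightarrow> \<sigma> \<one> x = x"
  using fun_cong[OF group_action.id_eq_one[OF action], of x] by simp

lemma measure_act:
  assumes "g \<in> carrier G" "A \<in> sets M"
  shows "measure M {x\<in>space M. \<sigma> g x \<in> A} = measure M A"
proof -
  have "measure (distr M M (\<sigma> g)) A = measure M (\<sigma> g -` A \<inter> space M)"
    using assms by (intro measure_distr) auto
  then show ?thesis
    using distr_act[OF assms(1)] by (simp add: vimage_def Int_def conj_commute)
qed

lemma AE_act: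
  assumes g: "g \<in> carrier G" and P: "AE x in M. P x"
  shows "AE x in M. P (\<sigma> g x)"
proof (rule AE_distrD[OF measurable_act[OF g]])
  show "AE x in distr M M (\<sigma> g). P x"
    unfolding distr_act[OF g] by (rule P)
qed

end

text \<open>
  A countable base of a Hausdorff topology separates points.
\<close>
lemma separating_sequence:
  assumes "standard_prob_space M"
  shows "\<exists>U :: nat \<Rightarrow> 'x set. (\<forall>i. U i \<in> sets M) \<and>
    (\<forall>x\<in>space M. \<forall>y\<in>space M. x \<noteq> y \<longrightarrow> (\<exists>i. x \<in> U i \<and> y \<notin> U i))"
proof -
  obtain T where T: "topspace T = space M" "completely_metrizable_space T" "second_countable T"
      "sets M = sigma_sets (space M) {U. openin T U}"
    using assms by (auto simp: standard_prob_space_def)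
  obtain \<B> where \<B>: "countable \<B>" "\<forall>V\<in>\<B>. openin T V"
      "\<forall>U x. openin T U \<and> x \<in> U \<longrightarrow> (\<exists>V\<in>\<B>. x \<in> V \<and> V \<subseteq> U)"
    using T(3) unfolding second_countable_def by (elim exE conjE) (rule that)
  have haus: "Hausdorff_space T"
    using T(2) completely_metrizable_imp_metrizable_space metrizable_imp_Hausdorff_space by blast
  define U where "U = from_nat_into (insert {} \<B>)"
  have U: "range U = insert {} \<B>"
    unfolding U_def using \<B>(1) by (intro range_from_nat_into) auto
  have "U i \<in> sets M" for i
  proof -
    have "U i \<in> insert {} \<B>"
      using U by auto
    then have "openin T (U i)"
      using \<B>(2) by auto
    then show ?thesis
      unfolding T(4) by (intro sigma_sets.Basic) simp
  qed
  moreover have "\<exists>i. x \<in> U i \<and> y \<notin> U i" if xy: "x \<in> space M" "y \<in> space M" and "x \<noteq> y" for x y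
  proof -
    have "\<exists>A B. openin T A \<and> openin T B \<and> x \<in> A \<and> y \<in> B \<and> disjnt A B"
      using haus \<open>x \<noteq> y\<close> xy unfolding Hausdorff_space_def T(1)[symmetric] by simp
    then obtain A B where AB: "openin T A" "openin T B" "x \<in> A" "y \<in> B" "disjnt A B"
      by blast
    obtain V where V: "V \<in> \<B>" "x \<in> V" "V \<subseteq> A"
      using \<B>(3)[rule_format, of A x] AB by blast
    have "V \<in> range U"
      unfolding U using V(1) by simp
    then obtain i where "V = U i"
      by (rule rangeE)
    then show ?thesis
      using V AB by (intro exI[of _ i]) (auto simp: disjnt_def)
  qed
  ultimately show ?thesis
    by (intro exI[of _ U]) simp
qed

text \<open>
  The cells are the atoms generated by the first \<open>n\<close> sets of a sequence separating points. As \<open>n\<close> grows, the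
  sets of points with two of the translates by \<open>V\<close> in a common cell decrease to the set of points with two equal
  translates, which is null by freeness.
\<close>
lemma (in pmp) separating_cells:
  assumes std: "standard_prob_space M" and free: "free_action G M \<sigma>"
    and V: "finite V" "V \<subseteq> carrier G" and \<delta>: "\<delta> > 0"
  shows "\<exists>(\<kappa> :: 'x \<Rightarrow> nat) r. \<kappa> \<in> measurable M (count_space UNIV) \<and> (\<forall>x. \<kappa> x < r) \<and>
    measure M {x\<in>space M. \<not> inj_on (\<lambda>v. \<kappa> (\<sigma> v x)) V} < \<delta>"
proof -
  obtain U :: "nat \<Rightarrow> 'x set" where U[measurable]: "\<And>i. U i \<in> sets M"
    and sep: "\<And>x y. x \<in> space M \<Longrightarrow> y \<in> space M \<Longrightarrow> x \<noteq> y \<Longrightarrow> \<exists>i. x \<in> U i \<and> y \<notin> U i"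
    using separating_sequence[OF std] by metis
  define S where "S n x = {i. i < n \<and> x \<in> U i}" for n x
  define \<kappa> where "\<kappa> n x = set_encode (S n x)" for n x
  have fin: "finite (S n x)" for n x
    by (simp add: S_def)
  have \<kappa>_eq: "\<kappa> n x = \<kappa> n y \<longleftrightarrow> (\<forall>i<n. x \<in> U i \<longleftrightarrow> y \<in> U i)" for n x y
    unfolding \<kappa>_def set_encode_eq[OF fin fin] by (auto simp: S_def)
  have meas[measurable]: "\<kappa> n \<in> measurable M (count_space UNIV)" for n
    unfolding measurable_count_space_eq2_countable
  proof (intro conjI ballI)
    fix c
    have "\<kappa> n x = c \<longleftrightarrow> S n x = set_decode c" for x
      unfolding \<kappa>_def using fin by (metis set_decode_inverse set_encode_inverse)
    then have "\<kappa> n x = c \<longleftrightarrow> (\<forall>i. (i < n \<and> x \<in> U i) \<longleftrightarrow> i \<in> set_decode c)" for x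
      by (simp add: S_def set_eq_iff)
    then have "\<kappa> n -` {c} \<inter> space M = {x\<in>space M. \<forall>i. (i < n \<and> x \<in> U i) \<longleftrightarrow> i \<in> set_decode c}"
      by (simp add: vimage_def Int_def conj_commute)
    also have "\<dots> \<in> sets M"
      by measurable
    finally show "\<kappa> n -` {c} \<inter> space M \<in> sets M" .
  qed simp
  have bound: "\<exists>r. \<forall>x. \<kappa> n x < r" for n
  proof -
    have "range (\<kappa> n) \<subseteq> set_encode ` Pow {..<n}"
      by (auto simp: \<kappa>_def S_def)
    then have "finite (range (\<kappa> n))"
      by (rule finite_subset) simp
    then show ?thesis
      unfolding finite_nat_set_iff_bounded by auto
  qed
  define E where "E n = {x\<in>space M. \<not> inj_on (\<lambda>v. \<kappa> n (\<sigma> v x)) V}" for n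
  have E_sets: "E n \<in> sets M" for n
  proof -
    have "{x\<in>space M. \<exists>v\<in>V. \<exists>w\<in>V. v \<noteq> w \<and> \<kappa> n (\<sigma> v x) = \<kappa> n (\<sigma> w x)} \<in> sets M"
    proof (intro sets.sets_Collect_finite_Ex V(1))
      fix v w assume "v \<in> V" "w \<in> V"
      then have m: "(\<lambda>x. \<kappa> n (\<sigma> v x)) \<in> measurable M (count_space UNIV)"
          "(\<lambda>x. \<kappa> n (\<sigma> w x)) \<in> measurable M (count_space UNIV)"
        using V by (auto intro!: measurable_compose[OF measurable_act meas])
      have "{x\<in>space M. \<kappa> n (\<sigma> v x) = \<kappa> n (\<sigma> w x)} =
          (\<Union>c. ((\<lambda>x. \<kappa> n (\<sigma> v x)) -` {c} \<inter> space M) \<inter> ((\<lambda>x. \<kappa> n (\<sigma> w x)) -` {c} \<inter> space M))"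
        by auto
      also have "\<dots> \<in> sets M"
        using m by (intro sets.countable_UN' sets.Int measurable_sets) auto
      finally have "{x\<in>space M. \<kappa> n (\<sigma> v x) = \<kappa> n (\<sigma> w x)} \<in> sets M" .
      then show "{x\<in>space M. v \<noteq> w \<and> \<kappa> n (\<sigma> v x) = \<kappa> n (\<sigma> w x)} \<in> sets M"
        by (cases "v = w") auto
    qed
    also have "{x\<in>space M. \<exists>v\<in>V. \<exists>w\<in>V. v \<noteq> w \<and> \<kappa> n (\<sigma> v x) = \<kappa> n (\<sigma> w x)} = E n"
      by (auto simp: E_def inj_on_def)
    finally show ?thesis .
  qed
  have "decseq E"
    unfolding decseq_def
  proof (intro allI impI subsetI)
    fix k n :: nat and x assume "k \<le> n" "x \<in> E n"
    then obtain v w where vw: "x \<in> space M" "v \<in> V" "w \<in> V" "v \<noteq> w" "\<kappa> n (\<sigma> v x) = \<kappa> n (\<sigma> w x)"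
      by (auto simp: E_def inj_on_def)
    then have "\<kappa> k (\<sigma> v x) = \<kappa> k (\<sigma> w x)"
      using \<open>k \<le> n\<close> by (simp add: \<kappa>_eq)
    then show "x \<in> E k"
      using vw by (auto simp: E_def inj_on_def)
  qed
  then have lim: "(\<lambda>n. measure M (E n)) \<longlonglongrightarrow> measure M (\<Inter>n. E n)"
    using E_sets by (intro finite_Lim_measure_decseq) auto
  have distinct: "AE x in M. \<forall>v\<in>V. \<forall>w\<in>V. v \<noteq> w \<longrightarrow> \<sigma> v x \<noteq> \<sigma> w x"
  proof (intro AE_finite_allI V(1))
    fix v w assume vw: "v \<in> V" "w \<in> V"
    then have c: "v \<in> carrier G" "w \<in> carrier G"
      using V by auto
    show "AE x in M. v \<noteq> w \<longrightarrow> \<sigma> v x \<noteq> \<sigma> w x"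
    proof (cases "v = w")
      case False
      then have "inv w \<otimes> v \<noteq> \<one>"
        using c by (metis inv_equality inv_inv inv_closed)
      then have "AE x in M. \<sigma> (inv w \<otimes> v) x \<noteq> x"
        using free c by (auto simp: free_action_def)
      then show ?thesis
        using AE_space
      proof eventually_elim
        case (elim x)
        have "\<sigma> (inv w \<otimes> w) x = x"
          using c elim(2) act_one by simp
        then show ?case
          using elim c act_mult[of "inv w" v x] act_mult[of "inv w" w x] by auto
      qed
    qed simp
  qed
  have "AE x in M. x \<notin> (\<Inter>n. E n)"
    using distinct AE_space
  proof eventually_elim
    case (elim x)
    have "\<exists>i. \<sigma> v x \<in> U i \<and> \<sigma> w x \<notin> U i" if "v \<in> V" "w \<in> V" "v \<noteq> w" for v w
      using elim that V by (intro sep act_space) auto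
    then obtain i where i: "\<And>v w. v \<in> V \<Longrightarrow> w \<in> V \<Longrightarrow> v \<noteq> w \<Longrightarrow> \<sigma> v x \<in> U (i v w) \<and> \<sigma> w x \<notin> U (i v w)"
      by metis
    obtain n where n: "\<forall>j\<in>(\<lambda>(v, w). i v w) ` (V \<times> V). j < n"
      using V(1) finite_nat_set_iff_bounded[of "(\<lambda>(v, w). i v w) ` (V \<times> V)"] by auto
    have "inj_on (\<lambda>v. \<kappa> n (\<sigma> v x)) V"
    proof (rule inj_onI, rule ccontr)
      fix v w assume vw: "v \<in> V" "w \<in> V" "\<kappa> n (\<sigma> v x) = \<kappa> n (\<sigma> w x)" "v \<noteq> w"
      have "i v w < n"
        using n vw by auto
      then show False
        using vw i[of v w] by (auto simp: \<kappa>_eq)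
    qed
    then show ?case
      by (auto simp: E_def)
  qed
  then have "measure M (\<Inter>n. E n) = 0"
    using E_sets by (subst prob_eq_0) auto
  then have "\<forall>\<^sub>F n in sequentially. measure M (E n) < \<delta>"
    using lim \<delta> by (simp add: order_tendstoD(2))
  then obtain n where "measure M (E n) < \<delta>"
    by (auto simp: eventually_sequentially)
  then show ?thesis
    using meas[of n] bound[of n] unfolding E_def by blast
qed

context pmp
begin

lemma sets_Collect_cells:
  fixes \<kappa> :: "'x \<Rightarrow> nat"
  assumes \<kappa>: "\<kappa> \<in> measurable M (count_space UNIV)" and V: "finite V" "V \<subseteq> carrier G"
    and P: "\<And>x x'. x \<in> space M \<Longrightarrow> x' \<in> space M \<Longrightarrow> (\<And>v. v \<in> V \<Longrightarrow> \<kappa> (\<sigma> v x) = \<kappa> (\<sigma> v x')) \<Longrightarrow> P x \<Longrightarrow> P x'"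
  shows "{x\<in>space M. P x} \<in> sets M"
  by (rule sets_Collect_determined[where f = "\<lambda>v x. \<kappa> (\<sigma> v x)" and V = V and R = UNIV])
    (use V in \<open>auto intro: P intro!: measurable_compose[OF measurable_act \<kappa>]\<close>)

text \<open>
  Where the translates of \<open>x\<close> lie in different cells, at most one of them lies in the cell \<open>c\<close>; integrating the
  number of those that do bounds the measure of the cell. If two translates rarely share a cell, a large \<open>V\<close>
  thus forces all cells to be small.
\<close>
lemma cell_measure_le:
  fixes \<kappa> :: "'x \<Rightarrow> nat"
  assumes \<kappa>: "\<kappa> \<in> measurable M (count_space UNIV)" and V: "finite V" "V \<subseteq> carrier G"
  shows "card V * measure M {x\<in>space M. \<kappa> x = c}
    \<le> 1 + card V * measure M {x\<in>space M. \<not> inj_on (\<lambda>v. \<kappa> (\<sigma> v x)) V}"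
proof -
  let ?E = "{x\<in>space M. \<not> inj_on (\<lambda>v. \<kappa> (\<sigma> v x)) V}" and ?C = "{x\<in>space M. \<kappa> x = c}"
  let ?B = "\<lambda>v. {x\<in>space M. \<kappa> (\<sigma> v x) = c}"
  have E: "?E \<in> sets M"
    by (rule sets_Collect_cells[OF \<kappa> V]) (simp add: inj_on_def)
  have C: "?C \<in> sets M"
    using measurable_sets[OF \<kappa>, of "{c}"] by (simp add: vimage_def Int_def conj_commute)
  have B_eq: "?B v = {x\<in>space M. \<sigma> v x \<in> ?C}" if "v \<in> V" for v
    using that V act_space by auto
  have B: "?B v \<in> sets M" if "v \<in> V" for v
    using that V by (intro sets_Collect_cells[OF \<kappa>, of "{v}"]) auto
  have "card V * measure M ?C = (\<Sum>v\<in>V. measure M (?B v))"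
    using measure_act[OF _ C] V by (simp add: B_eq subset_iff)
  also have "\<dots> = expectation (\<lambda>x. \<Sum>v\<in>V. indicator (?B v) x)"
    using B by (subst Bochner_Integration.integral_sum) (simp_all add: emeasure_eq_measure cong: sum.cong)
  also have "\<dots> \<le> expectation (\<lambda>x. 1 + real (card V) * indicat_real ?E x)"
  proof (rule integral_mono)
    show "integrable M (\<lambda>x. \<Sum>v\<in>V. indicat_real (?B v) x)"
      using B by (intro Bochner_Integration.integrable_sum) (auto simp: emeasure_eq_measure)
    show "integrable M (\<lambda>x. 1 + real (card V) * indicat_real ?E x)"
      using E by (intro Bochner_Integration.integrable_add integrable_mult_right) (auto simp: emeasure_eq_measure)
    fix x assume x: "x \<in> space M"
    have "(\<Sum>v\<in>V. indicat_real (?B v) x) = card {v\<in>V. \<kappa> (\<sigma> v x) = c}"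
      using x V by (simp add: indicator_def sum.If_cases Int_def)
    also have "\<dots> \<le> 1 + real (card V) * indicat_real ?E x"
    proof (cases "x \<in> ?E")
      case True
      have "card {v\<in>V. \<kappa> (\<sigma> v x) = c} \<le> card V"
        using V by (intro card_mono) auto
      then show ?thesis
        using True by simp
    next
      case False
      then have "inj_on (\<lambda>v. \<kappa> (\<sigma> v x)) V"
        using x by simp
      then have "card {v\<in>V. \<kappa> (\<sigma> v x) = c} \<le> Suc 0"
        using V by (subst card_le_Suc0_iff_eq) (auto dest: inj_onD)
      then show ?thesis
        using False by simp
    qed
    finally show "(\<Sum>v\<in>V. indicat_real (?B v) x) \<le> 1 + real (card V) * indicat_real ?E x" .
  qed
  also have "\<dots> = 1 + card V * measure M ?E"
    using E by (subst Bochner_Integration.integral_add) (auto simp: emeasure_eq_measure prob_space)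
  finally show ?thesis .
qed

end

section \<open>Random orders and balanced choices\<close>

text \<open>
  Composition with a transposition shows that every element of \<open>V\<close> is first in the same number of orders.
\<close>
lemma card_permutes_minimal_at:
  fixes e :: "'v \<Rightarrow> nat"
  assumes V: "finite V" and inj: "inj_on e V" and e: "e ` V \<subseteq> {..<r}" and B: "B \<subseteq> V"
  shows "card V * card {p. p permutes {..<r} \<and> (\<exists>v\<in>B. \<forall>u\<in>V. p (e v) \<le> p (e u))} = card B * fact r"
proof (cases "V = {}")
  case False
  define P where "P v = {p. p permutes {..<r} \<and> (\<forall>u\<in>V. p (e v) \<le> p (e u))}" for v
  have finite_P: "finite (P v)" for v
    by (rule finite_subset[OF _ finite_permutations[of "{..<r}"]]) (auto simp: P_def)
  have le: "card (P u) \<le> card (P v)" if uv: "u \<in> V" "v \<in> V" for u v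
  proof (rule card_inj_on_le)
    let ?\<tau> = "Transposition.transpose (e u) (e v)"
    show "inj_on (\<lambda>p. p \<circ> ?\<tau>) (P u)"
      by (rule inj_onI) (metis comp_assoc comp_id Transposition.transpose_comp_involutory)
    show "(\<lambda>p. p \<circ> ?\<tau>) ` P u \<subseteq> P v"
    proof
      fix q assume "q \<in> (\<lambda>p. p \<circ> ?\<tau>) ` P u"
      then obtain p where q: "q = p \<circ> ?\<tau>" and p: "p permutes {..<r}" "\<forall>w\<in>V. p (e u) \<le> p (e w)"
        by (auto simp: P_def)
      have "q permutes {..<r}"
        unfolding q using e uv by (intro permutes_compose p permutes_swap_id) auto
      moreover have "q (e v) \<le> q (e w)" if "w \<in> V" for w
        using that p uv by (simp add: q Transposition.transpose_def)
      ultimately show "q \<in> P v"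
        by (simp add: P_def)
    qed
  qed (rule finite_P)
  obtain c where c: "\<And>v. v \<in> V \<Longrightarrow> card (P v) = c"
    using le False by (metis all_not_in_conv order_antisym)
  have disjoint: "P u \<inter> P v = {}" if "u \<in> V" "v \<in> V" "u \<noteq> v" for u v
  proof -
    have "False" if p: "p \<in> P u" "p \<in> P v" for p
    proof -
      have "p (e u) = p (e v)" and "p permutes {..<r}"
        using p \<open>u \<in> V\<close> \<open>v \<in> V\<close> by (auto simp: P_def intro: order_antisym)
      then have "e u = e v"
        using permutes_inj by (metis injD)
      then show False
        using inj \<open>u \<in> V\<close> \<open>v \<in> V\<close> \<open>u \<noteq> v\<close> by (auto dest: inj_onD)
    qed
    then show ?thesis by blast
  qed
  have card_UN: "card (\<Union>v\<in>A. P v) = card A * c" if "A \<subseteq> V" for A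
  proof -
    have "card (\<Union>v\<in>A. P v) = (\<Sum>v\<in>A. card (P v))"
      using that finite_subset[OF that V] finite_P disjoint by (intro card_UN_disjoint) (auto simp: subset_iff)
    also have "\<dots> = card A * c"
      using that c by (simp add: subset_iff)
    finally show ?thesis .
  qed
  have "(\<Union>v\<in>V. P v) = {p. p permutes {..<r}}"
  proof
    show "{p. p permutes {..<r}} \<subseteq> (\<Union>v\<in>V. P v)"
    proof
      fix p assume "p \<in> {p. p permutes {..<r}}"
      moreover obtain v where "v \<in> V" "\<forall>u\<in>V. p (e v) \<le> p (e u)"
        using ex_is_arg_min_if_finite[OF V False, of "\<lambda>v. p (e v)"]
        by (auto simp: is_arg_min_linorder)
      ultimately show "p \<in> (\<Union>v\<in>V. P v)"
        by (auto simp: P_def)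
    qed
  qed (auto simp: P_def)
  then have "card V * c = fact r"
    using card_UN[of V] card_permutations[of "{..<r}" r] by simp
  moreover have "{p. p permutes {..<r} \<and> (\<exists>v\<in>B. \<forall>u\<in>V. p (e v) \<le> p (e u))} = (\<Union>v\<in>B. P v)"
    by (auto simp: P_def)
  ultimately show ?thesis
    using card_UN[OF B] by (metis mult.assoc mult.commute)
qed (use B in auto)

context pmp
begin

text \<open>
  For every single \<open>x\<close> with distinct cells, the proportion of orders in which the winner lies in \<open>B\<close> is
  \<open>card B / card V\<close>. Averaging over \<open>x\<close> and exchanging the averages, some order does as well as the mean.
\<close>
lemma exists_good_order:
  fixes \<kappa> :: "'x \<Rightarrow> nat" and \<theta> :: real
  assumes \<kappa>: "\<kappa> \<in> measurable M (count_space UNIV)" "\<And>x. \<kappa> x < r"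
    and V: "finite V" "V \<subseteq> carrier G" "V \<noteq> {}" and B: "B \<subseteq> V" "card B \<le> \<theta> * card V"
  shows "\<exists>p. p permutes {..<r} \<and>
    measure M {x\<in>space M. inj_on (\<lambda>v. \<kappa> (\<sigma> v x)) V \<and>
      (\<exists>v\<in>B. \<forall>u\<in>V. p (\<kappa> (\<sigma> v x)) \<le> p (\<kappa> (\<sigma> u x)))} \<le> \<theta>"
proof (rule ccontr)
  let ?\<Pi> = "{p. p permutes {..<r}}"
  define E where "E p = {x\<in>space M. inj_on (\<lambda>v. \<kappa> (\<sigma> v x)) V \<and>
      (\<exists>v\<in>B. \<forall>u\<in>V. p (\<kappa> (\<sigma> v x)) \<le> p (\<kappa> (\<sigma> u x)))}" for p :: "nat \<Rightarrow> nat"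
  assume "\<not> ?thesis"
  then have large: "\<theta> < measure M (E p)" if "p \<in> ?\<Pi>" for p
    using that by (auto simp: E_def not_le)
  have fin: "finite ?\<Pi>" and card: "card ?\<Pi> = fact r"
    using card_permutations[of "{..<r}" r] by (auto simp: finite_permutations)
  have "id \<in> ?\<Pi>"
    by (simp add: permutes_id)
  have E: "E p \<in> sets M" for p
    unfolding E_def
  proof (rule sets_Collect_cells[OF \<kappa>(1) V(1,2)])
    fix x x'
    assume eq: "\<And>v. v \<in> V \<Longrightarrow> \<kappa> (\<sigma> v x) = \<kappa> (\<sigma> v x')"
      and *: "inj_on (\<lambda>v. \<kappa> (\<sigma> v x)) V \<and> (\<exists>v\<in>B. \<forall>u\<in>V. p (\<kappa> (\<sigma> v x)) \<le> p (\<kappa> (\<sigma> u x)))"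
    have "inj_on (\<lambda>v. \<kappa> (\<sigma> v x')) V"
      using * eq by (simp add: inj_on_def)
    moreover have "\<exists>v\<in>B. \<forall>u\<in>V. p (\<kappa> (\<sigma> v x')) \<le> p (\<kappa> (\<sigma> u x'))"
      using * eq B(1) by (metis subsetD)
    ultimately show "inj_on (\<lambda>v. \<kappa> (\<sigma> v x')) V \<and> (\<exists>v\<in>B. \<forall>u\<in>V. p (\<kappa> (\<sigma> v x')) \<le> p (\<kappa> (\<sigma> u x')))"
      by blast
  qed
  have "fact r * \<theta> = (\<Sum>p\<in>?\<Pi>. \<theta>)"
    using card by simp
  also have "\<dots> < (\<Sum>p\<in>?\<Pi>. measure M (E p))"
    using fin large \<open>id \<in> ?\<Pi>\<close> by (intro sum_strict_mono) blast+
  also have "\<dots> = expectation (\<lambda>x. \<Sum>p\<in>?\<Pi>. indicator (E p) x)"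
    using E by (subst Bochner_Integration.integral_sum) (simp_all add: emeasure_eq_measure)
  also have "\<dots> \<le> expectation (\<lambda>x. \<theta> * fact r)"
  proof (rule integral_mono)
    show "integrable M (\<lambda>x. \<Sum>p\<in>?\<Pi>. indicat_real (E p) x)"
      using E by (intro Bochner_Integration.integrable_sum) (auto simp: emeasure_eq_measure)
    fix x assume x: "x \<in> space M"
    let ?e = "\<lambda>v. \<kappa> (\<sigma> v x)"
    have V0: "0 < card V"
      using V by (simp add: card_gt_0_iff)
    have "0 \<le> \<theta>"
    proof -
      have "0 \<le> \<theta> * card V"
        using B(2) by (meson of_nat_0_le_iff order_trans)
      then show ?thesis
        using V0 by (simp add: zero_le_mult_iff)
    qed
    have "(\<Sum>p\<in>?\<Pi>. indicat_real (E p) x) = card {p\<in>?\<Pi>. x \<in> E p}"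
      using fin by (simp add: indicator_def sum.If_cases Int_def)
    also have "\<dots> \<le> \<theta> * fact r"
    proof (cases "inj_on ?e V")
      case True
      then have "card V * card {p\<in>?\<Pi>. x \<in> E p} = card B * fact r"
        using card_permutes_minimal_at[OF V(1) True _ B(1), of r] \<kappa>(2) x
        by (simp add: E_def image_subset_iff)
      then have "card V * real (card {p\<in>?\<Pi>. x \<in> E p}) = card B * fact r"
        by (metis of_nat_fact of_nat_mult)
      also have "\<dots> \<le> card V * (\<theta> * fact r)"
        using mult_right_mono[OF B(2), of "fact r"] by (simp add: mult_ac)
      finally show ?thesis
        using V0 by simp
    next
      case False
      then have "{p\<in>?\<Pi>. x \<in> E p} = {}"
        by (simp add: E_def)
      then show ?thesis
        using \<open>0 \<le> \<theta>\<close> by (simp only: card.empty of_nat_0 mult_nonneg_nonneg fact_ge_zero)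
    qed
    finally show "(\<Sum>p\<in>?\<Pi>. indicat_real (E p) x) \<le> \<theta> * fact r" .
  qed simp
  also have "\<dots> = \<theta> * fact r"
    by (simp add: prob_space)
  finally show False
    by (simp add: mult.commute)
qed

end

text \<open>
  The cross terms have expectation \<open>0\<close>, so they cannot be positive everywhere.
\<close>
lemma (in prob_space) exists_sum_squares_le:
  fixes X :: "'w \<Rightarrow> 'a \<Rightarrow> real" and b :: real
  assumes int: "\<And>w. w \<in> W \<Longrightarrow> integrable M (X w)"
    and centred: "\<And>w. w \<in> W \<Longrightarrow> expectation (X w) = 0"
    and bound: "\<And>w z. w \<in> W \<Longrightarrow> z \<in> space M \<Longrightarrow> \<bar>X w z\<bar> \<le> b"
  shows "\<exists>z\<in>space M. (\<Sum>w\<in>W. (s w + X w z)\<^sup>2) \<le> (\<Sum>w\<in>W. (s w)\<^sup>2) + card W * b\<^sup>2"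
proof (rule ccontr)
  assume not: "\<not> ?thesis"
  have "0 < (\<Sum>w\<in>W. 2 * s w * X w z)" if z: "z \<in> space M" for z
  proof -
    have "(\<Sum>w\<in>W. (s w)\<^sup>2) + card W * b\<^sup>2 < (\<Sum>w\<in>W. (s w + X w z)\<^sup>2)"
      using not z by (auto simp: not_le)
    also have "\<dots> = (\<Sum>w\<in>W. (s w)\<^sup>2) + (\<Sum>w\<in>W. 2 * s w * X w z) + (\<Sum>w\<in>W. (X w z)\<^sup>2)"
      by (simp add: power2_sum sum.distrib algebra_simps)
    also have "(\<Sum>w\<in>W. (X w z)\<^sup>2) \<le> (\<Sum>w\<in>W. b\<^sup>2)"
      using bound z by (intro sum_mono) (metis abs_le_square_iff abs_of_nonneg abs_ge_zero order_trans)
    finally show ?thesis by simp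
  qed
  then have "0 < expectation (\<lambda>z. \<Sum>w\<in>W. 2 * s w * X w z)"
    using int by (intro expectation_greater) auto
  also have "expectation (\<lambda>z. \<Sum>w\<in>W. 2 * s w * X w z) = 0"
    using int centred by (subst Bochner_Integration.integral_sum) auto
  finally show False by simp
qed

text \<open>
  For independent random \<open>y c\<close> the variances of the summands add up, which bounds the expected sum of squares
  as in Chebyshev's inequality. Instead of a product measure, the points are chosen one after the other, each so
  that the sum of squares grows by no more than the variance bound for this step.
\<close>
lemma (in prob_space) exists_balanced_choice:
  fixes m :: "'c \<Rightarrow> 'v \<Rightarrow> real" and A :: "'w \<Rightarrow> 'v \<Rightarrow> 'a set"
  assumes C: "finite C"
    and A: "\<And>w v. w \<in> W \<Longrightarrow> v \<in> V \<Longrightarrow> A w v \<in> events"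
    and p: "\<And>w v. w \<in> W \<Longrightarrow> v \<in> V \<Longrightarrow> prob (A w v) = p w"
    and m: "\<And>c v. 0 \<le> m c v"
  shows "\<exists>y. (\<forall>c. y c \<in> space M) \<and>
    (\<Sum>w\<in>W. (\<Sum>c\<in>C. \<Sum>v\<in>V. m c v * (indicator (A w v) (y c) - p w))\<^sup>2)
      \<le> card W * (\<Sum>c\<in>C. (\<Sum>v\<in>V. m c v)\<^sup>2)"
  using C
proof (induction C rule: finite_induct)
  case empty
  show ?case
    using not_empty by (auto intro!: exI[of _ "\<lambda>_. SOME z. z \<in> space M"] some_in_eq[THEN iffD2])
next
  case (insert c C)
  then obtain y where y: "\<forall>c. y c \<in> space M"
    "(\<Sum>w\<in>W. (\<Sum>c\<in>C. \<Sum>v\<in>V. m c v * (indicator (A w v) (y c) - p w))\<^sup>2)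
      \<le> card W * (\<Sum>c\<in>C. (\<Sum>v\<in>V. m c v)\<^sup>2)"
    by blast
  define s where "s w = (\<Sum>c\<in>C. \<Sum>v\<in>V. m c v * (indicator (A w v) (y c) - p w))" for w
  define X where "X w z = (\<Sum>v\<in>V. m c v * (indicator (A w v) z - p w))" for w z
  have "\<exists>z\<in>space M. (\<Sum>w\<in>W. (s w + X w z)\<^sup>2) \<le> (\<Sum>w\<in>W. (s w)\<^sup>2) + card W * (\<Sum>v\<in>V. m c v)\<^sup>2"
  proof (rule exists_sum_squares_le)
    fix w assume w: "w \<in> W"
    have [measurable, simp]: "A w v \<in> events" if "v \<in> V" for v
      using A[OF w that] .
    show "integrable M (X w)"
      unfolding X_def by (intro Bochner_Integration.integrable_sum integrable_mult_right
        Bochner_Integration.integrable_diff) (auto simp: emeasure_eq_measure)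
    show "expectation (X w) = 0"
      unfolding X_def
      by (subst Bochner_Integration.integral_sum) (auto simp: p[OF w] emeasure_eq_measure prob_space)
    fix z assume "z \<in> space M"
    have "\<bar>X w z\<bar> \<le> (\<Sum>v\<in>V. \<bar>m c v * (indicator (A w v) z - p w)\<bar>)"
      unfolding X_def by (rule sum_abs)
    also have "\<dots> \<le> (\<Sum>v\<in>V. m c v)"
    proof (rule sum_mono)
      fix v assume v: "v \<in> V"
      have "0 \<le> p w" "p w \<le> 1"
        using p[OF w v, symmetric] by auto
      then have "\<bar>indicator (A w v) z - p w\<bar> \<le> 1"
        by (auto simp: indicator_def)
      then show "\<bar>m c v * (indicator (A w v) z - p w)\<bar> \<le> m c v"
        using m[of c v] by (simp add: abs_mult mult_left_le)
    qed
    finally show "\<bar>X w z\<bar> \<le> (\<Sum>v\<in>V. m c v)" .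
  qed
  then obtain z where z: "z \<in> space M"
    "(\<Sum>w\<in>W. (s w + X w z)\<^sup>2) \<le> (\<Sum>w\<in>W. (s w)\<^sup>2) + card W * (\<Sum>v\<in>V. m c v)\<^sup>2"
    by blast
  have "(\<Sum>c'\<in>insert c C. \<Sum>v\<in>V. m c' v * (indicator (A w v) ((y(c := z)) c') - p w)) = s w + X w z" for w
  proof -
    have "(\<Sum>c'\<in>C. \<Sum>v\<in>V. m c' v * (indicator (A w v) ((y(c := z)) c') - p w)) = s w"
      unfolding s_def using insert.hyps by (intro sum.cong refl) auto
    then show ?thesis
      using insert.hyps by (simp add: X_def)
  qed
  then have "(\<Sum>w\<in>W. (\<Sum>c'\<in>insert c C. \<Sum>v\<in>V. m c' v * (indicator (A w v) ((y(c := z)) c') - p w))\<^sup>2)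
      \<le> card W * (\<Sum>c\<in>C. (\<Sum>v\<in>V. m c v)\<^sup>2) + card W * (\<Sum>v\<in>V. m c v)\<^sup>2"
    using z(2) y(2) unfolding s_def by simp
  also have "\<dots> = card W * (\<Sum>c\<in>insert c C. (\<Sum>v\<in>V. m c v)\<^sup>2)"
    using insert.hyps by (simp add: algebra_simps)
  finally show ?case
    using y(1) z(1) by (intro exI[of _ "y(c := z)"]) auto
qed

section \<open>Imitating an action of an amenable group by a free one\<close>

text \<open>
  The construction of \<open>f'\<close> by competition. With \<open>\<theta>\<close> a fixed fraction of \<open>\<epsilon>\<close>, three errors of size about
  \<open>\<theta>\<close> occur: points with two translates in a common cell, points whose winner lies outside some of the
  subsets \<open>K\<inverse> h\<close>, and the deviation of the frequencies in \<open>exists_balanced_choice\<close>.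
\<close>
theorem amenable_weak_containment:
  fixes G (structure) and M :: "'x measure" and N :: "'y measure" and f :: "'y \<Rightarrow> 'l" and \<epsilon> :: real
  assumes am: "amenable G" and count: "countable (carrier G)" and inf: "infinite (carrier G)"
    and std: "standard_prob_space M" and \<sigma>: "pmp_action G M \<sigma>" and free: "free_action G M \<sigma>"
    and \<rho>: "pmp_action G N \<rho>"
    and R: "finite R" and f: "f \<in> measurable N (count_space R)"
    and F: "finite F" "F \<subseteq> carrier G" and \<epsilon>: "\<epsilon> > 0"
  shows "\<exists>f'\<in>measurable M (count_space R). \<forall>w\<in>F \<rightarrow>\<^sub>E R.
    \<bar>measure M {x\<in>space M. \<forall>h\<in>F. f' (\<sigma> h x) = w h} -
      measure N {y\<in>space N. \<forall>h\<in>F. f (\<rho> h y) = w h}\<bar> < \<epsilon>"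
proof -
  interpret M: pmp G M \<sigma>
    using \<sigma> by unfold_locales
  interpret N: pmp G N \<rho>
    using \<rho> by unfold_locales
  define \<theta> where "\<theta> = \<epsilon> / 6"
  have \<theta>: "\<theta> > 0"
    using \<epsilon> by (simp add: \<theta>_def)
  obtain K V where K: "finite K" "K \<subseteq> carrier G" and V: "finite V" "V \<subseteq> carrier G" "V \<noteq> {}"
    and KF': "\<forall>h\<in>F. \<forall>k\<in>K. inv k \<otimes> h \<in> V"
    and bad: "card {v\<in>V. \<exists>h\<in>F. h \<otimes> inv v \<notin> K} \<le> \<theta> * card V"
    using Folner_window[OF am count F \<theta>] by (elim exE conjE) (rule that)
  have KF: "inv k \<otimes> h \<in> V" if "h \<in> F" "k \<in> K" for h k
    using KF' that by simp
  define B where "B = {v\<in>V. \<exists>h\<in>F. h \<otimes> inv v \<notin> K}"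
  have "B \<subseteq> V"
    by (auto simp: B_def)
  define W where "W = F \<rightarrow>\<^sub>E R"
  have W: "finite W"
    unfolding W_def using F R by (intro finite_PiE) auto
  \<comment> \<open>If all cells have measure at most \<open>\<beta>\<close>, the bound of \<open>exists_balanced_choice\<close>
    is at most \<open>\<theta>\<^sup>2\<close>.\<close>
  define \<beta> where "\<beta> = \<theta>\<^sup>2 / (real (card W) * real (card V) + 1)"
  have WV: "0 < real (card W) * real (card V) + 1"
    by (intro add_nonneg_pos mult_nonneg_nonneg) auto
  have \<beta>: "\<beta> > 0"
    using \<theta> WV by (simp add: \<beta>_def)
  define \<delta> where "\<delta> = min \<theta> (\<beta> / 2)"
  have \<delta>: "\<delta> > 0" "\<delta> \<le> \<theta>" "\<delta> \<le> \<beta> / 2"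
    using \<theta> \<beta> by (auto simp: \<delta>_def)

  obtain L :: nat where L: "2 / \<beta> < L"
    using reals_Archimedean2 by blast
  then have L0: "0 < L"
    using \<beta> by (metis divide_pos_pos less_trans of_nat_0_less_iff zero_less_numeral)
  obtain V1 where V1: "V1 \<subseteq> carrier G" "finite V1" "card V1 = L"
    using infinite_arbitrarily_large[OF inf] by blast
  \<comment> \<open>The window is enlarged to at least \<open>L\<close> elements so that
    \<open>cell_measure_le\<close> bounds the cells by \<open>1 / L + \<delta> \<le> \<beta>\<close>.\<close>
  define V' where "V' = V \<union> V1"
  have V': "finite V'" "V' \<subseteq> carrier G" "V \<subseteq> V'" "L \<le> card V'"
    using V V1 card_mono[of V' V1] by (auto simp: V'_def)
  obtain \<kappa> :: "'x \<Rightarrow> nat" and r where \<kappa>: "\<kappa> \<in> measurable M (count_space UNIV)" "\<forall>x. \<kappa> x < r"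
    and coll: "measure M {x\<in>space M. \<not> inj_on (\<lambda>v. \<kappa> (\<sigma> v x)) V'} < \<delta>"
    using M.separating_cells[OF std free V'(1,2) \<delta>(1)] by (elim exE conjE) (rule that)
  define e where "e x v = \<kappa> (\<sigma> v x)" for x v
  have e_less: "e x v < r" for x v
    using \<kappa>(2) by (simp add: e_def)
  have sets_e: "{x\<in>space M. P x} \<in> sets M"
    if "\<And>x x'. x \<in> space M \<Longrightarrow> x' \<in> space M \<Longrightarrow> (\<And>v. v \<in> V' \<Longrightarrow> e x v = e x' v) \<Longrightarrow> P x \<Longrightarrow> P x'" for P
    by (rule M.sets_Collect_cells[OF \<kappa>(1) V'(1,2)], rule that, assumption+) (simp_all add: e_def)
  have small: "measure M {x\<in>space M. \<kappa> x = c} \<le> \<beta>" for c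
  proof -
    have "card V' * measure M {x\<in>space M. \<kappa> x = c} \<le> 1 + card V' * \<delta>"
      using M.cell_measure_le[OF \<kappa>(1) V'(1,2), of c] coll
      by (smt (verit) mult_left_mono of_nat_0_le_iff)
    moreover have "1 \<le> card V' * (\<beta> / 2)"
    proof -
      have "1 \<le> L * (\<beta> / 2)"
        using L \<beta> by (simp add: field_simps)
      also have "\<dots> \<le> card V' * (\<beta> / 2)"
        using V'(4) \<beta> by (intro mult_right_mono) auto
      finally show ?thesis .
    qed
    moreover have "card V' * \<delta> \<le> card V' * (\<beta> / 2)"
      using \<delta>(3) by (intro mult_left_mono) auto
    ultimately have "card V' * measure M {x\<in>space M. \<kappa> x = c} \<le> card V' * \<beta>"
      by (simp add: algebra_simps)
    moreover have "0 < card V'"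
      using L0 V'(4) by simp
    ultimately show ?thesis
      by simp
  qed

  obtain p where p: "p permutes {..<r}"
    and order: "measure M {x\<in>space M. inj_on (\<lambda>v. \<kappa> (\<sigma> v x)) V \<and>
      (\<exists>v\<in>B. \<forall>u\<in>V. p (\<kappa> (\<sigma> v x)) \<le> p (\<kappa> (\<sigma> u x)))} \<le> \<theta>"
    using M.exists_good_order[OF \<kappa>(1) spec[OF \<kappa>(2)] V \<open>B \<subseteq> V\<close> bad[folded B_def]]
    by (elim exE conjE) (rule that)
  define minimal where "minimal v x \<longleftrightarrow> v \<in> V \<and> (\<forall>u\<in>V. p (e x v) \<le> p (e x u))" for v x
  define E1 where "E1 = {x\<in>space M. \<not> inj_on (e x) V'}"
  define E2 where "E2 = {x\<in>space M. inj_on (e x) V \<and> (\<exists>v\<in>B. minimal v x)}"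
  \<comment> \<open>The good points: no two translates share a cell, and the winner of \<open>V\<close> belongs to all the subsets
    \<open>K\<inverse> h\<close>, \<open>h \<in> F\<close>.\<close>
  define Gd where "Gd = {x\<in>space M. inj_on (e x) V' \<and> \<not> (\<exists>v\<in>B. minimal v x)}"
  have minimal_cong: "minimal v x \<longleftrightarrow> minimal v x'" if "\<And>v. v \<in> V' \<Longrightarrow> e x v = e x' v" for v x x'
    using that V'(3) by (auto simp: minimal_def subset_iff)
  have inj_cong: "inj_on (e x) A \<longleftrightarrow> inj_on (e x') A" if "\<And>v. v \<in> V' \<Longrightarrow> e x v = e x' v" "A \<subseteq> V'" for A x x'
    using that by (intro inj_on_cong) auto
  have E1: "E1 \<in> sets M"
    unfolding E1_def by (rule sets_e) (use inj_cong in blast)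
  have E2: "E2 \<in> sets M"
    unfolding E2_def by (rule sets_e) (metis inj_cong V'(3) minimal_cong)
  have Gd_sets: "Gd \<in> sets M"
    unfolding Gd_def by (rule sets_e) (metis inj_cong order_refl minimal_cong)
  have "measure M E1 < \<delta>"
    using coll by (simp add: E1_def e_def[abs_def])
  have "E2 = {x\<in>space M. inj_on (\<lambda>v. \<kappa> (\<sigma> v x)) V \<and>
      (\<exists>v\<in>B. \<forall>u\<in>V. p (\<kappa> (\<sigma> v x)) \<le> p (\<kappa> (\<sigma> u x)))}"
    unfolding E2_def minimal_def e_def[abs_def] using \<open>B \<subseteq> V\<close> by blast
  then have "measure M E2 \<le> \<theta>"
    using order by simp
  have "space M - Gd \<subseteq> E1 \<union> E2"
    using V'(3) by (auto simp: Gd_def E1_def E2_def intro: inj_on_subset)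
  then have "measure M (space M - Gd) \<le> measure M (E1 \<union> E2)"
    using E1 E2 by (intro M.finite_measure_mono) auto
  also have "\<dots> \<le> measure M E1 + measure M E2"
    using E1 E2 by (rule measure_Un_le)
  also have "\<dots> \<le> 2 * \<theta>"
    using \<open>measure M E1 < \<delta>\<close> \<open>measure M E2 \<le> \<theta>\<close> \<delta> by simp
  finally have compl_Gd: "measure M (space M - Gd) \<le> 2 * \<theta>" .
  then have Gd_large: "1 - 2 * \<theta> \<le> measure M Gd"
    using M.prob_compl[OF Gd_sets] by simp

  have minimal_ex: "\<exists>v. minimal v x" for x
    using ex_is_arg_min_if_finite[OF V(1,3), of "\<lambda>v. p (e x v)"]
    by (auto simp: is_arg_min_linorder minimal_def)
  have minimal_unique: "v = u" if "x \<in> Gd" "minimal v x" "u \<in> V" "p (e x u) \<le> p (e x v)" for v u x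
  proof -
    have "p (e x v) = p (e x u)"
      using that by (auto simp: minimal_def intro: order_antisym)
    then have "e x v = e x u"
      using permutes_inj[OF p] by (simp add: inj_eq)
    then show ?thesis
      using that V'(3) unfolding Gd_def minimal_def by (auto dest!: inj_onD)
  qed

  \<comment> \<open>On \<open>D c v\<close> the winner is \<open>\<sigma> v x\<close>, and it lies in the cell \<open>c\<close>.\<close>
  define D where "D c v = {x\<in>space M. x \<in> Gd \<and> minimal v x \<and> e x v = c}" for c v
  have D_sets: "D c v \<in> sets M" for c v
    unfolding D_def
  proof (rule sets_e)
    fix x x' assume *: "x \<in> space M" "x' \<in> space M" "\<And>v. v \<in> V' \<Longrightarrow> e x v = e x' v"
      and "x \<in> Gd \<and> minimal v x \<and> e x v = c"
    moreover from this have "v \<in> V'"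
      using V'(3) by (auto simp: minimal_def)
    moreover have "inj_on (e x) V' = inj_on (e x') V'"
      using inj_cong[OF *(3)] by simp
    ultimately show "x' \<in> Gd \<and> minimal v x' \<and> e x' v = c"
      using minimal_cong[OF *(3)] by (simp add: Gd_def)
  qed
  define P where "P w = {y\<in>space N. \<forall>h\<in>F. f (\<rho> h y) = w h}" for w
  have P_sets: "P w \<in> sets N" if "w \<in> W" for w
    unfolding P_def
  proof (intro sets.sets_Collect_finite_All F(1))
    fix h assume h: "h \<in> F"
    have "(\<lambda>y. f (\<rho> h y)) \<in> measurable N (count_space R)"
      using h F by (intro measurable_compose[OF N.measurable_act f]) auto
    moreover have "{w h} \<subseteq> R"
      using that h by (auto simp: W_def)
    ultimately have "(\<lambda>y. f (\<rho> h y)) -` {w h} \<inter> space N \<in> sets N"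
      by (intro measurable_sets) auto
    then show "{y\<in>space N. f (\<rho> h y) = w h} \<in> sets N"
      by (simp add: vimage_def Int_def conj_commute)
  qed
  \<comment> \<open>If the winner is \<open>\<sigma> v x\<close>, the pattern at \<open>x\<close> is \<open>w\<close> exactly when the point attached to its cell
    lies in \<open>A w v\<close>.\<close>
  define A where "A w v = {y\<in>space N. \<rho> (inv v) y \<in> P w}" for w v
  have A_sets: "A w v \<in> sets N" and A_measure: "measure N (A w v) = measure N (P w)"
    if "w \<in> W" "v \<in> V" for w v
  proof -
    have v: "inv v \<in> carrier G"
      using that V by auto
    show "A w v \<in> sets N"
      using measurable_sets[OF N.measurable_act[OF v] P_sets[OF that(1)]]
      by (simp add: A_def vimage_def Int_def conj_commute)
    show "measure N (A w v) = measure N (P w)"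
      unfolding A_def using N.measure_act[OF v P_sets[OF that(1)]] .
  qed
  obtain y where y: "\<And>c. y c \<in> space N"
    and balanced: "(\<Sum>w\<in>W. (\<Sum>c<r. \<Sum>v\<in>V. measure M (D c v) * (indicator (A w v) (y c) - measure N (P w)))\<^sup>2)
      \<le> card W * (\<Sum>c<r. (\<Sum>v\<in>V. measure M (D c v))\<^sup>2)"
    using N.exists_balanced_choice[of "{..<r}" W V A "\<lambda>w. measure N (P w)" "\<lambda>c v. measure M (D c v)"]
      A_sets A_measure by auto

  have D_disjoint: "disjoint_family_on (\<lambda>(c, v). D c v) X" for X
    unfolding disjoint_family_on_def
  proof (intro ballI impI)
    fix i j assume "i \<in> X" "j \<in> X" "i \<noteq> j"
    moreover have "i = j" if "x \<in> D (fst i) (snd i)" "x \<in> D (fst j) (snd j)" for x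
    proof -
      have "snd i = snd j"
        using that minimal_unique[of x "snd i" "snd j"] by (auto simp: D_def minimal_def)
      then show ?thesis
        using that by (auto simp: D_def intro: prod_eqI)
    qed
    ultimately show "(case i of (c, v) \<Rightarrow> D c v) \<inter> (case j of (c, v) \<Rightarrow> D c v) = {}"
      unfolding case_prod_unfold by blast
  qed
  have D_UN: "measure M (\<Union>i\<in>X. case i of (c, v) \<Rightarrow> D c v) = (\<Sum>i\<in>X. case i of (c, v) \<Rightarrow> measure M (D c v))"
    if "finite X" for X
    using D_sets D_disjoint that
    by (subst M.finite_measure_finite_Union) (auto simp: case_prod_unfold)
  have Gd_UN: "(\<Union>i\<in>{..<r} \<times> V. case i of (c, v) \<Rightarrow> D c v) = Gd"
  proof
    show "Gd \<subseteq> (\<Union>i\<in>{..<r} \<times> V. case i of (c, v) \<Rightarrow> D c v)"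
    proof
      fix x assume x: "x \<in> Gd"
      obtain v where v: "minimal v x"
        using minimal_ex by blast
      then have "v \<in> V" "x \<in> D (e x v) v"
        using x by (auto simp: D_def Gd_def minimal_def)
      then show "x \<in> (\<Union>i\<in>{..<r} \<times> V. case i of (c, v) \<Rightarrow> D c v)"
        using e_less by (intro UN_I[of "(e x v, v)"]) auto
    qed
  qed (auto simp: D_def)
  have D_total: "(\<Sum>c<r. \<Sum>v\<in>V. measure M (D c v)) = measure M Gd"
    using D_UN[of "{..<r} \<times> V"] V(1) unfolding Gd_UN by (simp add: sum.cartesian_product)
  have D_cell: "(\<Sum>v\<in>V. measure M (D c v)) \<le> card V * \<beta>" for c
  proof -
    have "measure M (D c v) \<le> \<beta>" if v: "v \<in> V" for v
    proof -
      have C: "{x\<in>space M. \<kappa> x = c} \<in> sets M"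
        using measurable_sets[OF \<kappa>(1), of "{c}"] by (simp add: vimage_def Int_def conj_commute)
      have vG: "v \<in> carrier G"
        using v V by auto
      have "measure M (D c v) \<le> measure M {x\<in>space M. \<sigma> v x \<in> {x\<in>space M. \<kappa> x = c}}"
        using C vG M.act_space[OF vG] measurable_sets[OF M.measurable_act[OF vG] C]
        by (intro M.finite_measure_mono) (auto simp: D_def e_def vimage_def Int_def conj_commute)
      then show ?thesis
        using small[of c] M.measure_act[OF vG C] by simp
    qed
    then have "(\<Sum>v\<in>V. measure M (D c v)) \<le> (\<Sum>v\<in>V. \<beta>)"
      by (rule sum_mono)
    then show ?thesis by simp
  qed
  have "(\<Sum>c<r. (\<Sum>v\<in>V. measure M (D c v))\<^sup>2) \<le> (\<Sum>c<r. (card V * \<beta>) * (\<Sum>v\<in>V. measure M (D c v)))"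
    unfolding power2_eq_square using D_cell by (intro sum_mono mult_right_mono sum_nonneg) auto
  also have "\<dots> = card V * \<beta> * measure M Gd"
    by (simp add: D_total flip: sum_distrib_left)
  also have "\<dots> \<le> card V * \<beta>"
    using \<beta> by (intro mult_left_le) auto
  finally have "card W * (\<Sum>c<r. (\<Sum>v\<in>V. measure M (D c v))\<^sup>2) \<le> card W * (card V * \<beta>)"
    by (intro mult_left_mono) auto
  also have "\<dots> = (real (card W) * real (card V)) * \<beta>"
    by simp
  also have "\<dots> \<le> \<theta>\<^sup>2"
    using WV by (simp add: \<beta>_def field_simps)
  finally have balanced': "(\<Sum>w\<in>W. (\<Sum>c<r. \<Sum>v\<in>V. measure M (D c v) * (indicator (A w v) (y c) - measure N (P w)))\<^sup>2) \<le> \<theta>\<^sup>2"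
    using balanced by simp
  have close: "\<bar>(\<Sum>c<r. \<Sum>v\<in>V. measure M (D c v) * indicator (A w v) (y c)) - measure N (P w) * measure M Gd\<bar> \<le> \<theta>"
    if w: "w \<in> W" for w
  proof -
    let ?S = "\<Sum>c<r. \<Sum>v\<in>V. measure M (D c v) * (indicator (A w v) (y c) - measure N (P w))"
    have "?S\<^sup>2 \<le> (\<Sum>w\<in>W. (\<Sum>c<r. \<Sum>v\<in>V. measure M (D c v) * (indicator (A w v) (y c) - measure N (P w)))\<^sup>2)"
      using w W by (intro member_le_sum) auto
    then have "?S\<^sup>2 \<le> \<theta>\<^sup>2"
      using balanced' by simp
    then have "\<bar>?S\<bar> \<le> \<theta>"
      using \<theta> by (simp add: abs_le_square_iff[symmetric])
    moreover have "?S = (\<Sum>c<r. \<Sum>v\<in>V. measure M (D c v) * indicator (A w v) (y c)) - measure N (P w) * measure M Gd"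
      by (simp add: right_diff_distrib sum_subtractf mult.commute flip: D_total sum_distrib_left)
    ultimately show ?thesis by simp
  qed

  \<comment> \<open>The winner among the translates \<open>\<sigma> (inv k) z\<close>. The value of \<open>f'\<close> in the other branch only
    keeps \<open>f'\<close> inside \<open>R\<close> when \<open>K\<close> is empty.\<close>
  define k where "k z = (SOME k. k \<in> K \<and> (\<forall>u\<in>K. p (e z (inv k)) \<le> p (e z (inv u))))" for z
  define f' where "f' z = (if k z \<in> K then f (\<rho> (k z) (y (e z (inv (k z))))) else f (y 0))" for z
  have f'_R: "f' z \<in> R" for z
    using measurable_space[OF f] N.act_space y K by (auto simp: f'_def subset_iff)
  have f'_meas: "f' \<in> measurable M (count_space R)"
    unfolding measurable_count_space_eq2[OF R]
  proof (intro conjI ballI)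
    fix a
    have "{z\<in>space M. f' z = a} \<in> sets M"
    proof (rule M.sets_Collect_cells[OF \<kappa>(1), of "(\<lambda>k. inv k) ` K"])
      fix z z' assume eq: "\<And>v. v \<in> (\<lambda>k. inv k) ` K \<Longrightarrow> \<kappa> (\<sigma> v z) = \<kappa> (\<sigma> v z')" and "f' z = a"
      have e: "e z (inv u) = e z' (inv u)" if "u \<in> K" for u
        using eq that by (simp add: e_def)
      then have "k z = k z'"
        unfolding k_def by (intro arg_cong[where f = Eps] ext) auto
      then show "f' z' = a"
        using \<open>f' z = a\<close> e by (cases "k z' \<in> K") (simp_all add: f'_def)
    qed (use K in auto)
    then show "f' -` {a} \<inter> space M \<in> sets M"
      by (simp add: vimage_def Int_def conj_commute)
  qed (use f'_R in auto)

  \<comment> \<open>The winner \<open>v\<close> of \<open>V\<close> takes part in the competition at \<open>\<sigma> h x\<close> because it lies in \<open>K\<inverse> h\<close>, and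
    all competitors there belong to \<open>V\<close>; hence it wins there too, with \<open>k = h \<otimes> inv v\<close>.\<close>
  have f'_act: "f' (\<sigma> h x) = f (\<rho> h (\<rho> (inv v) (y (e x v))))"
    if x: "x \<in> Gd" and v: "minimal v x" and h: "h \<in> F" for x v h
  proof -
    have xM: "x \<in> space M"
      using x by (simp add: Gd_def)
    have vV: "v \<in> V"
      using v by (simp add: minimal_def)
    have hG: "h \<in> carrier G" and vG: "v \<in> carrier G"
      using h F vV V by auto
    have "v \<notin> B"
      using x v by (auto simp: Gd_def)
    then have k0: "h \<otimes> inv v \<in> K"
      using vV h by (auto simp: B_def)
    have e_act: "e (\<sigma> h x) (inv u) = e x (inv u \<otimes> h)" if "u \<in> K" for u
      using that K hG xM M.act_mult[of "inv u" h x] by (auto simp: e_def subset_iff)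
    have inv_k0: "inv (h \<otimes> inv v) \<otimes> h = v"
      using hG vG by (simp add: M.inv_mult_group M.m_assoc)
    have "k (\<sigma> h x) = h \<otimes> inv v"
      unfolding k_def
    proof (rule some_equality)
      show "h \<otimes> inv v \<in> K \<and> (\<forall>u\<in>K. p (e (\<sigma> h x) (inv (h \<otimes> inv v))) \<le> p (e (\<sigma> h x) (inv u)))"
        using k0 v KF[OF h] by (simp add: e_act inv_k0 minimal_def)
      fix u assume u: "u \<in> K \<and> (\<forall>w\<in>K. p (e (\<sigma> h x) (inv u)) \<le> p (e (\<sigma> h x) (inv w)))"
      then have "p (e x (inv u \<otimes> h)) \<le> p (e x v)"
        using k0 e_act[of u] e_act[OF k0] inv_k0 by auto
      then have "v = inv u \<otimes> h"
        using minimal_unique[OF x v] KF[OF h] u by blast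
      then show "u = h \<otimes> inv v"
        using u K hG by (auto simp: M.inv_mult_group subset_iff simp flip: M.m_assoc)
    qed
    then have "f' (\<sigma> h x) = f (\<rho> (h \<otimes> inv v) (y (e x v)))"
      using k0 e_act[OF k0] by (simp add: f'_def inv_k0)
    also have "\<dots> = f (\<rho> h (\<rho> (inv v) (y (e x v))))"
      using N.act_mult[of h "inv v"] hG vG y by simp
    finally show ?thesis .
  qed

  show ?thesis
  proof (intro bexI[OF _ f'_meas] ballI)
    fix w assume "w \<in> F \<rightarrow>\<^sub>E R"
    then have w: "w \<in> W"
      by (simp add: W_def)
    define Q where "Q = {x\<in>space M. \<forall>h\<in>F. f' (\<sigma> h x) = w h}"
    have Q: "Q \<in> sets M"
      unfolding Q_def
    proof (intro sets.sets_Collect_finite_All F(1))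
      fix h assume h: "h \<in> F"
      have "(\<lambda>x. f' (\<sigma> h x)) \<in> measurable M (count_space R)"
        using h F by (intro measurable_compose[OF M.measurable_act f'_meas]) auto
      moreover have "{w h} \<subseteq> R"
        using w h by (auto simp: W_def)
      ultimately have "(\<lambda>x. f' (\<sigma> h x)) -` {w h} \<inter> space M \<in> sets M"
        by (intro measurable_sets) auto
      then show "{x\<in>space M. f' (\<sigma> h x) = w h} \<in> sets M"
        by (simp add: vimage_def Int_def conj_commute)
    qed
    let ?X = "{i\<in>{..<r} \<times> V. y (fst i) \<in> A w (snd i)}"
    have "Q \<inter> Gd = (\<Union>i\<in>?X. case i of (c, v) \<Rightarrow> D c v)"
    proof (intro Set.set_eqI)
      fix x
      have "x \<in> Q \<longleftrightarrow> y c \<in> A w v" if "x \<in> D c v" for c v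
      proof -
        have x: "x \<in> Gd" "minimal v x" "e x v = c" "v \<in> V"
          using that by (auto simp: D_def minimal_def)
        have "\<rho> (inv v) (y c) \<in> space N"
          using x(4) V y by (intro N.act_space) auto
        then show ?thesis
          using x f'_act[OF x(1,2)] y by (simp add: Q_def A_def P_def Gd_def)
      qed
      then show "x \<in> Q \<inter> Gd \<longleftrightarrow> x \<in> (\<Union>i\<in>?X. case i of (c, v) \<Rightarrow> D c v)"
        unfolding Gd_UN[symmetric] by (auto 0 4)
    qed
    then have "measure M (Q \<inter> Gd) = (\<Sum>i\<in>?X. case i of (c, v) \<Rightarrow> measure M (D c v))"
      using D_UN[of ?X] V(1) by simp
    also have "\<dots> = (\<Sum>i\<in>{..<r} \<times> V. case i of (c, v) \<Rightarrow> measure M (D c v) * indicator (A w v) (y c))"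
      using V(1) by (intro sum.mono_neutral_cong_left) (auto simp: indicator_def)
    also have "\<dots> = (\<Sum>c<r. \<Sum>v\<in>V. measure M (D c v) * indicator (A w v) (y c))"
      by (simp add: sum.cartesian_product)
    finally have 1: "\<bar>measure M (Q \<inter> Gd) - measure N (P w) * measure M Gd\<bar> \<le> \<theta>"
      using close[OF w] by simp
    have "measure M Q = measure M (Q \<inter> Gd) + measure M (Q - Gd)"
      using M.finite_measure_Union[of "Q \<inter> Gd" "Q - Gd"] Q Gd_sets
      by (metis Diff_disjoint Int_Diff_Un Int_assoc inf_bot_right sets.Diff sets.Int)
    moreover have "measure M (Q - Gd) \<le> measure M (space M - Gd)"
      using Q Gd_sets by (intro M.finite_measure_mono) (auto simp: Q_def)
    ultimately have 2: "\<bar>measure M Q - measure M (Q \<inter> Gd)\<bar> \<le> 2 * \<theta>"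
      using compl_Gd measure_nonneg[of M "Q - Gd"] by linarith
    have "measure N (P w) * (1 - measure M Gd) \<le> 1 - measure M Gd"
      by (intro mult_left_le_one_le) auto
    moreover have "0 \<le> measure N (P w) * (1 - measure M Gd)"
      by (intro mult_nonneg_nonneg) auto
    moreover have "measure N (P w) - measure N (P w) * measure M Gd = measure N (P w) * (1 - measure M Gd)"
      by (simp add: algebra_simps)
    ultimately have 3: "\<bar>measure N (P w) - measure N (P w) * measure M Gd\<bar> \<le> 2 * \<theta>"
      using Gd_large by linarith
    have "\<bar>measure M Q - measure N (P w)\<bar> \<le> 5 * \<theta>"
      using 1 2 3 by linarith
    also have "\<dots> < \<epsilon>"
      using \<epsilon> by (simp add: \<theta>_def)
    finally show "\<bar>measure M {x\<in>space M. \<forall>h\<in>F. f' (\<sigma> h x) = w h} -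
        measure N {y\<in>space N. \<forall>h\<in>F. f (\<rho> h y) = w h}\<bar> < \<epsilon>"
      by (simp add: Q_def P_def)
  qed
qed

section \<open>Weak embeddability in terms of a generating algebra\<close>

lemma (in finite_measure) abs_measure_diff_le:
  assumes "A \<in> sets M" "B \<in> sets M"
  shows "\<bar>measure M A - measure M B\<bar> \<le> measure M (sym_diff A B)"
proof -
  have D: "sym_diff A B \<in> sets M"
    using assms by auto
  have "measure M A \<le> measure M (B \<union> sym_diff A B)"
    using assms D by (intro finite_measure_mono sets.Un) auto
  also have "\<dots> \<le> measure M B + measure M (sym_diff A B)"
    using assms(2) D by (rule measure_Un_le)
  finally have "measure M A \<le> measure M B + measure M (sym_diff A B)" .
  moreover have "measure M B \<le> measure M (A \<union> sym_diff A B)"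
    using assms D by (intro finite_measure_mono sets.Un) auto
  moreover have "measure M (A \<union> sym_diff A B) \<le> measure M A + measure M (sym_diff A B)"
    using assms(1) D by (rule measure_Un_le)
  ultimately show ?thesis by linarith
qed

text \<open>
  The approximable sets form a sigma algebra; a countable union is first replaced by a finite one.
\<close>
lemma (in finite_measure) sigma_sets_approximation:
  assumes alg: "algebra (space M) \<A>" and sub: "\<A> \<subseteq> sets M"
    and A: "A \<in> sigma_sets (space M) \<A>" and \<delta>: "\<delta> > 0"
  shows "\<exists>B\<in>\<A>. measure M (sym_diff A B) < \<delta>"
  using A \<delta>
proof (induction arbitrary: \<delta> rule: sigma_sets.induct)
  case (Basic a)
  then show ?case by (intro bexI[of _ a]) auto
next
  case Empty
  interpret algebra "space M" \<A> by fact
  show ?case using Empty by (intro bexI[of _ "{}"]) auto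
next
  case (Compl a)
  interpret algebra "space M" \<A> by fact
  obtain B where B: "B \<in> \<A>" "measure M (sym_diff a B) < \<delta>"
    using Compl by blast
  have "a \<subseteq> space M" "B \<subseteq> space M"
    using Compl.hyps B(1) sub sets.sets_into_space sigma_sets_into_sp[of \<A> "space M"] space_closed by auto
  then have "sym_diff (space M - a) (space M - B) = sym_diff a B"
    by auto
  then show ?case
    using B by (intro bexI[of _ "space M - B"]) auto
next
  case (Union a)
  interpret algebra "space M" \<A> by fact
  have a: "a i \<in> sets M" for i
    using Union.hyps sets.sigma_sets_subset[OF sub] by auto
  let ?U = "\<Union>i. a i" and ?V = "\<lambda>n. \<Union>i<n. a i"
  have "(\<lambda>n. measure M (?U - ?V n)) \<longlonglongrightarrow> measure M (\<Inter>n. ?U - ?V n)"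
    using a by (intro finite_Lim_measure_decseq) (auto simp: decseq_def)
  also have "(\<Inter>n. ?U - ?V n) = {}"
    by auto
  finally have "(\<lambda>n. measure M (?U - ?V n)) \<longlonglongrightarrow> 0"
    by simp
  then have "\<forall>\<^sub>F n in sequentially. measure M (?U - ?V n) < \<delta> / 2"
    using Union.prems by (intro order_tendstoD(2)) auto
  then obtain n where n: "measure M (?U - ?V n) < \<delta> / 2"
    by (auto simp: eventually_sequentially)
  define \<eta> where "\<eta> = \<delta> / (2 * (real n + 1))"
  have \<eta>: "\<eta> > 0"
    using Union.prems by (simp add: \<eta>_def)
  have "\<exists>B. \<forall>i. B i \<in> \<A> \<and> measure M (sym_diff (a i) (B i)) < \<eta>"
    using Union.IH[OF \<eta>] by (intro choice) blast
  then obtain B where B: "\<And>i. B i \<in> \<A>" "\<And>i. measure M (sym_diff (a i) (B i)) < \<eta>"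
    by blast
  let ?B = "\<Union>i<n. B i"
  have B_sets: "B i \<in> sets M" for i
    using B(1) sub by auto
  have rest: "?U - ?V n \<in> sets M" and D: "\<And>i. sym_diff (a i) (B i) \<in> sets M"
    using a B_sets by auto
  have D': "(\<Union>i<n. sym_diff (a i) (B i)) \<in> sets M"
    using D by (intro sets.finite_UN) auto
  have "measure M (sym_diff ?U ?B) \<le> measure M ((?U - ?V n) \<union> (\<Union>i<n. sym_diff (a i) (B i)))"
    by (rule finite_measure_mono[OF _ sets.Un[OF rest D']]) auto
  also have "\<dots> \<le> measure M (?U - ?V n) + measure M (\<Union>i<n. sym_diff (a i) (B i))"
    using rest D' by (rule measure_Un_le)
  also have "measure M (\<Union>i<n. sym_diff (a i) (B i)) \<le> (\<Sum>i<n. measure M (sym_diff (a i) (B i)))"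
    using D by (intro finite_measure_subadditive_finite) auto
  also have "\<dots> \<le> (\<Sum>i<n. \<eta>)"
    using B(2) by (intro sum_mono less_imp_le)
  also have "(\<Sum>i<n. \<eta>) \<le> \<delta> / 2"
    using Union.prems by (simp add: \<eta>_def field_simps)
  finally have "measure M (sym_diff ?U ?B) < \<delta>"
    using n by linarith
  moreover have "?B \<in> \<A>"
    using B(1) by (intro finite_UN) auto
  ultimately show ?case
    by blast
qed

lemma (in pmp) Inter_act_close:
  fixes \<delta> :: real
  assumes I: "finite I" and g: "\<And>i. i \<in> I \<Longrightarrow> g i \<in> carrier G"
    and A: "\<And>i. i \<in> I \<Longrightarrow> A i \<in> sets M" and B: "\<And>i. i \<in> I \<Longrightarrow> B i \<in> sets M"
    and close: "\<And>i. i \<in> I \<Longrightarrow> measure M (sym_diff (A i) (B i)) \<le> \<delta>"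
  shows "\<bar>measure M {x\<in>space M. \<forall>i\<in>I. \<sigma> (g i) x \<in> A i} - measure M {x\<in>space M. \<forall>i\<in>I. \<sigma> (g i) x \<in> B i}\<bar>
    \<le> card I * \<delta>"
proof -
  have sets1: "{x\<in>space M. \<sigma> (g i) x \<in> X} \<in> sets M" if "i \<in> I" "X \<in> sets M" for i X
    using measurable_sets[OF measurable_act[OF g[OF that(1)]] that(2)]
    by (simp add: vimage_def Int_def conj_commute)
  have sets: "{x\<in>space M. \<forall>i\<in>I. \<sigma> (g i) x \<in> X i} \<in> sets M" if "\<And>i. i \<in> I \<Longrightarrow> X i \<in> sets M" for X
    using sets1 that I by (intro sets.sets_Collect_finite_All) auto
  let ?D = "\<lambda>i. {x\<in>space M. \<sigma> (g i) x \<in> sym_diff (A i) (B i)}"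
  have D: "?D i \<in> sets M" if "i \<in> I" for i
    by (rule sets1[OF that]) (intro sets.Un sets.Diff A[OF that] B[OF that])
  have "\<bar>measure M {x\<in>space M. \<forall>i\<in>I. \<sigma> (g i) x \<in> A i} - measure M {x\<in>space M. \<forall>i\<in>I. \<sigma> (g i) x \<in> B i}\<bar>
      \<le> measure M (sym_diff {x\<in>space M. \<forall>i\<in>I. \<sigma> (g i) x \<in> A i} {x\<in>space M. \<forall>i\<in>I. \<sigma> (g i) x \<in> B i})"
    by (intro abs_measure_diff_le sets A B)
  also have "\<dots> \<le> measure M (\<Union>i\<in>I. ?D i)"
    by (rule finite_measure_mono[OF _ sets.finite_UN[OF I D]]) auto
  also have "\<dots> \<le> (\<Sum>i\<in>I. measure M (?D i))"
    using I D by (intro finite_measure_subadditive_finite) auto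
  also have "\<dots> \<le> (\<Sum>i\<in>I. \<delta>)"
  proof (rule sum_mono)
    fix i assume i: "i \<in> I"
    then have "sym_diff (A i) (B i) \<in> sets M"
      using A B by auto
    then show "measure M (?D i) \<le> \<delta>"
      using measure_act[OF g[OF i], of "sym_diff (A i) (B i)"] close[OF i] by simp
  qed
  finally show ?thesis by simp
qed

text \<open>
  Projections are indicator functions almost everywhere, and a product of indicator functions is the indicator
  function of the intersection. This turns the moments in the definition of weak embeddability into measures.
\<close>
lemma (in pmp) integral_prod_induced_action:
  fixes I :: "nat set"
  assumes I: "finite I" and g: "\<And>i. i \<in> I \<Longrightarrow> g i \<in> carrier G"
    and A: "\<And>i. i \<in> I \<Longrightarrow> A i \<in> sets M" and p: "\<And>i. i \<in> I \<Longrightarrow> p i \<in> borel_measurable M"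
    and eq: "\<And>i. i \<in> I \<Longrightarrow> AE x in M. p i x = indicator (A i) x"
  shows "(\<integral>t. (\<Prod>i\<in>I. induced_action G \<sigma> (g i) (p i) t) \<partial>M) =
    complex_of_real (measure M {x\<in>space M. \<forall>i\<in>I. \<sigma> (inv (g i)) x \<in> A i})"
proof -
  let ?X = "{x\<in>space M. \<forall>i\<in>I. \<sigma> (inv (g i)) x \<in> A i}"
  have g': "inv (g i) \<in> carrier G" if "i \<in> I" for i
    using g that by simp
  have "{x\<in>space M. \<sigma> (inv (g i)) x \<in> A i} \<in> sets M" if "i \<in> I" for i
    using measurable_sets[OF measurable_act[OF g'[OF that]] A[OF that]]
    by (simp add: vimage_def Int_def conj_commute)
  then have X: "?X \<in> sets M"
    using I by (intro sets.sets_Collect_finite_All) auto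
  have "AE t in M. \<forall>i\<in>I. p i (\<sigma> (inv (g i)) t) = indicator (A i) (\<sigma> (inv (g i)) t)"
    using eq g' by (intro AE_finite_allI I AE_act[where P = "\<lambda>x. p _ x = indicator (A _) x"]) auto
  then have "AE t in M. (\<Prod>i\<in>I. induced_action G \<sigma> (g i) (p i) t) = complex_of_real (indicator ?X t)"
    using AE_space
  proof eventually_elim
    case (elim t)
    have "(\<Prod>i\<in>I. induced_action G \<sigma> (g i) (p i) t) = (\<Prod>i\<in>I. indicator (A i) (\<sigma> (inv (g i)) t))"
      using elim by (intro prod.cong) (auto simp: induced_action_def)
    also have "\<dots> = complex_of_real (indicator ?X t)"
    proof (cases "t \<in> ?X")
      case False
      then obtain i where "i \<in> I" "\<sigma> (inv (g i)) t \<notin> A i"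
        using elim by blast
      then show ?thesis
        using I False by (subst prod_zero_iff[THEN iffD2]) (auto simp: indicator_def)
    qed simp
    finally show ?case .
  qed
  moreover have "(\<lambda>t. \<Prod>i\<in>I. induced_action G \<sigma> (g i) (p i) t) \<in> borel_measurable M"
    unfolding induced_action_def using p g'
    by (intro borel_measurable_prod measurable_compose[OF measurable_act])
  ultimately have "(\<integral>t. (\<Prod>i\<in>I. induced_action G \<sigma> (g i) (p i) t) \<partial>M) = (\<integral>t. complex_of_real (indicator ?X t) \<partial>M)"
    using X by (intro integral_cong_AE) auto
  also have "\<dots> = complex_of_real (measure M ?X)"
    using X by (simp add: emeasure_eq_measure)
  finally show ?thesis .
qed

text \<open>
  Projections may be replaced by sets from a generating algebra: approximating each of the at most \<open>K\<close> factors
  within \<open>\<delta>\<close> changes the measure of the intersection by at most \<open>K \<delta>\<close>, half of the allowed error.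
\<close>
lemma weakly_embeddableI:
  fixes G (structure)
  assumes \<sigma>: "pmp_action G M \<sigma>" and \<rho>: "pmp_action G N \<rho>"
    and \<A>: "algebra (space M) \<A>" "sets M = sigma_sets (space M) \<A>"
    and key: "\<And>F n A \<epsilon>. finite F \<Longrightarrow> F \<subseteq> carrier G \<Longrightarrow> \<forall>i\<in>{1..n::nat}. A i \<in> \<A> \<Longrightarrow> (0::real) < \<epsilon> \<Longrightarrow>
      \<exists>B. (\<forall>i\<in>{1..n}. B i \<in> sets N) \<and>
        (\<forall>k (g :: nat \<Rightarrow> 'g) m. (\<forall>i\<in>{1..k::nat}. g i \<in> F \<and> m i \<in> {1..n}) \<longrightarrow>
          \<bar>measure M {x\<in>space M. \<forall>i\<in>{1..k}. \<sigma> (inv (g i)) x \<in> A (m i)} -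
           measure N {y\<in>space N. \<forall>i\<in>{1..k}. \<rho> (inv (g i)) y \<in> B (m i)}\<bar> < \<epsilon>)"
  shows "weakly_embeddable G M \<sigma> N \<rho>"
  unfolding weakly_embeddable_def
proof (intro allI impI)
  fix F :: "'g set" and n K :: nat and p :: "nat \<Rightarrow> 'b \<Rightarrow> complex" and \<epsilon> :: real
  assume F: "finite F" "F \<subseteq> carrier G" and p: "\<forall>i\<in>{1..n}. Linfty_projection M (p i)"
    and K: "1 \<le> K" and \<epsilon>: "0 < \<epsilon>"
  interpret M: pmp G M \<sigma>
    using \<sigma> by unfold_locales
  interpret N: pmp G N \<rho>
    using \<rho> by unfold_locales
  have sub: "\<A> \<subseteq> sets M"
    using \<A>(2) by auto
  define \<delta> where "\<delta> = \<epsilon> / (2 * K)"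
  have \<delta>: "\<delta> > 0"
    using \<epsilon> K by (simp add: \<delta>_def)
  define A0 where "A0 i = {x\<in>space M. p i x = 1}" for i
  have p_meas: "p i \<in> borel_measurable M" and A0: "A0 i \<in> sets M"
    and p_eq: "AE x in M. p i x = indicator (A0 i) x" if "i \<in> {1..n}" for i
  proof -
    have proj: "Linfty_projection M (p i)"
      using p that by blast
    then show meas: "p i \<in> borel_measurable M"
      by (simp add: Linfty_projection_def Linfty_def)
    have "p i -` {1} \<inter> space M \<in> sets M"
      using meas by (intro measurable_sets[OF meas]) auto
    then show "A0 i \<in> sets M"
      by (simp add: A0_def vimage_def Int_def conj_commute)
    have "AE x in M. p i x * p i x = p i x"
      using proj by (simp add: Linfty_projection_def)
    then show "AE x in M. p i x = indicator (A0 i) x"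
      using AE_space
    proof eventually_elim
      case (elim x)
      then have "p i x = 0 \<or> p i x = 1"
        by simp
      then show ?case
        using elim by (auto simp: A0_def indicator_def)
    qed
  qed
  have "\<forall>i\<in>{1..n}. \<exists>A\<in>\<A>. measure M (sym_diff (A0 i) A) < \<delta>"
    using M.sigma_sets_approximation[OF \<A>(1) sub _ \<delta>] A0 \<A>(2) by blast
  then obtain A where A: "\<forall>i\<in>{1..n}. A i \<in> \<A>" and A_close: "\<forall>i\<in>{1..n}. measure M (sym_diff (A0 i) (A i)) < \<delta>"
    by metis
  obtain B where B: "\<forall>i\<in>{1..n}. B i \<in> sets N"
    and AB: "\<forall>k (g :: nat \<Rightarrow> 'g) m. (\<forall>i\<in>{1..k}. g i \<in> F \<and> m i \<in> {1..n}) \<longrightarrow>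
          \<bar>measure M {x\<in>space M. \<forall>i\<in>{1..k}. \<sigma> (inv (g i)) x \<in> A (m i)} -
           measure N {y\<in>space N. \<forall>i\<in>{1..k}. \<rho> (inv (g i)) y \<in> B (m i)}\<bar> < \<epsilon> / 2"
    using key[OF F A half_gt_zero[OF \<epsilon>]] by (elim exE conjE) (rule that)
  define q where "q i = (indicator (B i) :: 'c \<Rightarrow> complex)" for i
  have q_meas: "q i \<in> borel_measurable N" if "i \<in> {1..n}" for i
    using B that unfolding q_def by (intro borel_measurable_indicator) auto
  show "\<exists>q. (\<forall>i\<in>{1..n}. Linfty_projection N (q i)) \<and>
      (\<forall>k\<in>{1..K}. \<forall>(g::nat \<Rightarrow> 'g) (m::nat \<Rightarrow> nat). (\<forall>i\<in>{1..k}. g i \<in> F \<and> m i \<in> {1..n}) \<longrightarrow>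
        cmod ((\<integral>t. (\<Prod>i=1..k. induced_action G \<sigma> (g i) (p (m i)) t) \<partial>M)
            - (\<integral>t. (\<Prod>i=1..k. induced_action G \<rho> (g i) (q (m i)) t) \<partial>N)) < \<epsilon>)"
  proof (intro exI[of _ q] conjI ballI allI impI)
    fix i assume i: "i \<in> {1..n}"
    have "AE y in N. cmod (q i y) \<le> 1"
      by (auto simp: q_def indicator_def)
    then show "Linfty_projection N (q i)"
      using q_meas[OF i] unfolding Linfty_projection_def Linfty_def
      by (auto simp: q_def indicator_def)
  next
    fix k :: nat and g :: "nat \<Rightarrow> 'g" and m :: "nat \<Rightarrow> nat"
    assume k: "k \<in> {1..K}" and gm: "\<forall>i\<in>{1..k}. g i \<in> F \<and> m i \<in> {1..n}"
    have g: "g i \<in> carrier G" and m: "m i \<in> {1..n}" if "i \<in> {1..k}" for i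
      using gm that F by blast+
    let ?a = "measure M {x\<in>space M. \<forall>i\<in>{1..k}. \<sigma> (inv (g i)) x \<in> A0 (m i)}"
    let ?a' = "measure M {x\<in>space M. \<forall>i\<in>{1..k}. \<sigma> (inv (g i)) x \<in> A (m i)}"
    let ?b = "measure N {y\<in>space N. \<forall>i\<in>{1..k}. \<rho> (inv (g i)) y \<in> B (m i)}"
    have I1: "(\<integral>t. (\<Prod>i=1..k. induced_action G \<sigma> (g i) (p (m i)) t) \<partial>M) = complex_of_real ?a"
      by (rule M.integral_prod_induced_action) (use g m A0 p_meas p_eq in auto)
    have I2: "(\<integral>t. (\<Prod>i=1..k. induced_action G \<rho> (g i) (q (m i)) t) \<partial>N) = complex_of_real ?b"
      by (rule N.integral_prod_induced_action) (use g m B q_meas in \<open>auto simp: q_def\<close>)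
    have "\<bar>?a - ?a'\<bar> \<le> card {1..k} * \<delta>"
      by (rule M.Inter_act_close) (use g m A0 A sub A_close in \<open>auto intro: less_imp_le\<close>)
    also have "\<dots> \<le> K * \<delta>"
      using k \<delta> by (intro mult_right_mono) auto
    also have "\<dots> = \<epsilon> / 2"
      using K by (simp add: \<delta>_def)
    finally have "\<bar>?a - ?b\<bar> < \<epsilon>"
      using mp[OF spec[OF spec[OF spec[OF AB, of k], of g], of m] gm] by linarith
    then show "cmod ((\<integral>t. (\<Prod>i=1..k. induced_action G \<sigma> (g i) (p (m i)) t) \<partial>M)
        - (\<integral>t. (\<Prod>i=1..k. induced_action G \<rho> (g i) (q (m i)) t) \<partial>N)) < \<epsilon>"
      unfolding I1 I2 of_real_diff[symmetric] norm_of_real .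
  qed
qed

section \<open>Cylinder sets in infinite products\<close>

definition separated_alike :: "'i set \<Rightarrow> 'y set set \<Rightarrow> ('i \<Rightarrow> 'y) \<Rightarrow> ('i \<Rightarrow> 'y) \<Rightarrow> bool" where
  "separated_alike J \<E> s t \<longleftrightarrow> (\<forall>i\<in>J. \<forall>E\<in>\<E>. s i \<in> E \<longleftrightarrow> t i \<in> E)"

text \<open>
  Membership in \<open>A\<close> depends only on which of the sets in \<open>\<E>\<close> contain the coordinates with index in \<open>J\<close>.
  Enlarging \<open>J\<close> and \<open>\<E>\<close> preserves this, so finitely many such sets can share the same data; this is what makes
  the Boolean operations immediate and provides one labelling for all of them.
\<close>
definition finitely_determined :: "'i set \<Rightarrow> 'y measure \<Rightarrow> 'i set \<Rightarrow> 'y set set \<Rightarrow> ('i \<Rightarrow> 'y) set \<Rightarrow> bool" where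
  "finitely_determined L N J \<E> A \<longleftrightarrow> A \<subseteq> space (PiM L (\<lambda>_. N)) \<and>
     finite J \<and> J \<subseteq> L \<and> finite \<E> \<and> \<E> \<subseteq> sets N \<and>
     (\<forall>s\<in>A. \<forall>t\<in>space (PiM L (\<lambda>_. N)). separated_alike J \<E> s t \<longrightarrow> t \<in> A)"

definition cylinder_sets :: "'i set \<Rightarrow> 'y measure \<Rightarrow> ('i \<Rightarrow> 'y) set set" where
  "cylinder_sets L N = {A. \<exists>J \<E>. finitely_determined L N J \<E> A}"

lemma separated_alike_sym: "separated_alike J \<E> s t \<Longrightarrow> separated_alike J \<E> t s"
  by (simp add: separated_alike_def)

lemma finitely_determinedI:
  assumes "A \<subseteq> space (PiM L (\<lambda>_. N))" "finite J" "J \<subseteq> L" "finite \<E>" "\<E> \<subseteq> sets N"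
    "\<And>s t. s \<in> A \<Longrightarrow> t \<in> space (PiM L (\<lambda>_. N)) \<Longrightarrow> separated_alike J \<E> s t \<Longrightarrow> t \<in> A"
  shows "finitely_determined L N J \<E> A"
  unfolding finitely_determined_def by (intro conjI ballI impI) (fact assms)+

lemma finitely_determinedD:
  assumes "finitely_determined L N J \<E> A"
  shows "A \<subseteq> space (PiM L (\<lambda>_. N))" "finite J" "J \<subseteq> L" "finite \<E>" "\<E> \<subseteq> sets N"
  using assms unfolding finitely_determined_def by simp_all

lemma finitely_determined_step:
  assumes "finitely_determined L N J \<E> A" "s \<in> A" "t \<in> space (PiM L (\<lambda>_. N))" "separated_alike J \<E> s t"
  shows "t \<in> A"
  using assms(1)[unfolded finitely_determined_def] assms(2-4) by simp

lemma finitely_determined_mono: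
  assumes A: "finitely_determined L N J \<E> A" and J': "J \<subseteq> J'" "finite J'" "J' \<subseteq> L"
    and E': "\<E> \<subseteq> \<E>'" "finite \<E>'" "\<E>' \<subseteq> sets N"
  shows "finitely_determined L N J' \<E>' A"
proof (rule finitely_determinedI[OF finitely_determinedD(1)[OF A] J'(2,3) E'(2,3)])
  fix s t assume st: "s \<in> A" "t \<in> space (PiM L (\<lambda>_. N))" "separated_alike J' \<E>' s t"
  have "separated_alike J \<E> s t"
    using st(3) J'(1) E'(1) by (simp add: separated_alike_def subset_iff)
  then show "t \<in> A"
    by (rule finitely_determined_step[OF A st(1,2)])
qed

lemma algebra_cylinder_sets: "algebra (space (PiM L (\<lambda>_. N))) (cylinder_sets L N)"
  unfolding algebra_iff_Un
proof (intro conjI ballI)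
  show "cylinder_sets L N \<subseteq> Pow (space (PiM L (\<lambda>_. N)))"
    by (auto simp: cylinder_sets_def finitely_determined_def)
  have "finitely_determined L N {} {} {}"
    by (simp add: finitely_determined_def)
  then show "{} \<in> cylinder_sets L N"
    unfolding cylinder_sets_def by blast
next
  fix A assume "A \<in> cylinder_sets L N"
  then obtain J \<E> where A: "finitely_determined L N J \<E> A"
    by (auto simp: cylinder_sets_def)
  have "finitely_determined L N J \<E> (space (PiM L (\<lambda>_. N)) - A)"
  proof (rule finitely_determinedI[OF Diff_subset finitely_determinedD(2-5)[OF A]])
    fix s t assume "s \<in> space (PiM L (\<lambda>_. N)) - A" "t \<in> space (PiM L (\<lambda>_. N))" "separated_alike J \<E> s t"
    then show "t \<in> space (PiM L (\<lambda>_. N)) - A"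
      using finitely_determined_step[OF A, of t s] separated_alike_sym by auto
  qed
  then show "space (PiM L (\<lambda>_. N)) - A \<in> cylinder_sets L N"
    unfolding cylinder_sets_def by blast
next
  fix A B assume "A \<in> cylinder_sets L N" "B \<in> cylinder_sets L N"
  then obtain J \<E> J' \<E>' where AB: "finitely_determined L N J \<E> A" "finitely_determined L N J' \<E>' B"
    by (auto simp: cylinder_sets_def)
  have fin: "finite (J \<union> J')" "J \<union> J' \<subseteq> L" "finite (\<E> \<union> \<E>')" "\<E> \<union> \<E>' \<subseteq> sets N"
    using finitely_determinedD(2-5)[OF AB(1)] finitely_determinedD(2-5)[OF AB(2)] by simp_all
  have A: "finitely_determined L N (J \<union> J') (\<E> \<union> \<E>') A"
    by (rule finitely_determined_mono[OF AB(1)]) (use fin in auto)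
  have B: "finitely_determined L N (J \<union> J') (\<E> \<union> \<E>') B"
    by (rule finitely_determined_mono[OF AB(2)]) (use fin in auto)
  have "finitely_determined L N (J \<union> J') (\<E> \<union> \<E>') (A \<union> B)"
  proof (rule finitely_determinedI[OF _ fin])
    show "A \<union> B \<subseteq> space (PiM L (\<lambda>_. N))"
      using finitely_determinedD(1)[OF A] finitely_determinedD(1)[OF B] by (rule Un_least)
    show "t \<in> A \<union> B" if "s \<in> A \<union> B" "t \<in> space (PiM L (\<lambda>_. N))" "separated_alike (J \<union> J') (\<E> \<union> \<E>') s t" for s t
      using that finitely_determined_step[OF A, of s t] finitely_determined_step[OF B, of s t] by auto
  qed
  then show "A \<union> B \<in> cylinder_sets L N"
    unfolding cylinder_sets_def by blast
qed

lemma measurable_separation: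
  assumes "finite \<E>" "\<E> \<subseteq> sets N"
  shows "(\<lambda>y. {E\<in>\<E>. y \<in> E}) \<in> measurable N (count_space (Pow \<E>))"
  unfolding measurable_count_space_eq2[OF finite_Pow_iff[THEN iffD2, OF assms(1)]]
proof (intro conjI ballI)
  fix X assume X: "X \<in> Pow \<E>"
  have "{y\<in>space N. \<forall>E\<in>\<E>. y \<in> E \<longleftrightarrow> E \<in> X} \<in> sets N"
  proof (intro sets.sets_Collect_finite_All assms(1))
    fix E assume "E \<in> \<E>"
    then have [measurable]: "E \<in> sets N"
      using assms(2) by auto
    show "{y\<in>space N. y \<in> E \<longleftrightarrow> E \<in> X} \<in> sets N"
      by measurable
  qed
  also have "{y\<in>space N. \<forall>E\<in>\<E>. y \<in> E \<longleftrightarrow> E \<in> X} = (\<lambda>y. {E\<in>\<E>. y \<in> E}) -` {X} \<inter> space N"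
    using X by auto
  finally show "(\<lambda>y. {E\<in>\<E>. y \<in> E}) -` {X} \<inter> space N \<in> sets N" .
qed auto

lemma separated_alike_iff:
  "separated_alike J \<E> s t \<longleftrightarrow> (\<forall>i\<in>J. {E\<in>\<E>. s i \<in> E} = {E\<in>\<E>. t i \<in> E})"
  unfolding separated_alike_def by blast

lemma sets_PiM_eq_cylinder_sets:
  "sets (PiM L (\<lambda>_. N)) = sigma_sets (space (PiM L (\<lambda>_. N))) (cylinder_sets L N)"
proof
  have "sigma_sets (\<Pi>\<^sub>E i\<in>L. space N) {{f\<in>\<Pi>\<^sub>E i\<in>L. space N. f i \<in> A} | i A. i \<in> L \<and> A \<in> sets N}
      \<subseteq> sigma_sets (space (PiM L (\<lambda>_. N))) (cylinder_sets L N)"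
    unfolding space_PiM
  proof (rule sigma_sets_mono', intro subsetI)
    fix X assume "X \<in> {{f\<in>\<Pi>\<^sub>E i\<in>L. space N. f i \<in> A} | i A. i \<in> L \<and> A \<in> sets N}"
    then obtain i A where X: "X = {f\<in>\<Pi>\<^sub>E i\<in>L. space N. f i \<in> A}" "i \<in> L" "A \<in> sets N"
      by blast
    then have "finitely_determined L N {i} {A} X"
      by (intro finitely_determinedI) (auto simp: separated_alike_def space_PiM)
    then show "X \<in> cylinder_sets L N"
      unfolding cylinder_sets_def by blast
  qed
  then show "sets (PiM L (\<lambda>_. N)) \<subseteq> sigma_sets (space (PiM L (\<lambda>_. N))) (cylinder_sets L N)"
    by (simp add: sets_PiM_single)
next
  have "A \<in> sets (PiM L (\<lambda>_. N))" if "A \<in> cylinder_sets L N" for A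
  proof -
    obtain J \<E> where A: "finitely_determined L N J \<E> A"
      using \<open>A \<in> cylinder_sets L N\<close> by (auto simp: cylinder_sets_def)
    have J: "finite J" "J \<subseteq> L" and E: "finite \<E>" "\<E> \<subseteq> sets N"
      using finitely_determinedD(2-5)[OF A] by simp_all
    have "{t\<in>space (PiM L (\<lambda>_. N)). t \<in> A} \<in> sets (PiM L (\<lambda>_. N))"
    proof (rule sets_Collect_determined[where f = "\<lambda>i t. {E\<in>\<E>. t i \<in> E}" and V = J and R = "Pow \<E>"])
      show "countable (Pow \<E>)"
        using E(1) by (intro countable_finite) simp
      show "(\<lambda>t. {E\<in>\<E>. t i \<in> E}) \<in> measurable (PiM L (\<lambda>_. N)) (count_space (Pow \<E>))" if "i \<in> J" for i
      proof -
        have "(\<lambda>t. t i) \<in> measurable (PiM L (\<lambda>_. N)) N"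
          using measurable_component_singleton[of i L "\<lambda>_. N"] that J by auto
        then show ?thesis
          by (rule measurable_compose) (rule measurable_separation[OF E])
      qed
      show "t \<in> A" if "s \<in> space (PiM L (\<lambda>_. N))" "t \<in> space (PiM L (\<lambda>_. N))" "s \<in> A"
        "\<And>i. i \<in> J \<Longrightarrow> {E\<in>\<E>. s i \<in> E} = {E\<in>\<E>. t i \<in> E}" for s t
        using finitely_determined_step[OF A that(3,2)] that(4) by (simp add: separated_alike_iff)
    qed (rule J)
    also have "{t\<in>space (PiM L (\<lambda>_. N)). t \<in> A} = A"
      using finitely_determinedD(1)[OF A] by auto
    finally show ?thesis .
  qed
  then show "sigma_sets (space (PiM L (\<lambda>_. N))) (cylinder_sets L N) \<subseteq> sets (PiM L (\<lambda>_. N))"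
    by (intro sets.sigma_sets_subset) auto
qed

text \<open>
  Each single pattern is a box, and the coordinates are independent. The law of the patterns in all
  coordinates is thus a polynomial in the laws of the single coordinates, which is how closeness of the latter
  passes to the product.
\<close>
lemma measure_PiM_pattern:
  assumes N: "prob_space N" and J: "finite J" "J \<subseteq> L" and Q: "finite Q"
    and u: "\<And>i. i \<in> J \<Longrightarrow> u i \<in> measurable N (count_space Q)" and \<Psi>: "\<Psi> \<subseteq> J \<rightarrow>\<^sub>E Q"
  shows "measure (PiM L (\<lambda>_. N)) {t\<in>space (PiM L (\<lambda>_. N)). (\<lambda>i\<in>J. u i (t i)) \<in> \<Psi>} =
    (\<Sum>\<pi>\<in>\<Psi>. \<Prod>i\<in>J. measure N {y\<in>space N. u i y = \<pi> i})"
proof -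
  interpret N: prob_space N by fact
  interpret P: product_prob_space "\<lambda>_. N" L
    by unfold_locales
  let ?P = "PiM L (\<lambda>_. N)"
  define X where "X \<pi> i = {y\<in>space N. u i y = \<pi> i}" for \<pi> i
  have X: "X \<pi> i \<in> sets N" if "\<pi> \<in> \<Psi>" "i \<in> J" for \<pi> i
  proof -
    have "{\<pi> i} \<subseteq> Q"
      using that \<Psi> by auto
    then have "u i -` {\<pi> i} \<inter> space N \<in> sets N"
      by (intro measurable_sets[OF u[OF that(2)]]) simp
    then show ?thesis
      by (simp add: X_def vimage_def Int_def conj_commute)
  qed
  have fin: "finite \<Psi>"
    using \<Psi> finite_PiE[OF J(1), of "\<lambda>_. Q"] Q finite_subset by blast
  have emb_iff: "t \<in> prod_emb L (\<lambda>_. N) J (Pi\<^sub>E J (X \<pi>)) \<longleftrightarrow> (\<forall>i\<in>J. u i (t i) = \<pi> i)"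
    if "t \<in> space ?P" for t \<pi>
    using that J by (auto simp: prod_emb_def X_def space_PiM PiE_iff subset_iff)
  have emb_sub: "prod_emb L (\<lambda>_. N) J (Pi\<^sub>E J (X \<pi>)) \<subseteq> space ?P" for \<pi>
    by (auto simp: prod_emb_def space_PiM)
  have "{t\<in>space ?P. (\<lambda>i\<in>J. u i (t i)) \<in> \<Psi>} = (\<Union>\<pi>\<in>\<Psi>. prod_emb L (\<lambda>_. N) J (Pi\<^sub>E J (X \<pi>)))"
  proof (intro equalityI subsetI)
    fix t assume t: "t \<in> {t\<in>space ?P. (\<lambda>i\<in>J. u i (t i)) \<in> \<Psi>}"
    then show "t \<in> (\<Union>\<pi>\<in>\<Psi>. prod_emb L (\<lambda>_. N) J (Pi\<^sub>E J (X \<pi>)))"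
      using emb_iff[of t "\<lambda>i\<in>J. u i (t i)"] by auto
  next
    fix t assume "t \<in> (\<Union>\<pi>\<in>\<Psi>. prod_emb L (\<lambda>_. N) J (Pi\<^sub>E J (X \<pi>)))"
    then obtain \<pi> where \<pi>: "\<pi> \<in> \<Psi>" "t \<in> prod_emb L (\<lambda>_. N) J (Pi\<^sub>E J (X \<pi>))"
      by blast
    then have t: "t \<in> space ?P" "\<forall>i\<in>J. u i (t i) = \<pi> i"
      using emb_sub emb_iff by blast+
    have "(\<lambda>i\<in>J. u i (t i)) = \<pi>"
    proof
      fix i
      have "\<pi> \<in> J \<rightarrow>\<^sub>E Q"
        using \<pi>(1) \<Psi> by (rule subsetD[rotated])
      then have "\<pi> i = undefined" if "i \<notin> J"
        using that by (rule PiE_arb)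
      then show "(\<lambda>i\<in>J. u i (t i)) i = \<pi> i"
        using bspec[OF t(2), of i] by (cases "i \<in> J") simp_all
    qed
    then show "t \<in> {t\<in>space ?P. (\<lambda>i\<in>J. u i (t i)) \<in> \<Psi>}"
      using t \<pi> by simp
  qed
  also have "measure ?P \<dots> = (\<Sum>\<pi>\<in>\<Psi>. measure ?P (prod_emb L (\<lambda>_. N) J (Pi\<^sub>E J (X \<pi>))))"
  proof (rule P.finite_measure_finite_Union[OF fin])
    show "(\<lambda>\<pi>. prod_emb L (\<lambda>_. N) J (Pi\<^sub>E J (X \<pi>))) ` \<Psi> \<subseteq> sets ?P"
      using X J by (auto intro!: sets_PiM_I)
    show "disjoint_family_on (\<lambda>\<pi>. prod_emb L (\<lambda>_. N) J (Pi\<^sub>E J (X \<pi>))) \<Psi>"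
      unfolding disjoint_family_on_def
    proof (intro ballI impI)
      fix \<pi> \<pi>' assume *: "\<pi> \<in> \<Psi>" "\<pi>' \<in> \<Psi>" "\<pi> \<noteq> \<pi>'"
      then obtain i where i: "i \<in> J" "\<pi> i \<noteq> \<pi>' i"
        using PiE_ext[OF subsetD[OF \<Psi>] subsetD[OF \<Psi>], of \<pi> \<pi>'] by blast
      show "prod_emb L (\<lambda>_. N) J (Pi\<^sub>E J (X \<pi>)) \<inter> prod_emb L (\<lambda>_. N) J (Pi\<^sub>E J (X \<pi>')) = {}"
      proof (rule equals0I)
        fix t assume "t \<in> prod_emb L (\<lambda>_. N) J (Pi\<^sub>E J (X \<pi>)) \<inter> prod_emb L (\<lambda>_. N) J (Pi\<^sub>E J (X \<pi>'))"
        then have "\<forall>i\<in>J. u i (t i) = \<pi> i" "\<forall>i\<in>J. u i (t i) = \<pi>' i"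
          using emb_iff[of t] subsetD[OF emb_sub, of t] by auto
        then show False
          using i by simp
      qed
    qed
  qed
  also have "\<dots> = (\<Sum>\<pi>\<in>\<Psi>. \<Prod>i\<in>J. measure N (X \<pi> i))"
    using X J by (intro sum.cong refl P.measure_PiM_emb) auto
  finally show ?thesis
    by (simp add: X_def)
qed

section \<open>Co-induced actions\<close>

text \<open>
  The cocycles of two systems of representatives are cohomologous: \<open>k C\<close> compares the two representatives of
  the coset \<open>C\<close>.
\<close>
lemma coset_cocycle_change:
  assumes "group G" "subgroup H G" "coset_representatives G H S" "coset_representatives G H T"
    "g \<in> carrier G" "C \<in> lcosets\<^bsub>G\<^esub> H"
  defines "k \<equiv> \<lambda>C. inv\<^bsub>G\<^esub> coset_rep G H T C \<otimes>\<^bsub>G\<^esub> coset_rep G H S C"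
  shows "k (g <#\<^bsub>G\<^esub> C) \<otimes>\<^bsub>G\<^esub> coset_cocycle G H S g C = coset_cocycle G H T g C \<otimes>\<^bsub>G\<^esub> k C"
proof -
  interpret group G by fact
  have gC: "g <#\<^bsub>G\<^esub> C \<in> lcosets\<^bsub>G\<^esub> H"
    using lcosets_translate[OF assms(1,2,5,6)] .
  have cancel: "inv\<^bsub>G\<^esub> t' \<otimes>\<^bsub>G\<^esub> s' \<otimes>\<^bsub>G\<^esub> (inv\<^bsub>G\<^esub> s' \<otimes>\<^bsub>G\<^esub> (g \<otimes>\<^bsub>G\<^esub> s)) =
      inv\<^bsub>G\<^esub> t' \<otimes>\<^bsub>G\<^esub> (g \<otimes>\<^bsub>G\<^esub> t) \<otimes>\<^bsub>G\<^esub> (inv\<^bsub>G\<^esub> t \<otimes>\<^bsub>G\<^esub> s)"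
    if "s \<in> carrier G" "t \<in> carrier G" "s' \<in> carrier G" "t' \<in> carrier G" for s t s' t'
  proof -
    have "s' \<otimes>\<^bsub>G\<^esub> (inv\<^bsub>G\<^esub> s' \<otimes>\<^bsub>G\<^esub> (g \<otimes>\<^bsub>G\<^esub> s)) = g \<otimes>\<^bsub>G\<^esub> s" "t \<otimes>\<^bsub>G\<^esub> (inv\<^bsub>G\<^esub> t \<otimes>\<^bsub>G\<^esub> s) = s"
      using that assms(5) by (simp_all flip: m_assoc)
    then show ?thesis
      using that assms(5) by (simp add: m_assoc)
  qed
  show ?thesis
    unfolding k_def coset_cocycle_eq[OF assms(1,2,3,5,6)] coset_cocycle_eq[OF assms(1,2,4,5,6)]
    by (intro cancel coset_rep(3)[OF assms(3)] coset_rep(3)[OF assms(4)] assms(6) gC)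
qed

lemma coset_rep_quotient_in:
  assumes "group G" "subgroup H G" "coset_representatives G H S" "coset_representatives G H T"
    "C \<in> lcosets\<^bsub>G\<^esub> H"
  shows "inv\<^bsub>G\<^esub> coset_rep G H T C \<otimes>\<^bsub>G\<^esub> coset_rep G H S C \<in> H"
proof -
  interpret group G by fact
  have "coset_rep G H S C \<in> coset_rep G H S C <#\<^bsub>G\<^esub> H"
    using coset_rep(3)[OF assms(3,5)] assms(2) by (intro lcos_self)
  then have "coset_rep G H S C \<in> coset_rep G H T C <#\<^bsub>G\<^esub> H"
    using coset_rep(2)[OF assms(3,5)] coset_rep(2)[OF assms(4,5)] by simp
  then show ?thesis
    by (rule subgroup.lcos_module_imp[OF assms(2,1) coset_rep(3)[OF assms(4,5)]])
qed

lemma coinduced_action_inv_apply: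
  assumes "group G" "g \<in> carrier G" "C \<in> lcosets\<^bsub>G\<^esub> H" "t \<in> space (coinduced_space G H M)"
  shows "coinduced_action G H S M \<sigma> (inv\<^bsub>G\<^esub> g) t C =
    \<sigma> (coset_cocycle G H S (inv\<^bsub>G\<^esub> g) (g <#\<^bsub>G\<^esub> C)) (t (g <#\<^bsub>G\<^esub> C))"
  using assms by (simp add: coinduced_action_def group.inv_inv)

text \<open>
  A common finite family \<open>\<E>\<close> describes all the given cylinder sets, and \<open>f\<close> labels a point of \<open>N\<close> by the members
  of \<open>\<E>\<close> that contain it. The set \<open>B i\<close> imitating \<open>A i\<close> consists of the points whose labels under \<open>f'\<close>, in the
  coordinates \<open>J\<close> and after correction by \<open>k\<close>, are the labels of some point of \<open>A i\<close>. Both for \<open>A\<close> and for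
  \<open>B\<close> the joint events are then described by the same set \<open>\<Psi>\<close> of patterns over the translated coordinates
  \<open>J'\<close>, with the finite set \<open>W\<close> of values of the cocycle as window.
\<close>
theorem coinduced_weakly_embeddable:
  fixes \<Gamma> :: "('g, 'm) monoid_scheme" and H S T :: "'g set"
    and M :: "'x measure" and \<sigma> :: "'g \<Rightarrow> 'x \<Rightarrow> 'x"
    and N :: "'y measure" and \<rho> :: "'g \<Rightarrow> 'y \<Rightarrow> 'y"
  assumes \<Gamma>: "group \<Gamma>" and count: "countable (carrier \<Gamma>)" and H: "subgroup H \<Gamma>"
    and inf: "infinite H" and am: "amenable (\<Gamma>\<lparr>carrier := H\<rparr>)"
    and std: "standard_prob_space M" and \<sigma>: "pmp_action (\<Gamma>\<lparr>carrier := H\<rparr>) M \<sigma>"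
    and free: "free_action (\<Gamma>\<lparr>carrier := H\<rparr>) M \<sigma>"
    and \<rho>: "pmp_action (\<Gamma>\<lparr>carrier := H\<rparr>) N \<rho>"
    and S: "coset_representatives \<Gamma> H S" and T: "coset_representatives \<Gamma> H T"
  shows "weakly_embeddable \<Gamma>
    (coinduced_space \<Gamma> H N) (coinduced_action \<Gamma> H T N \<rho>)
    (coinduced_space \<Gamma> H M) (coinduced_action \<Gamma> H S M \<sigma>)"
proof -
  interpret \<Gamma>: group \<Gamma>
    by (rule \<Gamma>)
  interpret M: pmp "\<Gamma>\<lparr>carrier := H\<rparr>" M \<sigma>
    using \<sigma> by unfold_locales
  interpret N: pmp "\<Gamma>\<lparr>carrier := H\<rparr>" N \<rho>
    using \<rho> by unfold_locales
  note actS = pmp_action_coinduced_action[OF \<Gamma> H S \<sigma>]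
  note actT = pmp_action_coinduced_action[OF \<Gamma> H T \<rho>]
  interpret X: pmp \<Gamma> "coinduced_space \<Gamma> H M" "coinduced_action \<Gamma> H S M \<sigma>"
    using actS by unfold_locales
  interpret Y: pmp \<Gamma> "coinduced_space \<Gamma> H N" "coinduced_action \<Gamma> H T N \<rho>"
    using actT by unfold_locales
  let ?L = "lcosets\<^bsub>\<Gamma>\<^esub> H" and ?X = "coinduced_space \<Gamma> H M" and ?Y = "coinduced_space \<Gamma> H N"
  let ?aS = "coinduced_action \<Gamma> H S M \<sigma>" and ?aT = "coinduced_action \<Gamma> H T N \<rho>"
  have alg: "algebra (space ?Y) (cylinder_sets ?L N)" "sets ?Y = sigma_sets (space ?Y) (cylinder_sets ?L N)"
    unfolding coinduced_space_def by (rule algebra_cylinder_sets sets_PiM_eq_cylinder_sets)+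
  show ?thesis
  proof (rule weakly_embeddableI[OF actT actS alg])
    fix F :: "'g set" and n :: nat and A :: "nat \<Rightarrow> ('g set \<Rightarrow> 'y) set" and \<epsilon> :: real
    assume F: "finite F" "F \<subseteq> carrier \<Gamma>" and A: "\<forall>i\<in>{1..n}. A i \<in> cylinder_sets ?L N" and \<epsilon>: "0 < \<epsilon>"
    have "\<forall>i\<in>{1..n}. \<exists>J \<E>. finitely_determined ?L N J \<E> (A i)"
      using A by (simp add: cylinder_sets_def)
    then obtain J0 \<E>0 where det0: "\<forall>i\<in>{1..n}. finitely_determined ?L N (J0 i) (\<E>0 i) (A i)"
      by metis
    define J where "J = (\<Union>i\<in>{1..n}. J0 i)"
    define \<E> where "\<E> = (\<Union>i\<in>{1..n}. \<E>0 i)"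
    note D = finitely_determinedD[OF bspec[OF det0]]
    have J: "finite J" "J \<subseteq> ?L"
      unfolding J_def by (rule finite_UN_I[OF finite_atLeastAtMost D(2)] UN_least[OF D(3)], assumption)+
    have \<E>: "finite \<E>" "\<E> \<subseteq> sets N"
      unfolding \<E>_def by (rule finite_UN_I[OF finite_atLeastAtMost D(4)] UN_least[OF D(5)], assumption)+
    have det: "finitely_determined ?L N J \<E> (A i)" if "i \<in> {1..n}" for i
      by (rule finitely_determined_mono[OF bspec[OF det0 that] _ J _ \<E>]) (use that in \<open>auto simp: J_def \<E>_def\<close>)
    define f where "f y = {E\<in>\<E>. y \<in> E}" for y
    let ?R = "Pow \<E>"
    have R: "finite ?R" and f: "f \<in> measurable N (count_space ?R)"
      using \<E> measurable_separation[OF \<E>] by (simp_all add: f_def[abs_def])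

    define d where "d g C = coset_cocycle \<Gamma> H T (inv\<^bsub>\<Gamma>\<^esub> g) (g <#\<^bsub>\<Gamma>\<^esub> C)" for g C
    define W where "W = (\<lambda>(g, C). d g C) ` (F \<times> J)"
    define J' where "J' = (\<lambda>(g, C). g <#\<^bsub>\<Gamma>\<^esub> C) ` (F \<times> J)"
    have dW: "d g C \<in> W" and J'I: "g <#\<^bsub>\<Gamma>\<^esub> C \<in> J'" if "g \<in> F" "C \<in> J" for g C
      using that by (auto simp: W_def J'_def)
    have W: "finite W" "W \<subseteq> H"
      using F J lcosets_translate[OF \<Gamma> H] coset_cocycle_in[OF \<Gamma> H T]
      by (auto simp: W_def d_def subset_iff)
    have J': "finite J'" "J' \<subseteq> ?L"
      using F J lcosets_translate[OF \<Gamma> H] by (auto simp: J'_def subset_iff)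
    define Q where "Q = W \<rightarrow>\<^sub>E ?R"
    have Q: "finite Q"
      unfolding Q_def using W R by (intro finite_PiE) auto
    define \<P> where "\<P> = J' \<rightarrow>\<^sub>E Q"
    have \<P>: "finite \<P>"
      unfolding \<P>_def using J' Q by (intro finite_PiE) auto
    \<comment> \<open>A set of patterns has at most \<open>card \<P>\<close> elements, and an error \<open>\<eta>\<close> in each of the \<open>card J'\<close>
      factors changes the probability of a single pattern by at most \<open>card J' * \<eta>\<close>.\<close>
    define \<eta> where "\<eta> = \<epsilon> / (real (card \<P>) * real (card J') + 1)"
    have pos: "0 < real (card \<P>) * real (card J') + 1"
      by (intro add_nonneg_pos mult_nonneg_nonneg) auto
    have \<eta>: "\<eta> > 0"
      using \<epsilon> pos by (simp add: \<eta>_def)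
    have countH: "countable (carrier (\<Gamma>\<lparr>carrier := H\<rparr>))"
      using count subgroup.subset[OF H] by (auto intro: countable_subset)
    have infH: "infinite (carrier (\<Gamma>\<lparr>carrier := H\<rparr>))" and WH: "W \<subseteq> carrier (\<Gamma>\<lparr>carrier := H\<rparr>)"
      using inf W(2) by simp_all
    obtain f' where f': "f' \<in> measurable M (count_space ?R)"
      and close: "\<forall>w\<in>Q. \<bar>measure M {x\<in>space M. \<forall>h\<in>W. f' (\<sigma> h x) = w h} -
        measure N {y\<in>space N. \<forall>h\<in>W. f (\<rho> h y) = w h}\<bar> < \<eta>"
      using amenable_weak_containment[OF am countH infH std \<sigma> free \<rho> R f W(1) WH \<eta>, folded Q_def]
      by (elim bexE) (rule that)

    \<comment> \<open>This correction makes the window elements in the two co-induced actions agree although the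
      representatives differ.\<close>
    define k where "k C = inv\<^bsub>\<Gamma>\<^esub> coset_rep \<Gamma> H T C \<otimes>\<^bsub>\<Gamma>\<^esub> coset_rep \<Gamma> H S C" for C
    have k: "k C \<in> H" if "C \<in> ?L" for C
      unfolding k_def using coset_rep_quotient_in[OF \<Gamma> H S T that] .
    define B where "B i = {t\<in>space ?X. \<exists>s\<in>A i. \<forall>C\<in>J. f (s C) = f' (\<sigma> (k C) (t C))}" for i
    have B: "B i \<in> sets ?X" for i
      unfolding B_def coinduced_space_def
    proof (rule sets_Collect_determined[where V = J and R = ?R and f = "\<lambda>C t. f' (\<sigma> (k C) (t C))"])
      show "(\<lambda>t. f' (\<sigma> (k C) (t C))) \<in> measurable (PiM ?L (\<lambda>_. M)) (count_space ?R)" if "C \<in> J" for C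
      proof -
        have C: "C \<in> ?L"
          using that J by auto
        then have "(\<lambda>t. t C) \<in> measurable (PiM ?L (\<lambda>_. M)) M"
          using measurable_component_singleton[of C ?L "\<lambda>_. M"] by simp
        moreover have "(\<lambda>x. f' (\<sigma> (k C) x)) \<in> measurable M (count_space ?R)"
          using k[OF C] by (intro measurable_compose[OF M.measurable_act f']) simp
        ultimately show ?thesis
          by (rule measurable_compose)
      qed
      show "\<exists>s\<in>A i. \<forall>C\<in>J. f (s C) = f' (\<sigma> (k C) (t' C))"
        if "\<And>C. C \<in> J \<Longrightarrow> f' (\<sigma> (k C) (t C)) = f' (\<sigma> (k C) (t' C))"
          "\<exists>s\<in>A i. \<forall>C\<in>J. f (s C) = f' (\<sigma> (k C) (t C))" for t t'
        using that by simp
    qed (use J R in \<open>auto intro: countable_finite\<close>)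

    define u where "u D y = (\<lambda>h\<in>W. f (\<rho> h y))" for D :: "'g set" and y
    define u' where "u' D x = (\<lambda>h\<in>W. f' (\<sigma> h (\<sigma> (k D) x)))" for D x
    have u: "u D \<in> measurable N (count_space Q)" for D
      unfolding u_def[abs_def] Q_def using W
      by (intro measurable_restrict_count_space R measurable_compose[OF N.measurable_act f]) auto
    have u': "u' D \<in> measurable M (count_space Q)" if "D \<in> J'" for D
      unfolding u'_def[abs_def] Q_def using W J' k[of D] that
      by (intro measurable_restrict_count_space R measurable_compose[OF M.measurable_act]
          measurable_compose[OF M.measurable_act f']) auto
    have factors: "\<bar>measure N {y\<in>space N. u D y = w} - measure M {x\<in>space M. u' D x = w}\<bar> \<le> \<eta>"
      if D: "D \<in> J'" and w: "w \<in> Q" for D w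
    proof -
      have ext: "(\<lambda>h\<in>W. v h) = w \<longleftrightarrow> (\<forall>h\<in>W. v h = w h)" for v
        using w unfolding Q_def by (auto simp: fun_eq_iff PiE_iff extensional_def restrict_def)
      let ?E = "{x\<in>space M. \<forall>h\<in>W. f' (\<sigma> h x) = w h}"
      have E: "?E \<in> sets M"
      proof (rule sets_Collect_determined[where V = W and R = ?R and f = "\<lambda>h x. f' (\<sigma> h x)"])
        show "(\<lambda>x. f' (\<sigma> h x)) \<in> measurable M (count_space ?R)" if "h \<in> W" for h
          using that W by (intro measurable_compose[OF M.measurable_act f']) auto
      qed (use W R in \<open>auto intro: countable_finite\<close>)
      have kD: "k D \<in> carrier (\<Gamma>\<lparr>carrier := H\<rparr>)"
        using k D J' by auto
      have "{x\<in>space M. u' D x = w} = {x\<in>space M. \<sigma> (k D) x \<in> ?E}"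
        using M.act_space[OF kD] unfolding u'_def ext by auto
      then have "measure M {x\<in>space M. u' D x = w} = measure M ?E"
        using M.measure_act[OF kD E] by simp
      moreover have "{y\<in>space N. u D y = w} = {y\<in>space N. \<forall>h\<in>W. f (\<rho> h y) = w h}"
        unfolding u_def ext ..
      ultimately show ?thesis
        using bspec[OF close w] by simp
    qed
    have patterns: "\<bar>measure ?Y {t\<in>space ?Y. (\<lambda>D\<in>J'. u D (t D)) \<in> \<Psi>} -
        measure ?X {t\<in>space ?X. (\<lambda>D\<in>J'. u' D (t D)) \<in> \<Psi>}\<bar> < \<epsilon>" if \<Psi>: "\<Psi> \<subseteq> \<P>" for \<Psi>
    proof -
      let ?a = "\<lambda>\<pi> D. measure N {y\<in>space N. u D y = \<pi> D}"
      let ?b = "\<lambda>\<pi> D. measure M {x\<in>space M. u' D x = \<pi> D}"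
      have a: "measure ?Y {t\<in>space ?Y. (\<lambda>D\<in>J'. u D (t D)) \<in> \<Psi>} = (\<Sum>\<pi>\<in>\<Psi>. \<Prod>D\<in>J'. ?a \<pi> D)"
        unfolding coinduced_space_def
        by (rule measure_PiM_pattern[OF N.prob_space_axioms J' Q u \<Psi>[unfolded \<P>_def]])
      have b: "measure ?X {t\<in>space ?X. (\<lambda>D\<in>J'. u' D (t D)) \<in> \<Psi>} = (\<Sum>\<pi>\<in>\<Psi>. \<Prod>D\<in>J'. ?b \<pi> D)"
        unfolding coinduced_space_def
        by (rule measure_PiM_pattern[OF M.prob_space_axioms J' Q u' \<Psi>[unfolded \<P>_def]])
      have "\<bar>(\<Prod>D\<in>J'. ?a \<pi> D) - (\<Prod>D\<in>J'. ?b \<pi> D)\<bar> \<le> card J' * \<eta>" if "\<pi> \<in> \<Psi>" for \<pi>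
      proof -
        have "\<pi> D \<in> Q" if "D \<in> J'" for D
          using \<open>\<pi> \<in> \<Psi>\<close> \<Psi> that by (auto simp: \<P>_def)
        have "norm ((\<Prod>D\<in>J'. ?a \<pi> D) - (\<Prod>D\<in>J'. ?b \<pi> D)) \<le> (\<Sum>D\<in>J'. norm (?a \<pi> D - ?b \<pi> D))"
          by (rule norm_prod_diff) simp_all
        also have "\<dots> \<le> (\<Sum>D\<in>J'. \<eta>)"
          using factors \<open>\<And>D. D \<in> J' \<Longrightarrow> \<pi> D \<in> Q\<close> by (intro sum_mono) simp
        finally show ?thesis by simp
      qed
      then have "(\<Sum>\<pi>\<in>\<Psi>. \<bar>(\<Prod>D\<in>J'. ?a \<pi> D) - (\<Prod>D\<in>J'. ?b \<pi> D)\<bar>) \<le> (\<Sum>\<pi>\<in>\<Psi>. card J' * \<eta>)"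
        by (rule sum_mono)
      also have "\<dots> \<le> card \<P> * (card J' * \<eta>)"
        using card_mono[OF \<P> \<Psi>] \<eta> by (simp add: mult_right_mono)
      also have "\<dots> = (real (card \<P>) * real (card J')) * \<eta>"
        by simp
      also have "\<dots> < \<epsilon>"
        using \<epsilon> pos by (simp add: \<eta>_def field_simps)
      finally show ?thesis
        unfolding a b sum_subtractf[symmetric] using sum_abs by (rule le_less_trans[rotated])
    qed

    show "\<exists>B. (\<forall>i\<in>{1..n}. B i \<in> sets ?X) \<and>
        (\<forall>k (g :: nat \<Rightarrow> 'g) m. (\<forall>i\<in>{1..k::nat}. g i \<in> F \<and> m i \<in> {1..n}) \<longrightarrow>
          \<bar>measure ?Y {x\<in>space ?Y. \<forall>i\<in>{1..k}. ?aT (inv\<^bsub>\<Gamma>\<^esub> (g i)) x \<in> A (m i)} -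
           measure ?X {y\<in>space ?X. \<forall>i\<in>{1..k}. ?aS (inv\<^bsub>\<Gamma>\<^esub> (g i)) y \<in> B (m i)}\<bar> < \<epsilon>)"
    proof (intro exI[of _ B] conjI ballI allI impI B)
      fix l :: nat and g :: "nat \<Rightarrow> 'g" and m :: "nat \<Rightarrow> nat"
      assume gm: "\<forall>i\<in>{1..l}. g i \<in> F \<and> m i \<in> {1..n}"
      define \<Psi> where "\<Psi> = {\<pi>\<in>\<P>. \<forall>i\<in>{1..l}. \<exists>s\<in>A (m i). \<forall>C\<in>J.
        f (s C) = \<pi> (g i <#\<^bsub>\<Gamma>\<^esub> C) (d (g i) C)}"
      have Y_iff: "?aT (inv\<^bsub>\<Gamma>\<^esub> h) t \<in> A j \<longleftrightarrow>
          (\<exists>s\<in>A j. \<forall>C\<in>J. f (s C) = (\<lambda>D\<in>J'. u D (t D)) (h <#\<^bsub>\<Gamma>\<^esub> C) (d h C))"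
        if t: "t \<in> space ?Y" and h: "h \<in> F" and j: "j \<in> {1..n}" for t h j
      proof -
        have hG: "h \<in> carrier \<Gamma>"
          using h F by auto
        have eq: "(\<lambda>D\<in>J'. u D (t D)) (h <#\<^bsub>\<Gamma>\<^esub> C) (d h C) = f (?aT (inv\<^bsub>\<Gamma>\<^esub> h) t C)" if "C \<in> J" for C
          using coinduced_action_inv_apply[OF \<Gamma> hG subsetD[OF J(2) that] t, of T \<rho>] dW[OF h that] J'I[OF h that]
          by (simp add: u_def d_def)
        have sp: "?aT (inv\<^bsub>\<Gamma>\<^esub> h) t \<in> space (PiM ?L (\<lambda>_. N))"
          using Y.act_space[of "inv\<^bsub>\<Gamma>\<^esub> h" t] hG t by (simp add: coinduced_space_def)
        show ?thesis
        proof
          assume "?aT (inv\<^bsub>\<Gamma>\<^esub> h) t \<in> A j"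
          then show "\<exists>s\<in>A j. \<forall>C\<in>J. f (s C) = (\<lambda>D\<in>J'. u D (t D)) (h <#\<^bsub>\<Gamma>\<^esub> C) (d h C)"
            by (rule bexI[rotated]) (intro ballI eq[symmetric])
        next
          assume "\<exists>s\<in>A j. \<forall>C\<in>J. f (s C) = (\<lambda>D\<in>J'. u D (t D)) (h <#\<^bsub>\<Gamma>\<^esub> C) (d h C)"
          then obtain s where s1: "s \<in> A j" "\<forall>C\<in>J. f (s C) = (\<lambda>D\<in>J'. u D (t D)) (h <#\<^bsub>\<Gamma>\<^esub> C) (d h C)"
            by (rule bexE)
          have s: "s \<in> A j" "\<forall>C\<in>J. f (s C) = f (?aT (inv\<^bsub>\<Gamma>\<^esub> h) t C)"
            using s1 eq by (auto simp del: restrict_apply)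
          have "separated_alike J \<E> s (?aT (inv\<^bsub>\<Gamma>\<^esub> h) t)"
            using s(2) unfolding separated_alike_iff f_def .
          then show "?aT (inv\<^bsub>\<Gamma>\<^esub> h) t \<in> A j"
            by (rule finitely_determined_step[OF det[OF j] s(1) sp])
        qed
      qed
      have X_iff: "?aS (inv\<^bsub>\<Gamma>\<^esub> h) t \<in> B j \<longleftrightarrow>
          (\<exists>s\<in>A j. \<forall>C\<in>J. f (s C) = (\<lambda>D\<in>J'. u' D (t D)) (h <#\<^bsub>\<Gamma>\<^esub> C) (d h C))"
        if t: "t \<in> space ?X" and h: "h \<in> F" for t h j
      proof -
        have hG: "h \<in> carrier \<Gamma>" and hG': "inv\<^bsub>\<Gamma>\<^esub> h \<in> carrier \<Gamma>"
          using h F by auto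
        have eq: "(\<lambda>D\<in>J'. u' D (t D)) (h <#\<^bsub>\<Gamma>\<^esub> C) (d h C) = f' (\<sigma> (k C) (?aS (inv\<^bsub>\<Gamma>\<^esub> h) t C))" if C: "C \<in> J" for C
        proof -
          let ?D = "h <#\<^bsub>\<Gamma>\<^esub> C"
          have CL: "C \<in> ?L" and D: "?D \<in> ?L"
            using C J lcosets_translate[OF \<Gamma> H hG] by auto
          have DC: "inv\<^bsub>\<Gamma>\<^esub> h <#\<^bsub>\<Gamma>\<^esub> ?D = C"
            using lcosets_translate_translate[OF \<Gamma> H hG' hG CL] lcosets_translate_one[OF \<Gamma> H CL] hG by simp
          have tD: "t ?D \<in> space M"
            using t D by (auto simp: space_coinduced_space)
          have cS: "coset_cocycle \<Gamma> H S (inv\<^bsub>\<Gamma>\<^esub> h) ?D \<in> H"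
            by (rule coset_cocycle_in[OF \<Gamma> H S hG' D])
          have "k C \<otimes>\<^bsub>\<Gamma>\<^esub> coset_cocycle \<Gamma> H S (inv\<^bsub>\<Gamma>\<^esub> h) ?D = d h C \<otimes>\<^bsub>\<Gamma>\<^esub> k ?D"
            using coset_cocycle_change[OF \<Gamma> H S T hG' D] by (simp add: k_def d_def DC)
          then have "\<sigma> (k C) (\<sigma> (coset_cocycle \<Gamma> H S (inv\<^bsub>\<Gamma>\<^esub> h) ?D) (t ?D)) = \<sigma> (d h C) (\<sigma> (k ?D) (t ?D))"
            using M.act_mult[of "k C" "coset_cocycle \<Gamma> H S (inv\<^bsub>\<Gamma>\<^esub> h) ?D" "t ?D"]
              M.act_mult[of "d h C" "k ?D" "t ?D"] k[OF CL] k[OF D] cS tD subsetD[OF W(2) dW[OF h C]] by simp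
          then show ?thesis
            using coinduced_action_inv_apply[OF \<Gamma> hG CL t, of S \<sigma>] dW[OF h C] J'I[OF h C]
            by (simp add: u'_def)
        qed
        have "?aS (inv\<^bsub>\<Gamma>\<^esub> h) t \<in> space ?X"
          by (rule X.act_space[OF hG' t])
        then show ?thesis
          by (simp add: B_def eq del: restrict_apply cong: ball_cong)
      qed
      have Y_\<P>: "(\<lambda>D\<in>J'. u D (t D)) \<in> \<P>" if "t \<in> space ?Y" for t
        using that J' measurable_space[OF u] unfolding \<P>_def space_coinduced_space by auto
      have X_\<P>: "(\<lambda>D\<in>J'. u' D (t D)) \<in> \<P>" if "t \<in> space ?X" for t
        using that J' measurable_space[OF u'] unfolding \<P>_def space_coinduced_space by auto
      have "{x\<in>space ?Y. \<forall>i\<in>{1..l}. ?aT (inv\<^bsub>\<Gamma>\<^esub> (g i)) x \<in> A (m i)} = {t\<in>space ?Y. (\<lambda>D\<in>J'. u D (t D)) \<in> \<Psi>}"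
      proof (intro Collect_cong conj_cong refl)
        fix t assume t: "t \<in> space ?Y"
        have "(\<forall>i\<in>{1..l}. ?aT (inv\<^bsub>\<Gamma>\<^esub> (g i)) t \<in> A (m i)) \<longleftrightarrow> (\<forall>i\<in>{1..l}. \<exists>s\<in>A (m i). \<forall>C\<in>J.
            f (s C) = (\<lambda>D\<in>J'. u D (t D)) (g i <#\<^bsub>\<Gamma>\<^esub> C) (d (g i) C))"
          using gm by (intro ball_cong refl Y_iff t) simp_all
        then show "(\<forall>i\<in>{1..l}. ?aT (inv\<^bsub>\<Gamma>\<^esub> (g i)) t \<in> A (m i)) \<longleftrightarrow> (\<lambda>D\<in>J'. u D (t D)) \<in> \<Psi>"
          using Y_\<P>[OF t] by (simp only: \<Psi>_def mem_Collect_eq simp_thms)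
      qed
      moreover have "{y\<in>space ?X. \<forall>i\<in>{1..l}. ?aS (inv\<^bsub>\<Gamma>\<^esub> (g i)) y \<in> B (m i)} = {t\<in>space ?X. (\<lambda>D\<in>J'. u' D (t D)) \<in> \<Psi>}"
      proof (intro Collect_cong conj_cong refl)
        fix t assume t: "t \<in> space ?X"
        have "(\<forall>i\<in>{1..l}. ?aS (inv\<^bsub>\<Gamma>\<^esub> (g i)) t \<in> B (m i)) \<longleftrightarrow> (\<forall>i\<in>{1..l}. \<exists>s\<in>A (m i). \<forall>C\<in>J.
            f (s C) = (\<lambda>D\<in>J'. u' D (t D)) (g i <#\<^bsub>\<Gamma>\<^esub> C) (d (g i) C))"
          using gm by (intro ball_cong refl X_iff t) simp_all
        then show "(\<forall>i\<in>{1..l}. ?aS (inv\<^bsub>\<Gamma>\<^esub> (g i)) t \<in> B (m i)) \<longleftrightarrow> (\<lambda>D\<in>J'. u' D (t D)) \<in> \<Psi>"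
          using X_\<P>[OF t] by (simp only: \<Psi>_def mem_Collect_eq simp_thms)
      qed
      ultimately show "\<bar>measure ?Y {x\<in>space ?Y. \<forall>i\<in>{1..l}. ?aT (inv\<^bsub>\<Gamma>\<^esub> (g i)) x \<in> A (m i)} -
           measure ?X {y\<in>space ?X. \<forall>i\<in>{1..l}. ?aS (inv\<^bsub>\<Gamma>\<^esub> (g i)) y \<in> B (m i)}\<bar> < \<epsilon>"
        using patterns[of \<Psi>] by (simp add: \<Psi>_def)
    qed
  qed
qed

theorem corollary3p9:
  fixes \<Gamma> :: "('g, 'm) monoid_scheme" and H S T :: "'g set"
    and M :: "'x measure" and \<sigma> :: "'g \<Rightarrow> 'x \<Rightarrow> 'x"
    and N :: "'y measure" and \<rho> :: "'g \<Rightarrow> 'y \<Rightarrow> 'y"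
  assumes "group \<Gamma>" and "countable (carrier \<Gamma>)"
    and "subgroup H \<Gamma>" and "infinite H" and "amenable (\<Gamma>\<lparr>carrier := H\<rparr>)"
    and "standard_prob_space M" and "pmp_action (\<Gamma>\<lparr>carrier := H\<rparr>) M \<sigma>"
    and "free_action (\<Gamma>\<lparr>carrier := H\<rparr>) M \<sigma>" and "ergodic_action (\<Gamma>\<lparr>carrier := H\<rparr>) M \<sigma>"
    and "standard_prob_space N" and "pmp_action (\<Gamma>\<lparr>carrier := H\<rparr>) N \<rho>"
    and "free_action (\<Gamma>\<lparr>carrier := H\<rparr>) N \<rho>" and "ergodic_action (\<Gamma>\<lparr>carrier := H\<rparr>) N \<rho>"
    and "coset_representatives \<Gamma> H S" and "coset_representatives \<Gamma> H T"
  shows "weakly_conjugate \<Gamma>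
    (coinduced_space \<Gamma> H M) (coinduced_action \<Gamma> H S M \<sigma>)
    (coinduced_space \<Gamma> H N) (coinduced_action \<Gamma> H T N \<rho>)"
  unfolding weakly_conjugate_def
  using coinduced_weakly_embeddable[OF assms(1-5) assms(10-12) assms(7) assms(15,14)]
    coinduced_weakly_embeddable[OF assms(1-5) assms(6-8) assms(11) assms(14,15)]
  by blast

end
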